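(* For $i=1,2$, let $\overline{X_i}=\varprojlim\{X_{i,k},f_{i,k}\}$ be a compact connected orientable branched matchbox manifold with a presentation $\{X_{i,k},f_{i,k}\}_k$ (as described in the context) satisfying the Simplicity Condition: for each $k\ge1$ there exists $\kappa(k)\ge k$ such that for every $l\ge\kappa(k)$ and every edge $e$ of $X_{i,l}$, $f_{i,k+1}\circ\cdots\circ f_{i,l}(e)=X_{i,k}$. If $\overline{X_1}$ is homeomorphic to $\overline{X_2}$, then $\varinjlim\mathcal{G}_1^k$ is order isomorphic to $\varinjlim\mathcal{G}_2^k$, where $\varinjlim\mathcal{G}_i^k$ is the direct limit of the graph groups of $\{X_{i,k},f_{i,k}\}_k$ with the standard order.
   Context: **Branched matchbox manifolds.** A branched matchbox is a space homeomorphic to $U=\bigl((S_1\times(-1,0])\cup(S_2\times[0,1))\bigr)/\sim$, where $S_1,S_2$ are (disjoint) zero-dimensional compact separable metrizable spaces and there is a closed equivalence relation $\approx$ on $S_1\cup S_2$ such that: every element of $S_1$ is $\approx$-equivalent to at least one element of $S_2$ and every element of $S_2$ to at least one element of $S_1$; $(S_1\cup S_2)/{\approx}$ is a zero-dimensional metrizable space in the quotient topology; and $(s,i)\sim(s',j)$ iff either $s\approx s'$ and $i=j=0$, or $s=s'$ and $i=j$. Its projection is $p_U\colon U\to(-1,1)$, $[(z,j)]\mapsto j$. A branched matchbox manifold is a separable metrizable space $Y$ with a collection of charts, i.e. homeomorphisms $h\colon V\to U$ from open subsets $V$ of $Y$ onto branched matchboxes, whose domains cover $Y$ and whose changes of coordinates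 are continuous. $Y$ is orientable if it is covered by domains of charts $h_i\colon V_i\to U_i$ (with projections $p_i$) such that for all $i,j$ and every locally one-to-one curve $\gamma\colon[0,1]\to V_i\cap V_j$, $p_i\circ h_i\circ\gamma$ is increasing iff $p_j\circ h_j\circ\gamma$ is increasing; a maximal such collection of charts is an orientation. A locally one-to-one curve in $Y$ is orientation preserving if $p_i\circ h_i\circ\gamma$ is increasing on each interval that $\gamma$ maps into $V_i$. **Graphs.** A graph is finite, directed and nondegenerate (every vertex has at least one incoming and at least one outgoing edge). A directed edge $e$ is parameterized as $e(t)$, $t\in[0,1]$, with initial vertex $e(0)$ and terminal vertex $e(1)$ (possibly equal). A continuous path $p$ in a directed graph is orientation preserving if $e^{-1}\circ p$ is increasing on every interval that $p$ maps into a directed edge $e$. A continuous map of directed graphs is orientation preserving if it sends orientation preserving paths to orientation preserving paths. **Presentation.** A presentation $\{X_k,f_k\}$ of $\overline{X}$ means here $\overline{X}=\{(x_0,x_1,\dots)\in\prod_{k\ge0} X_k: f_{k+1}(x_{k+1})=x_k\}$, where each $X_k$ is a graph with a fixed vertex set $\mathcal{V}_k$ and set of directed edges $\mathcal{E}_k$, and each $f_k\colon X_k\to X_{k-1}$ is a continuous onto orientation preserving map with $f_k(\mathcal{V}_k)\subset\mathcal{V}_{k-1}$ and $f_k|_{X_k\setminus\mathcal{V}_k}$ locally one-to-one. The edge directions are induced by an orientation of $\overline{X}$, so the projections $\overline{X}\to X_k$ carry orientation preserving curves to orientation preserving curves. **Graph groups and standard order.** $C(\mathcal{E}_k,\mathbb{Z})$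 is the group of functions $\mathcal{E}_k\to\mathbb{Z}$ and $C_+(\mathcal{E}_k,\mathbb{Z})$ the nonnegative ones. For a vertex $p_i$ of $X_k$, the vertex function $v_i$ is $1$ on edges from $p_i$ to another vertex, $-1$ on edges from another vertex to $p_i$, and $0$ on all other edges. $V_k$ is the subgroup generated by the $v_i$, $\mathcal{G}^k=C(\mathcal{E}_k,\mathbb{Z})/V_k$, and $\mathcal{G}^k_+$ is the image of $C_+(\mathcal{E}_k,\mathbb{Z})$. For $e\in\mathcal{E}_{k+1}$ with $f_{k+1}(e)=e_1\cdots e_n$ (a path of edges of $X_k$), $f^*_{k+1}(g)(e)=\sum_i g(e_i)$ induces $f^*_{k+1}\colon\mathcal{G}^k\to\mathcal{G}^{k+1}$. $\varinjlim\mathcal{G}^k$ is the direct limit along these maps; the standard order has positive cone $\varinjlim\mathcal{G}^k_+$. Two (pre)ordered groups are order isomorphic if there is a group isomorphism carrying one positive cone onto the other. *)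

theory Defs
  imports "HOL-Analysis.Analysis" "HOL-Algebra.Product_Groups" "HOL-Algebra.Coset"
    "HOL-Algebra.Generated_Groups"
begin

section \<open>Topological preliminaries\<close>

definition quotient_topology :: "'a topology \<Rightarrow> ('a \<times> 'a) set \<Rightarrow> 'a set topology" where
  "quotient_topology X R = topology (\<lambda>\<U>. \<U> \<subseteq> topspace X // R \<and> openin X (\<Union>\<U>))"

lemma openin_quotient_topology:
  assumes R: "equiv (topspace X) R"
  shows "openin (quotient_topology X R) \<U> \<longleftrightarrow> \<U> \<subseteq> topspace X // R \<and> openin X (\<Union>\<U>)"
proof -
  have "istopology (\<lambda>\<U>. \<U> \<subseteq> topspace X // R \<and> openin X (\<Union>\<U>))"
    unfolding istopology_def
  proof (intro conjI allI impI; (elim conjE)?)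
    fix \<U> \<V>
    assume U: "\<U> \<subseteq> topspace X // R" "openin X (\<Union>\<U>)"
      and V: "\<V> \<subseteq> topspace X // R" "openin X (\<Union>\<V>)"
    show "\<U> \<inter> \<V> \<subseteq> topspace X // R" using U(1) by blast
    have "\<Union>(\<U> \<inter> \<V>) = \<Union>\<U> \<inter> \<Union>\<V>"
    proof
      show "\<Union>\<U> \<inter> \<Union>\<V> \<subseteq> \<Union>(\<U> \<inter> \<V>)"
      proof
        fix x assume "x \<in> \<Union>\<U> \<inter> \<Union>\<V>"
        then obtain A B where AB: "A \<in> \<U>" "B \<in> \<V>" "x \<in> A" "x \<in> B" by blast
        then have "A = B" using quotient_disj[OF R, of A B] U(1) V(1) by blast
        with AB show "x \<in> \<Union>(\<U> \<inter> \<V>)" by blast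
      qed
    qed blast
    then show "openin X (\<Union>(\<U> \<inter> \<V>))" using U(2) V(2) by (simp add: openin_Int)
  next
    fix \<K> :: "'a set set set"
    assume K: "\<forall>\<U>\<in>\<K>. \<U> \<subseteq> topspace X // R \<and> openin X (\<Union>\<U>)"
    show "\<Union>\<K> \<subseteq> topspace X // R" using K by blast
    have "\<Union>(\<Union>\<K>) = \<Union>(Union ` \<K>)" by blast
    then show "openin X (\<Union>(\<Union>\<K>))" using K by (metis (no_types, lifting) imageE openin_Union)
  qed
  then show ?thesis unfolding quotient_topology_def by simp
qed

lemma topspace_quotient_topology:
  assumes "equiv (topspace X) R"
  shows "topspace (quotient_topology X R) = topspace X // R"
proof -
  have "openin (quotient_topology X R) (topspace X // R)"
    using assms by (simp add: openin_quotient_topology Union_quotient)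
  then show ?thesis
    by (metis assms openin_quotient_topology openin_subset openin_topspace subset_antisym)
qed

lemma quotient_map_quotient_topology:
  assumes R: "equiv (topspace X) R"
  shows "quotient_map X (quotient_topology X R) (\<lambda>x. R `` {x})"
  unfolding quotient_map_def topspace_quotient_topology[OF R] openin_quotient_topology[OF R]
proof (intro conjI allI impI)
  show im: "(\<lambda>x. R `` {x}) ` topspace X = topspace X // R" by (auto simp: quotient_def)
  fix \<U> assume U: "\<U> \<subseteq> topspace X // R"
  have "{x \<in> topspace X. R `` {x} \<in> \<U>} = \<Union>\<U>"
  proof (intro equalityI subsetI)
    fix x assume "x \<in> {x \<in> topspace X. R `` {x} \<in> \<U>}"
    then show "x \<in> \<Union>\<U>" using equiv_class_self[OF R] by blast
  next
    fix x assume "x \<in> \<Union>\<U>"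
    then obtain A where A: "A \<in> \<U>" "x \<in> A" by blast
    then have x: "x \<in> topspace X" using U Union_quotient[OF R] by blast
    have "R `` {x} = A"
      using quotient_disj[OF R quotientI[OF x] subsetD[OF U A(1)]] equiv_class_self[OF R x] A(2)
      by blast
    with A x show "x \<in> {x \<in> topspace X. R `` {x} \<in> \<U>}" by blast
  qed
  then show "openin X {x \<in> topspace X. R `` {x} \<in> \<U>} = (\<U> \<subseteq> topspace X // R \<and> openin X (\<Union>\<U>))"
    using U by simp
qed

definition locally_one_to_one :: "'a topology \<Rightarrow> ('a \<Rightarrow> 'b) \<Rightarrow> bool" where
  "locally_one_to_one X f \<longleftrightarrow> (\<forall>x\<in>topspace X. \<exists>U. openin X U \<and> x \<in> U \<and> inj_on f U)"

definition loc_inj_curve :: "'a topology \<Rightarrow> (real \<Rightarrow> 'a) \<Rightarrow> bool" where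
  "loc_inj_curve Y \<gamma> \<longleftrightarrow> pathin Y \<gamma> \<and> locally_one_to_one (top_of_set {0..1}) \<gamma>"

section \<open>Branched matchbox manifolds\<close>

datatype side = Incoming | Outgoing

text \<open>
  The sets \<open>S\<^sub>1\<close> and \<open>S\<^sub>2\<close> are \<open>mfibre M Incoming\<close> and \<open>mfibre M Outgoing\<close>, made disjoint by
  tagging. They are abstract topologies whose points are named by real numbers; this is no
  restriction, since a compact metrizable space has at most continuum many points.
\<close>
record matchbox =
  mfibre :: "side \<Rightarrow> real topology"
  mident :: "((side \<times> real) \<times> (side \<times> real)) set"

definition end_space :: "matchbox \<Rightarrow> (side \<times> real) topology" where
  "end_space M = sum_topology (mfibre M) UNIV"

definition is_matchbox :: "matchbox \<Rightarrow> bool" where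
  "is_matchbox M \<longleftrightarrow>
     (\<forall>i. compact_space (mfibre M i) \<and> separable_space (mfibre M i) \<and>
          metrizable_space (mfibre M i) \<and> mfibre M i dim_le 0) \<and>
     equiv (topspace (end_space M)) (mident M) \<and>
     closedin (prod_topology (end_space M) (end_space M)) (mident M) \<and>
     (\<forall>s\<in>topspace (mfibre M Incoming). \<exists>s'\<in>topspace (mfibre M Outgoing).
        ((Incoming, s), (Outgoing, s')) \<in> mident M) \<and>
     (\<forall>s\<in>topspace (mfibre M Outgoing). \<exists>s'\<in>topspace (mfibre M Incoming).
        ((Outgoing, s), (Incoming, s')) \<in> mident M) \<and>
     metrizable_space (quotient_topology (end_space M) (mident M)) \<and>
     quotient_topology (end_space M) (mident M) dim_le 0"

fun side_interval :: "side \<Rightarrow> real set" where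
  "side_interval Incoming = {-1<..0}"
| "side_interval Outgoing = {0..<1}"

definition strip_space :: "matchbox \<Rightarrow> (side \<times> real \<times> real) topology" where
  "strip_space M =
     sum_topology (\<lambda>i. prod_topology (mfibre M i) (top_of_set (side_interval i))) UNIV"

definition strip_rel :: "matchbox \<Rightarrow> ((side \<times> real \<times> real) \<times> (side \<times> real \<times> real)) set" where
  "strip_rel M = {((i, s, t), (j, s', t')).
     (i, s, t) \<in> topspace (strip_space M) \<and> (j, s', t') \<in> topspace (strip_space M) \<and>
     (((i, s), (j, s')) \<in> mident M \<and> t = 0 \<and> t' = 0 \<or> (i, s) = (j, s') \<and> t = t')}"

definition matchbox_space :: "matchbox \<Rightarrow> (side \<times> real \<times> real) set topology" where
  "matchbox_space M = quotient_topology (strip_space M) (strip_rel M)"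

lemma equiv_strip_rel:
  assumes "is_matchbox M"
  shows "equiv (topspace (strip_space M)) (strip_rel M)"
proof -
  have E: "equiv (topspace (end_space M)) (mident M)"
    using assms by (simp add: is_matchbox_def)
  show ?thesis
  proof (rule equivI)
    show "strip_rel M \<subseteq> topspace (strip_space M) \<times> topspace (strip_space M)"
      by (auto simp: strip_rel_def)
    show "refl_on (topspace (strip_space M)) (strip_rel M)"
      by (auto simp: refl_on_def strip_rel_def)
    show "sym (strip_rel M)"
      using E by (auto simp: sym_def strip_rel_def elim!: equivE)
    show "trans (strip_rel M)"
      unfolding trans_def strip_rel_def using E by (auto elim!: equivE dest: transD)
  qed
qed

definition matchbox_proj :: "(side \<times> real \<times> real) set \<Rightarrow> real" where
  "matchbox_proj c = (THE t. \<exists>i s. (i, s, t) \<in> c)"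

lemma matchbox_proj_class:
  assumes "(i, s, t) \<in> topspace (strip_space M)"
  shows "matchbox_proj (strip_rel M `` {(i, s, t)}) = t"
  unfolding matchbox_proj_def
proof (rule the_equality)
  show "\<exists>j s'. (j, s', t) \<in> strip_rel M `` {(i, s, t)}"
    using assms by (auto simp: strip_rel_def)
qed (auto simp: strip_rel_def)

text \<open>
  The target of a chart is the concrete quotient space \<^term>\<open>matchbox_space M\<close>; a homeomorphism onto
  a copy of it amounts to the same thing.
\<close>
record 'y chart =
  cdom :: "'y set"
  cbox :: matchbox
  cmap :: "'y \<Rightarrow> (side \<times> real \<times> real) set"

definition is_chart :: "'y topology \<Rightarrow> 'y chart \<Rightarrow> bool" where
  "is_chart Y c \<longleftrightarrow> openin Y (cdom c) \<and> is_matchbox (cbox c) \<and>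
     homeomorphic_map (subtopology Y (cdom c)) (matchbox_space (cbox c)) (cmap c)"

definition chart_height :: "'y chart \<Rightarrow> 'y \<Rightarrow> real" where
  "chart_height c = matchbox_proj \<circ> cmap c"

definition atlas :: "'y topology \<Rightarrow> 'y chart set \<Rightarrow> bool" where
  "atlas Y \<A> \<longleftrightarrow> (\<forall>c\<in>\<A>. is_chart Y c) \<and> \<Union>(cdom ` \<A>) = topspace Y \<and>
     (\<forall>c\<in>\<A>. \<forall>d\<in>\<A>. continuous_map
        (subtopology (matchbox_space (cbox c)) (cmap c ` (cdom c \<inter> cdom d)))
        (subtopology (matchbox_space (cbox d)) (cmap d ` (cdom c \<inter> cdom d)))
        (cmap d \<circ> inv_into (cdom c) (cmap c)))"

definition branched_matchbox_manifold :: "'y topology \<Rightarrow> bool" where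
  "branched_matchbox_manifold Y \<longleftrightarrow>
     separable_space Y \<and> metrizable_space Y \<and> (\<exists>\<A>. atlas Y \<A>)"

definition oriented_atlas :: "'y topology \<Rightarrow> 'y chart set \<Rightarrow> bool" where
  "oriented_atlas Y \<A> \<longleftrightarrow> atlas Y \<A> \<and>
     (\<forall>c\<in>\<A>. \<forall>d\<in>\<A>. \<forall>\<gamma>. loc_inj_curve Y \<gamma> \<and> \<gamma> ` {0..1} \<subseteq> cdom c \<inter> cdom d \<longrightarrow>
        (strict_mono_on {0..1} (chart_height c \<circ> \<gamma>) \<longleftrightarrow>
         strict_mono_on {0..1} (chart_height d \<circ> \<gamma>)))"

definition orientable :: "'y topology \<Rightarrow> bool" where
  "orientable Y \<longleftrightarrow> (\<exists>\<A>. oriented_atlas Y \<A>)"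

definition orientation :: "'y topology \<Rightarrow> 'y chart set \<Rightarrow> bool" where
  "orientation Y \<O> \<longleftrightarrow> oriented_atlas Y \<O> \<and>
     (\<forall>\<A>. oriented_atlas Y \<A> \<and> \<O> \<subseteq> \<A> \<longrightarrow> \<A> = \<O>)"

definition op_curve :: "'y topology \<Rightarrow> 'y chart set \<Rightarrow> (real \<Rightarrow> 'y) \<Rightarrow> bool" where
  "op_curve Y \<O> \<gamma> \<longleftrightarrow> loc_inj_curve Y \<gamma> \<and>
     (\<forall>c\<in>\<O>. \<forall>J. is_interval J \<and> J \<subseteq> {0..1} \<and> \<gamma> ` J \<subseteq> cdom c \<longrightarrow>
        strict_mono_on J (chart_height c \<circ> \<gamma>))"

section \<open>Directed graphs\<close>

record ('v, 'e) digraph =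
  gspace :: "'v topology"
  gverts :: "'v set"
  gedges :: "'e set"
  gparam :: "'e \<Rightarrow> real \<Rightarrow> 'v"

text \<open>
  A Hausdorff space that is the disjoint union of a finite vertex set and finitely many
  injectively parameterized open edges with end points in the vertex set automatically carries
  the usual (quotient) topology of a finite graph.
\<close>
definition finite_digraph :: "('v, 'e) digraph \<Rightarrow> bool" where
  "finite_digraph G \<longleftrightarrow> Hausdorff_space (gspace G) \<and> finite (gverts G) \<and> finite (gedges G) \<and>
     (\<forall>e\<in>gedges G. pathin (gspace G) (gparam G e) \<and>
        gparam G e 0 \<in> gverts G \<and> gparam G e 1 \<in> gverts G \<and>
        inj_on (gparam G e) {0<..<1} \<and> disjnt (gparam G e ` {0<..<1}) (gverts G)) \<and>
     (\<forall>e\<in>gedges G. \<forall>e'\<in>gedges G. e \<noteq> e' \<longrightarrow>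
        disjnt (gparam G e ` {0<..<1}) (gparam G e' ` {0<..<1})) \<and>
     topspace (gspace G) = gverts G \<union> (\<Union>e\<in>gedges G. gparam G e ` {0<..<1}) \<and>
     (\<forall>v\<in>gverts G. (\<exists>e\<in>gedges G. gparam G e 1 = v) \<and> (\<exists>e\<in>gedges G. gparam G e 0 = v))"

text \<open>
  If \<open>e\<close> is a loop, then \<open>e\<^sup>-\<^sup>1\<close> has two values at the vertex, and \<open>e\<^sup>-\<^sup>1 \<circ> p\<close> is read as any continuous
  branch \<open>\<phi>\<close>, that is, \<open>p = e \<circ> \<phi>\<close> on \<open>J\<close>. If \<open>e\<close> is not a loop, then \<open>\<phi> = e\<^sup>-\<^sup>1 \<circ> p\<close>.
\<close>
definition op_path :: "('v, 'e) digraph \<Rightarrow> (real \<Rightarrow> 'v) \<Rightarrow> bool" where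
  "op_path G p \<longleftrightarrow> pathin (gspace G) p \<and>
     (\<forall>e\<in>gedges G. \<forall>J \<phi>. is_interval J \<and> J \<subseteq> {0..1} \<and>
        continuous_on J \<phi> \<and> \<phi> ` J \<subseteq> {0..1} \<and> (\<forall>t\<in>J. p t = gparam G e (\<phi> t)) \<longrightarrow>
        strict_mono_on J \<phi>)"

definition op_map :: "('v, 'e) digraph \<Rightarrow> ('w, 'd) digraph \<Rightarrow> ('v \<Rightarrow> 'w) \<Rightarrow> bool" where
  "op_map G H f \<longleftrightarrow> continuous_map (gspace G) (gspace H) f \<and>
     (\<forall>p. op_path G p \<longrightarrow> op_path H (f \<circ> p))"

section \<open>Presentations\<close>

text \<open>
  In a sequence \<open>f :: nat \<Rightarrow> 'v \<Rightarrow> 'v\<close> of bonding maps, \<open>f (Suc k)\<close> maps \<open>X (Suc k)\<close> to \<open>X k\<close>, and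
  \<open>f 0\<close> is never used.
\<close>
definition inverse_limit ::
    "(nat \<Rightarrow> ('v, 'e) digraph) \<Rightarrow> (nat \<Rightarrow> 'v \<Rightarrow> 'v) \<Rightarrow> (nat \<Rightarrow> 'v) topology" where
  "inverse_limit X f =
     subtopology (product_topology (\<lambda>k. gspace (X k)) UNIV) {x. \<forall>k. f (Suc k) (x (Suc k)) = x k}"

definition directions_induced ::
    "(nat \<Rightarrow> ('v, 'e) digraph) \<Rightarrow> (nat \<Rightarrow> 'v \<Rightarrow> 'v) \<Rightarrow> bool" where
  "directions_induced X f \<longleftrightarrow>
     (\<exists>\<O>. orientation (inverse_limit X f) \<O> \<and>
        (\<forall>k \<gamma>. op_curve (inverse_limit X f) \<O> \<gamma> \<longrightarrow> op_path (X k) (\<lambda>t. \<gamma> t k)))"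

definition presentation ::
    "(nat \<Rightarrow> ('v, 'e) digraph) \<Rightarrow> (nat \<Rightarrow> 'v \<Rightarrow> 'v) \<Rightarrow> bool" where
  "presentation X f \<longleftrightarrow>
     (\<forall>k. finite_digraph (X k)) \<and>
     (\<forall>k. op_map (X (Suc k)) (X k) (f (Suc k)) \<and>
        f (Suc k) ` topspace (gspace (X (Suc k))) = topspace (gspace (X k)) \<and>
        f (Suc k) ` gverts (X (Suc k)) \<subseteq> gverts (X k) \<and>
        locally_one_to_one
          (subtopology (gspace (X (Suc k))) (topspace (gspace (X (Suc k))) - gverts (X (Suc k))))
          (f (Suc k))) \<and>
     directions_induced X f"

text \<open>\<open>bonding f k l\<close> is \<open>f\<^sub>k\<^sub>+\<^sub>1 \<circ> \<dots> \<circ> f\<^sub>l\<close>.\<close>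
primrec bonding :: "(nat \<Rightarrow> 'v \<Rightarrow> 'v) \<Rightarrow> nat \<Rightarrow> nat \<Rightarrow> 'v \<Rightarrow> 'v" where
  "bonding f k 0 = id"
| "bonding f k (Suc l) = (if k \<le> l then bonding f k l \<circ> f (Suc l) else id)"

definition simplicity_condition ::
    "(nat \<Rightarrow> ('v, 'e) digraph) \<Rightarrow> (nat \<Rightarrow> 'v \<Rightarrow> 'v) \<Rightarrow> bool" where
  "simplicity_condition X f \<longleftrightarrow>
     (\<forall>k\<ge>1. \<exists>\<kappa>\<ge>k. \<forall>l\<ge>\<kappa>. \<forall>e\<in>gedges (X l).
        bonding f k l ` gparam (X l) e ` {0..1} = topspace (gspace (X k)))"

section \<open>Graph groups\<close>

definition edge_functions :: "('v, 'e) digraph \<Rightarrow> ('e \<Rightarrow> int) monoid" where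
  "edge_functions G = product_group (gedges G) (\<lambda>_. integer_group)"

definition nonneg_edge_functions :: "('v, 'e) digraph \<Rightarrow> ('e \<Rightarrow> int) set" where
  "nonneg_edge_functions G = {g \<in> carrier (edge_functions G). \<forall>e\<in>gedges G. 0 \<le> g e}"

definition vertex_function :: "('v, 'e) digraph \<Rightarrow> 'v \<Rightarrow> 'e \<Rightarrow> int" where
  "vertex_function G v = (\<lambda>e\<in>gedges G.
     if gparam G e 0 = v \<and> gparam G e 1 \<noteq> v then 1
     else if gparam G e 0 \<noteq> v \<and> gparam G e 1 = v then -1 else 0)"

definition vertex_subgroup :: "('v, 'e) digraph \<Rightarrow> ('e \<Rightarrow> int) set" where
  "vertex_subgroup G = generate (edge_functions G) (vertex_function G ` gverts G)"

definition graph_group :: "('v, 'e) digraph \<Rightarrow> ('e \<Rightarrow> int) set monoid" where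
  "graph_group G = edge_functions G Mod vertex_subgroup G"

definition graph_class :: "('v, 'e) digraph \<Rightarrow> ('e \<Rightarrow> int) \<Rightarrow> ('e \<Rightarrow> int) set" where
  "graph_class G g = vertex_subgroup G #>\<^bsub>edge_functions G\<^esub> g"

definition graph_cone :: "('v, 'e) digraph \<Rightarrow> ('e \<Rightarrow> int) set set" where
  "graph_cone G = graph_class G ` nonneg_edge_functions G"

text \<open>The path \<open>p\<close> is, up to reparameterization, the concatenation of the edges in \<open>es\<close>.\<close>
definition traverses :: "('v, 'e) digraph \<Rightarrow> (real \<Rightarrow> 'v) \<Rightarrow> 'e list \<Rightarrow> bool" where
  "traverses G p es \<longleftrightarrow>
     (\<exists>\<tau> :: nat \<Rightarrow> real. \<tau> 0 = 0 \<and> \<tau> (length es) = 1 \<and>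
        (\<forall>i<length es. es ! i \<in> gedges G \<and> \<tau> i < \<tau> (Suc i) \<and>
           (\<exists>\<phi> :: real \<Rightarrow> real. strict_mono_on {\<tau> i..\<tau> (Suc i)} \<phi> \<and>
              \<phi> ` {\<tau> i..\<tau> (Suc i)} = {0..1} \<and>
              (\<forall>t\<in>{\<tau> i..\<tau> (Suc i)}. p t = gparam G (es ! i) (\<phi> t)))))"

definition edge_path :: "('v, 'e) digraph \<Rightarrow> (real \<Rightarrow> 'v) \<Rightarrow> 'e list" where
  "edge_path G p = (THE es. traverses G p es)"

definition pullback ::
    "('v, 'e) digraph \<Rightarrow> ('w, 'd) digraph \<Rightarrow> ('w \<Rightarrow> 'v) \<Rightarrow> ('e \<Rightarrow> int) \<Rightarrow> 'd \<Rightarrow> int" where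
  "pullback G H f g = (\<lambda>e\<in>gedges H. \<Sum>e'\<leftarrow>edge_path G (f \<circ> gparam H e). g e')"

text \<open>The value is the common class of the pullbacks of all representatives \<open>g \<in> A\<close>.\<close>
definition graph_group_map ::
    "('v, 'e) digraph \<Rightarrow> ('w, 'd) digraph \<Rightarrow> ('w \<Rightarrow> 'v) \<Rightarrow> ('e \<Rightarrow> int) set \<Rightarrow> ('d \<Rightarrow> int) set" where
  "graph_group_map G H f A = the_elem ((\<lambda>g. graph_class H (pullback G H f g)) ` A)"

section \<open>Direct limits\<close>

text \<open>
  For a sequence of maps \<open>h k\<close> from \<open>G k\<close> to \<open>G (Suc k)\<close>, \<open>transition h k m\<close> is the composite map
  from \<open>G k\<close> to \<open>G m\<close>.
\<close>
primrec transition :: "(nat \<Rightarrow> 'g \<Rightarrow> 'g) \<Rightarrow> nat \<Rightarrow> nat \<Rightarrow> 'g \<Rightarrow> 'g" where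
  "transition h k 0 = id"
| "transition h k (Suc m) = (if k \<le> m then h m \<circ> transition h k m else id)"

definition direct_limit_rel ::
    "(nat \<Rightarrow> 'g monoid) \<Rightarrow> (nat \<Rightarrow> 'g \<Rightarrow> 'g) \<Rightarrow> ((nat \<times> 'g) \<times> (nat \<times> 'g)) set" where
  "direct_limit_rel G h = {((k, x), (l, y)). x \<in> carrier (G k) \<and> y \<in> carrier (G l) \<and>
     (\<exists>m. k \<le> m \<and> l \<le> m \<and> transition h k m x = transition h l m y)}"

text \<open>Any two classes have representatives in a common \<open>G m\<close>, and these are multiplied there.\<close>
definition direct_limit ::
    "(nat \<Rightarrow> 'g monoid) \<Rightarrow> (nat \<Rightarrow> 'g \<Rightarrow> 'g) \<Rightarrow> (nat \<times> 'g) set monoid" where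
  "direct_limit G h =
     \<lparr>carrier = (SIGMA k:UNIV. carrier (G k)) // direct_limit_rel G h,
      monoid.mult = (\<lambda>A B. direct_limit_rel G h ``
        {(m, x \<otimes>\<^bsub>G m\<^esub> y) | m x y. (m, x) \<in> A \<and> (m, y) \<in> B}),
      one = direct_limit_rel G h `` {(0, \<one>\<^bsub>G 0\<^esub>)}\<rparr>"

definition direct_limit_cone ::
    "(nat \<Rightarrow> 'g monoid) \<Rightarrow> (nat \<Rightarrow> 'g \<Rightarrow> 'g) \<Rightarrow> (nat \<Rightarrow> 'g set) \<Rightarrow> (nat \<times> 'g) set set" where
  "direct_limit_cone G h P = {direct_limit_rel G h `` {(k, x)} | k x. x \<in> P k}"

definition limit_group ::
    "(nat \<Rightarrow> ('v, 'e) digraph) \<Rightarrow> (nat \<Rightarrow> 'v \<Rightarrow> 'v) \<Rightarrow> (nat \<times> ('e \<Rightarrow> int) set) set monoid" where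
  "limit_group X f = direct_limit (\<lambda>k. graph_group (X k))
     (\<lambda>k. graph_group_map (X k) (X (Suc k)) (f (Suc k)))"

definition standard_cone ::
    "(nat \<Rightarrow> ('v, 'e) digraph) \<Rightarrow> (nat \<Rightarrow> 'v \<Rightarrow> 'v) \<Rightarrow> (nat \<times> ('e \<Rightarrow> int) set) set set" where
  "standard_cone X f = direct_limit_cone (\<lambda>k. graph_group (X k))
     (\<lambda>k. graph_group_map (X k) (X (Suc k)) (f (Suc k))) (\<lambda>k. graph_cone (X k))"

definition order_isomorphic :: "'g monoid \<Rightarrow> 'g set \<Rightarrow> 'h monoid \<Rightarrow> 'h set \<Rightarrow> bool" where
  "order_isomorphic G P H Q \<longleftrightarrow> (\<exists>h\<in>iso G H. h ` P = Q)"

end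

theory Submission
  imports Defs
begin

text \<open>
  A function \<open>g\<close> on the edges of \<open>X k\<close> defines a map of the graph to the circle that winds \<open>g e\<close> times
  along \<open>e\<close>, and the direct limit of the graph groups is the group of homotopy classes of maps from
  the inverse limit to the circle; this group is a topological invariant. For the order, lift the
  edges of the graphs to arcs in the inverse limits. A homeomorphism \<open>h\<close> cannot make the image of
  such an arc turn around: at each of its points the other limit has a forward curve, and its preimage
  can only run along the arc. Hence the circle map of a strictly positive \<open>g\<close>, composed with \<open>h\<close>, is
  strictly monotone along every lifted edge; by compactness and simplicity, the direction is
  the same for all lifts of sufficiently deep edges and all \<open>g\<close>, and the increments are bounded away
  from \<open>0\<close>. A cocycle that represents the composition is therefore, up to a global sign, positive
  after adding a real coboundary, and rounding the potential down makes the coboundary integral.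
  The sign is harmless, since it can be absorbed in the isomorphism.
\<close>

section \<open>Directed graphs\<close>

text \<open>A homeomorphism of the limits need not commute with the projections and induces no maps
  between the graphs that respect vertices. Maps to the circle are compared instead, because their
  homotopy classes see the limit spaces only. Two facts tie these classes to the graphs. A
  continuous function on the compact limit nearly factors through some level, so every circle map
  comes from a level and every relation already holds at one. And over an open edge the limit does
  not branch, so an arc there is determined by one of its points. Branching occurs over vertices
  only, where arcs that start or end at a given point are found by compactness. Monotone angles need
  strict positivity; simplicity is therefore used a second time, to pass from a nonzero element of
  the cone to one that is positive on every edge of a deeper graph. The two directions of the
  homeomorphism may produce different signs; a chain of three transfers then restores the sign that
  was fixed for the isomorphism.\<close>

lemma strict_mono_onto_endpoints:
  fixes f :: "real \<Rightarrow> real"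
  assumes mono: "strict_mono_on {a..b} f" and onto: "f ` {a..b} = {c..d}" and "a \<le> b"
  shows "f a = c" "f b = d"
proof -
  have le: "f x \<le> f y" if "x \<in> {a..b}" "y \<in> {a..b}" "x \<le> y" for x y
    using strict_mono_on_leD[OF mono that] .
  have "c \<le> d" using onto \<open>a \<le> b\<close> by (cases "c \<le> d") auto
  then have "c \<in> f ` {a..b}" "d \<in> f ` {a..b}" using onto by auto
  then obtain x y where "x \<in> {a..b}" "f x = c" "y \<in> {a..b}" "f y = d" by blast
  moreover have "f a \<in> {c..d}" "f b \<in> {c..d}" using onto \<open>a \<le> b\<close> by auto
  ultimately show "f a = c" "f b = d" using le[of a x] le[of y b] \<open>a \<le> b\<close> by auto
qed

text \<open>A strictly increasing map onto an interval cannot jump. Hence the reparametrizations in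
  \<open>traverses\<close> are continuous.\<close>

lemma strict_mono_onto_imp_continuous:
  fixes f :: "real \<Rightarrow> real"
  assumes mono: "strict_mono_on {a..b} f" and onto: "f ` {a..b} = {c..d}"
  shows "continuous_on {a..b} f"
proof (cases "a \<le> b")
  case True
  have le: "f x \<le> f y" if "x \<in> {a..b}" "y \<in> {a..b}" "x \<le> y" for x y
    using strict_mono_on_leD[OF mono that] .
  have fa: "f a = c" and fb: "f b = d"
    using strict_mono_onto_endpoints[OF mono onto True] by auto
  \<comment> \<open>Continuing with slope \<open>1\<close> on both sides gives a monotone surjection
    of the line; a monotone map with open range is continuous.\<close>
  define F where "F x = (if x < a then f a + (x - a) else if x > b then f b + (x - b) else f x)" for x
  have "F x \<le> F y" if "x \<le> y" for x y
  proof -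
    have "f a \<le> f b" using le True by simp
    then show ?thesis using that le[of a y] le[of x b] le[of x y] unfolding F_def by auto
  qed
  moreover have "range F = UNIV"
  proof -
    have "y \<in> range F" for y
    proof -
      consider "y < c" | "y \<in> {c..d}" | "y > d" by fastforce
      then show ?thesis
      proof cases
        case 1 then have "F (a + (y - c)) = y" by (simp add: F_def fa)
        then show ?thesis by (metis rangeI)
      next
        case 2 then have "y \<in> f ` {a..b}" using onto by simp
        then obtain x where "x \<in> {a..b}" "f x = y" by blast
        then have "F x = y" by (auto simp: F_def)
        then show ?thesis by (metis rangeI)
      next
        case 3 then have "F (b + (y - d)) = y" using True by (simp add: F_def fb)
        then show ?thesis by (metis rangeI)
      qed
    qed
    then show ?thesis by blast
  qed
  ultimately have "continuous_on UNIV F" by (intro continuous_onI_mono) auto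
  then have "continuous_on {a..b} F" using continuous_on_subset by blast
  then show ?thesis by (rule continuous_on_eq) (auto simp: F_def)
qed auto

lemma strict_mono_onto_inverse:
  fixes f :: "real \<Rightarrow> real"
  assumes mono: "strict_mono_on {a..b} f" and onto: "f ` {a..b} = {c..d}"
  obtains g where "strict_mono_on {c..d} g" "g ` {c..d} = {a..b}" "continuous_on {c..d} g"
    "\<And>x. x \<in> {a..b} \<Longrightarrow> g (f x) = x" "\<And>y. y \<in> {c..d} \<Longrightarrow> f (g y) = y"
proof
  let ?g = "inv_into {a..b} f"
  have inj: "inj_on f {a..b}" using mono strict_mono_on_imp_inj_on by blast
  show 1: "?g (f x) = x" if "x \<in> {a..b}" for x using that inj by simp
  show 2: "f (?g y) = y" if "y \<in> {c..d}" for y using that onto by (simp add: f_inv_into_f)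
  have 3: "?g y \<in> {a..b}" if "y \<in> {c..d}" for y using that onto by (metis inv_into_into)
  show 4: "?g ` {c..d} = {a..b}"
  proof
    show "?g ` {c..d} \<subseteq> {a..b}" using 3 by blast
    show "{a..b} \<subseteq> ?g ` {c..d}"
    proof
      fix x assume x: "x \<in> {a..b}"
      then have "f x \<in> {c..d}" using onto by blast
      then show "x \<in> ?g ` {c..d}" using 1[OF x] by (metis image_eqI)
    qed
  qed
  show 5: "strict_mono_on {c..d} ?g"
  proof (rule strict_mono_onI)
    fix x y assume "x \<in> {c..d}" "y \<in> {c..d}" "x < y"
    then show "?g x < ?g y"
      using 2 3 strict_mono_on_leD[OF mono] by (metis linorder_not_le)
  qed
  show "continuous_on {c..d} ?g" by (rule strict_mono_onto_imp_continuous[OF 5 4])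
qed

section \<open>Topology of finite directed graphs\<close>

locale fin_digraph =
  fixes G :: "('v, 'e) digraph"
  assumes finite_digraph: "finite_digraph G"
begin

lemma Hausdorff: "Hausdorff_space (gspace G)"
  and finite_verts: "finite (gverts G)"
  and finite_edges: "finite (gedges G)"
  and topspace_eq: "topspace (gspace G) = gverts G \<union> (\<Union>e\<in>gedges G. gparam G e ` {0<..<1})"
  using finite_digraph by (auto simp: finite_digraph_def)

lemma pathin_edge: "e \<in> gedges G \<Longrightarrow> pathin (gspace G) (gparam G e)"
  and edge_0: "e \<in> gedges G \<Longrightarrow> gparam G e 0 \<in> gverts G"
  and edge_1: "e \<in> gedges G \<Longrightarrow> gparam G e 1 \<in> gverts G"
  using finite_digraph by (auto simp: finite_digraph_def)

lemma in_edge: "v \<in> gverts G \<Longrightarrow> \<exists>e\<in>gedges G. gparam G e 1 = v"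
  and out_edge: "v \<in> gverts G \<Longrightarrow> \<exists>e\<in>gedges G. gparam G e 0 = v"
  using finite_digraph by (auto simp: finite_digraph_def)

lemma verts_topspace: "v \<in> gverts G \<Longrightarrow> v \<in> topspace (gspace G)"
  by (simp add: topspace_eq)

lemma edge_topspace: "e \<in> gedges G \<Longrightarrow> t \<in> {0..1} \<Longrightarrow> gparam G e t \<in> topspace (gspace G)"
  using pathin_edge[of e] by (auto simp: pathin_def continuous_map_def Pi_iff)

lemma edge_vertex_iff:
  assumes "e \<in> gedges G" "t \<in> {0..1}"
  shows "gparam G e t \<in> gverts G \<longleftrightarrow> t = 0 \<or> t = 1"
proof -
  have "disjnt (gparam G e ` {0<..<1}) (gverts G)"
    using finite_digraph assms by (auto simp: finite_digraph_def)
  then show ?thesis using edge_0 edge_1 assms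
    by (cases "t = 0 \<or> t = 1") (auto simp: disjnt_iff)
qed

text \<open>Only \<open>t\<close> has to be interior: an end point of an edge is a vertex, which no
  interior point is. Allowing \<open>t'\<close> to be an end avoids case distinctions at every
  use.\<close>

lemma edge_inj:
  assumes "e \<in> gedges G" "e' \<in> gedges G" "t \<in> {0<..<1}" "t' \<in> {0..1}"
    "gparam G e t = gparam G e' t'"
  shows "e = e'" "t = t'"
proof -
  have t': "t' \<in> {0<..<1}"
    using assms edge_vertex_iff[of e t] edge_vertex_iff[of e' t'] by fastforce
  show "e = e'"
  proof (rule ccontr)
    assume "e \<noteq> e'"
    then have "disjnt (gparam G e ` {0<..<1}) (gparam G e' ` {0<..<1})"
      using finite_digraph assms by (auto simp: finite_digraph_def)
    moreover have "gparam G e t \<in> gparam G e ` {0<..<1}" using assms by blast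
    moreover have "gparam G e t \<in> gparam G e' ` {0<..<1}" using assms(5) t' by auto
    ultimately show False unfolding disjnt_def by blast
  qed
  moreover have "inj_on (gparam G e) {0<..<1}"
    using finite_digraph assms by (auto simp: finite_digraph_def)
  ultimately show "t = t'" using assms t' by (auto simp: inj_on_def)
qed

lemma topspace_cases:
  assumes "x \<in> topspace (gspace G)"
  obtains (vertex) "x \<in> gverts G"
  | (edge) e t where "e \<in> gedges G" "t \<in> {0<..<1}" "x = gparam G e t"
  using assms topspace_eq by auto

lemma topspace_edge_in:
  assumes "x \<in> topspace (gspace G)"
  obtains e t where "e \<in> gedges G" "t \<in> {0<..1}" "x = gparam G e t"
  using assms
proof (cases rule: topspace_cases)
  case vertex
  then obtain e where "e \<in> gedges G" "gparam G e 1 = x" using in_edge by blast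
  then show ?thesis using that[of e 1] by simp
next
  case (edge e t) then show ?thesis using that[of e t] by auto
qed

lemma topspace_edge_out:
  assumes "x \<in> topspace (gspace G)"
  obtains e t where "e \<in> gedges G" "t \<in> {0..<1}" "x = gparam G e t"
  using assms
proof (cases rule: topspace_cases)
  case vertex
  then obtain e where "e \<in> gedges G" "gparam G e 0 = x" using out_edge by blast
  then show ?thesis using that[of e 0] by simp
next
  case (edge e t) then show ?thesis using that[of e t] by auto
qed

lemma closedin_edge_image:
  assumes "e \<in> gedges G" "closed C" "C \<subseteq> {0..1}"
  shows "closedin (gspace G) (gparam G e ` C)"
proof -
  have "compact C" using assms compact_Icc
    by (metis bounded_subset bounded_closed_interval box_real(2) compact_eq_bounded_closed)
  then have "compactin (top_of_set {0..1}) C"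
    using assms by (simp add: compactin_subtopology)
  then have "compactin (gspace G) (gparam G e ` C)"
    using pathin_edge[OF assms(1)] image_compactin unfolding pathin_def by blast
  then show ?thesis using compactin_imp_closedin Hausdorff by blast
qed

text \<open>The preimage of a closed set is a union of finitely many images of closed parameter
  sets, which are compact and hence closed. So the graph carries the quotient topology of its edges.
  The vertices are covered as well, because each of them has an incoming edge.\<close>

lemma continuous_map_graphI:
  assumes "\<And>e. e \<in> gedges G \<Longrightarrow> continuous_map (top_of_set {0..1}) Z (F \<circ> gparam G e)"
  shows "continuous_map (gspace G) Z F"
  unfolding continuous_map_closedin
proof (intro conjI allI impI funcsetI)
  fix x assume "x \<in> topspace (gspace G)"
  then obtain e t where "e \<in> gedges G" "t \<in> {0<..1}" "x = gparam G e t"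
    by (rule topspace_edge_in)
  then show "F x \<in> topspace Z"
    using assms[of e] by (auto simp: continuous_map_def)
next
  fix C assume C: "closedin Z C"
  have cl: "closedin (gspace G) (gparam G e ` {t \<in> {0..1}. F (gparam G e t) \<in> C})"
    if e: "e \<in> gedges G" for e
  proof (rule closedin_edge_image[OF e])
    have "closedin (top_of_set {0..1}) {t \<in> {0..1}. F (gparam G e t) \<in> C}"
      using closedin_continuous_map_preimage[OF assms[OF e] C] by simp
    then show "closed {t \<in> {0..1}. F (gparam G e t) \<in> C}"
      using closedin_closed_trans by blast
  qed auto
  have "{x \<in> topspace (gspace G). F x \<in> C} =
      (\<Union>e\<in>gedges G. gparam G e ` {t \<in> {0..1}. F (gparam G e t) \<in> C})" (is "?L = ?R")
  proof
    show "?L \<subseteq> ?R"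
    proof
      fix x assume x: "x \<in> ?L"
      then obtain e t where e: "e \<in> gedges G" "t \<in> {0<..1}" "x = gparam G e t"
        using topspace_edge_in by blast
      then have "t \<in> {t \<in> {0..1}. F (gparam G e t) \<in> C}" using x by auto
      with e show "x \<in> ?R" by blast
    qed
    show "?R \<subseteq> ?L" using edge_topspace by auto
  qed
  also have "closedin (gspace G) \<dots>"
    using cl finite_edges by (intro closedin_Union) auto
  finally show "closedin (gspace G) {x \<in> topspace (gspace G). F x \<in> C}" .
qed

lemma openin_edge_interval:
  assumes e: "e \<in> gedges G" and ab: "0 \<le> a" "b \<le> 1"
  shows "openin (gspace G) (gparam G e ` {a<..<b})"
proof (cases "a < b")
  case True
  \<comment> \<open>The complement of the open piece, written as a finite union of compact
    sets.\<close>
  define K where "K = gverts G \<union> (\<Union>e'\<in>gedges G - {e}. gparam G e' ` {0..1}) \<union>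
    gparam G e ` {0..a} \<union> gparam G e ` {b..1}"
  have "closedin (gspace G) (gverts G)"
    using Hausdorff finite_verts verts_topspace
    by (simp add: Hausdorff_imp_t1_space closedin_Hausdorff_finite subsetI)
  moreover have "closedin (gspace G) (\<Union>e'\<in>gedges G - {e}. gparam G e' ` {0..1})"
    using finite_edges closedin_edge_image by (intro closedin_Union) auto
  ultimately have "closedin (gspace G) K"
    using closedin_edge_image[OF e, of "{0..a}"] closedin_edge_image[OF e, of "{b..1}"] True ab
    unfolding K_def by (intro closedin_Un) auto
  moreover have "gparam G e ` {a<..<b} = topspace (gspace G) - K"
  proof
    show "gparam G e ` {a<..<b} \<subseteq> topspace (gspace G) - K"
    proof
      fix x assume "x \<in> gparam G e ` {a<..<b}"
      then obtain t where t: "t \<in> {a<..<b}" "x = gparam G e t" by blast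
      then have t01: "t \<in> {0<..<1}" using ab by auto
      have "x \<in> topspace (gspace G)" using edge_topspace[OF e, of t] t t01 by auto
      moreover have "x \<notin> gverts G" using edge_vertex_iff[OF e, of t] t t01 by auto
      moreover have "x \<notin> gparam G e' ` {0..1}" if "e' \<in> gedges G" "e' \<noteq> e" for e'
        using edge_inj(1)[OF e that(1) t01] t(2) that(2) by (metis imageE)
      moreover have "x \<notin> gparam G e ` {0..a}"
      proof
        assume "x \<in> gparam G e ` {0..a}"
        then obtain s where "s \<in> {0..a}" "x = gparam G e s" by blast
        then show False using edge_inj(2)[OF e e t01, of s] t True ab by auto
      qed
      moreover have "x \<notin> gparam G e ` {b..1}"
      proof
        assume "x \<in> gparam G e ` {b..1}"
        then obtain s where "s \<in> {b..1}" "x = gparam G e s" by blast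
        then show False using edge_inj(2)[OF e e t01, of s] t True ab by auto
      qed
      ultimately show "x \<in> topspace (gspace G) - K"
        unfolding K_def by blast
    qed
    show "topspace (gspace G) - K \<subseteq> gparam G e ` {a<..<b}"
    proof
      fix x assume x: "x \<in> topspace (gspace G) - K"
      then obtain e' t where "e' \<in> gedges G" "t \<in> {0<..<1}" "x = gparam G e' t"
        using topspace_eq unfolding K_def by auto
      moreover from this have "e' = e" "\<not> t \<le> a" "\<not> b \<le> t"
        using x unfolding K_def by fastforce+
      ultimately show "x \<in> gparam G e ` {a<..<b}" by auto
    qed
  qed
  ultimately show ?thesis by auto
qed simp

text \<open>An edge maps closed parameter sets to closed sets and is injective in the interior, so
  its inverse is continuous there.\<close>

lemma continuous_map_coordinate:
  assumes e: "e \<in> gedges G" and p: "continuous_map T (gspace G) p"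
    and \<theta>: "\<And>s. s \<in> topspace T \<Longrightarrow> \<theta> s \<in> {0<..<1} \<and> p s = gparam G e (\<theta> s)"
  shows "continuous_map T euclideanreal \<theta>"
  unfolding continuous_map_closedin
proof (intro conjI allI impI)
  fix C :: "real set" assume "closedin euclidean C"
  then have C: "closed (C \<inter> {0..1})" by auto
  have "{x \<in> topspace T. \<theta> x \<in> C} = {x \<in> topspace T. p x \<in> gparam G e ` (C \<inter> {0..1})}"
  proof (intro Collect_cong conj_cong refl iffI)
    fix x assume x: "x \<in> topspace T"
    show "p x \<in> gparam G e ` (C \<inter> {0..1})" if "\<theta> x \<in> C" using that \<theta>[OF x] by fastforce
    assume "p x \<in> gparam G e ` (C \<inter> {0..1})"
    then obtain c where "c \<in> C" "c \<in> {0..1}" "p x = gparam G e c" by blast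
    then show "\<theta> x \<in> C" using \<theta>[OF x] edge_inj[OF e e, of "\<theta> x" c] by auto
  qed
  also have "closedin T \<dots>"
    using closedin_continuous_map_preimage[OF p closedin_edge_image[OF e C]] by simp
  finally show "closedin T {x \<in> topspace T. \<theta> x \<in> C}" .
qed auto

text \<open>The open edges are disjoint open sets; one of them and the union of the others would
  separate \<open>C\<close>.\<close>

lemma connectedin_edge:
  assumes C: "connectedin (gspace G) C" "C \<inter> gverts G = {}" "C \<noteq> {}"
  obtains e where "e \<in> gedges G" "C \<subseteq> gparam G e ` {0<..<1}"
proof -
  have sub: "C \<subseteq> topspace (gspace G)" using C connectedin_subset_topspace by blast
  obtain x where x: "x \<in> C" using C by blast
  then obtain e t where e: "e \<in> gedges G" "t \<in> {0<..<1}" "x = gparam G e t"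
    using C sub topspace_eq by blast
  let ?A = "gparam G e ` {0<..<1}" and ?B = "\<Union>e'\<in>gedges G - {e}. gparam G e' ` {0<..<1}"
  have "openin (gspace G) ?A" "openin (gspace G) ?B"
    using openin_edge_interval e by (auto intro!: openin_Union)
  moreover have "?A \<inter> ?B = {}"
  proof -
    have False if "e' \<in> gedges G" "e' \<noteq> e" "s \<in> {0<..<1}" "s' \<in> {0<..<1}" "gparam G e s = gparam G e' s'" for e' s s'
      using edge_inj[OF e(1) that(1,3) _ that(5)] that by auto
    then show ?thesis by blast
  qed
  moreover have AB: "C \<subseteq> ?A \<union> ?B" using sub C topspace_eq by auto
  moreover have "?A \<inter> C \<noteq> {}" using x e by blast
  ultimately have "?B \<inter> C = {}" using C(1) unfolding connectedin by blast
  with AB have "C \<subseteq> ?A" by blast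
  with e(1) show ?thesis by (rule that)
qed

end

section \<open>Edge words of paths: break points and uniqueness\<close>

definition traversal ::
    "('v, 'e) digraph \<Rightarrow> (real \<Rightarrow> 'v) \<Rightarrow> 'e list \<Rightarrow> (nat \<Rightarrow> real) \<Rightarrow> (nat \<Rightarrow> real \<Rightarrow> real) \<Rightarrow> bool" where
  "traversal G p es \<tau> \<phi> \<longleftrightarrow> \<tau> 0 = 0 \<and> \<tau> (length es) = 1 \<and>
     (\<forall>i<length es. es ! i \<in> gedges G \<and> \<tau> i < \<tau> (Suc i) \<and>
        strict_mono_on {\<tau> i..\<tau> (Suc i)} (\<phi> i) \<and> \<phi> i ` {\<tau> i..\<tau> (Suc i)} = {0..1} \<and>
        (\<forall>t\<in>{\<tau> i..\<tau> (Suc i)}. p t = gparam G (es ! i) (\<phi> i t)))"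

lemma traverses_traversal: "traverses G p es \<longleftrightarrow> (\<exists>\<tau> \<phi>. traversal G p es \<tau> \<phi>)"
  unfolding traverses_def traversal_def by metis

context
  fixes G :: "('v, 'e) digraph" and p es \<tau> \<phi>
  assumes trav: "traversal G p es \<tau> \<phi>"
begin

lemma traversal_ends: "\<tau> 0 = 0" "\<tau> (length es) = 1"
  using trav by (auto simp: traversal_def)

lemma traversal_step:
  assumes "i < length es"
  shows "es ! i \<in> gedges G" "\<tau> i < \<tau> (Suc i)" "strict_mono_on {\<tau> i..\<tau> (Suc i)} (\<phi> i)"
    "\<phi> i ` {\<tau> i..\<tau> (Suc i)} = {0..1}" "continuous_on {\<tau> i..\<tau> (Suc i)} (\<phi> i)"
    "\<phi> i (\<tau> i) = 0" "\<phi> i (\<tau> (Suc i)) = 1"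
    "\<And>t. t \<in> {\<tau> i..\<tau> (Suc i)} \<Longrightarrow> p t = gparam G (es ! i) (\<phi> i t)"
proof -
  show *: "es ! i \<in> gedges G" "\<tau> i < \<tau> (Suc i)" "strict_mono_on {\<tau> i..\<tau> (Suc i)} (\<phi> i)"
    "\<phi> i ` {\<tau> i..\<tau> (Suc i)} = {0..1}"
    "\<And>t. t \<in> {\<tau> i..\<tau> (Suc i)} \<Longrightarrow> p t = gparam G (es ! i) (\<phi> i t)"
    using trav assms by (auto simp: traversal_def)
  show "continuous_on {\<tau> i..\<tau> (Suc i)} (\<phi> i)"
    by (rule strict_mono_onto_imp_continuous[OF *(3,4)])
  show "\<phi> i (\<tau> i) = 0" "\<phi> i (\<tau> (Suc i)) = 1"
    using strict_mono_onto_endpoints[OF *(3,4)] *(2) by auto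
qed

lemma traversal_less:
  assumes "i < j" "j \<le> length es"
  shows "\<tau> i < \<tau> j"
  using assms
proof (induction j)
  case (Suc j)
  then have "\<tau> j < \<tau> (Suc j)" using traversal_step(2) by simp
  with Suc show ?case by (cases "i = j") auto
qed simp

lemma traversal_le: "i \<le> j \<Longrightarrow> j \<le> length es \<Longrightarrow> \<tau> i \<le> \<tau> j"
  using traversal_less[of i j] by (cases "i = j") auto

lemma traversal_in: "i \<le> length es \<Longrightarrow> \<tau> i \<in> {0..1}"
  using traversal_le[of 0 i] traversal_le[of i "length es"] traversal_ends by auto

lemma traversal_nonempty: "es \<noteq> []"
  using traversal_ends by auto

lemma traversal_locate:
  assumes "t \<in> {0..1}"
  obtains i where "i < length es" "t \<in> {\<tau> i..\<tau> (Suc i)}"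
proof -
  have "m \<le> length es \<Longrightarrow> 0 < m \<Longrightarrow> t \<le> \<tau> m \<Longrightarrow> \<exists>i<m. t \<in> {\<tau> i..\<tau> (Suc i)}" for m
  proof (induction m)
    case (Suc m)
    show ?case
    proof (cases "0 < m \<and> t \<le> \<tau> m")
      case True
      with Suc show ?thesis by (metis Suc_leD less_SucI)
    next
      case False
      then have "\<tau> m \<le> t" using assms traversal_ends by auto
      with Suc show ?thesis by auto
    qed
  qed simp
  from this[of "length es"] show ?thesis
    using that assms traversal_ends traversal_nonempty by auto
qed

end

context fin_digraph
begin

text \<open>An edge meets the vertices at its two ends only, so the break points are the times at
  which \<open>p\<close> visits a vertex. They can therefore be read off from \<open>p\<close>
  alone.\<close>

lemma traversal_vertex_iff:
  assumes trav: "traversal G p es \<tau> \<phi>" and t: "t \<in> {0..1}"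
  shows "p t \<in> gverts G \<longleftrightarrow> (\<exists>i\<le>length es. t = \<tau> i)"
proof
  assume v: "p t \<in> gverts G"
  obtain i where i: "i < length es" "t \<in> {\<tau> i..\<tau> (Suc i)}"
    using traversal_locate[OF trav t] .
  note st = traversal_step[OF trav i(1)]
  have "\<phi> i t \<in> {0..1}" using st(4) i(2) by blast
  then have "\<phi> i t = 0 \<or> \<phi> i t = 1"
    using v st(8)[OF i(2)] edge_vertex_iff[OF st(1)] by simp
  then have "t = \<tau> i \<or> t = \<tau> (Suc i)"
    using strict_mono_onD[OF st(3), of "\<tau> i" t] strict_mono_onD[OF st(3), of t "\<tau> (Suc i)"]
      st(2,6,7) i(2) by force
  then show "\<exists>i\<le>length es. t = \<tau> i" using i(1) by (metis Suc_leI less_imp_le_nat)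
next
  assume "\<exists>i\<le>length es. t = \<tau> i"
  then obtain i where i: "i \<le> length es" "t = \<tau> i" by blast
  show "p t \<in> gverts G"
  proof (cases "i = length es")
    case True
    then obtain j where j: "i = Suc j" "j < length es"
      using traversal_nonempty[OF trav] by (metis length_0_conv lessI not0_implies_Suc)
    note st = traversal_step[OF trav j(2)]
    show ?thesis using st(8)[of t] st(1,2,7) i(2) j(1) edge_1 by simp
  next
    case False
    then have "i < length es" using i by simp
    note st = traversal_step[OF trav this]
    show ?thesis using st(8)[of t] st(1,2,6) i(2) edge_0 by simp
  qed
qed

lemma traversal_sorted_list:
  assumes trav: "traversal G p es \<tau> \<phi>"
  shows "map \<tau> [0..<Suc (length es)] = sorted_list_of_set {t \<in> {0..1}. p t \<in> gverts G}"
proof -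
  let ?l = "map \<tau> [0..<Suc (length es)]"
  have "set ?l = \<tau> ` {..length es}"
    by (simp del: upt_Suc add: atLeastLessThanSuc_atLeastAtMost atMost_atLeast0)
  then have set: "{t \<in> {0..1}. p t \<in> gverts G} = set ?l"
    using traversal_vertex_iff[OF trav] traversal_in[OF trav] by auto
  have "sorted_wrt (<) ?l"
    unfolding sorted_wrt_iff_nth_less using traversal_less[OF trav] by (auto simp del: upt_Suc)
  then have "sorted_list_of_set (set ?l) = ?l"
    by (simp only: strict_sorted_iff sorted_list_of_set.idem_if_sorted_distinct)
  then show ?thesis unfolding set by simp
qed

text \<open>Justifies the definite description in \<open>edge_path\<close>: the break points are the
  sorted visits to vertices, and the point at the middle time of each piece is interior to one edge
  only.\<close>

lemma traverses_unique:
  assumes "traverses G p es" "traverses G p es'"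
  shows "es = es'"
proof -
  obtain \<tau> \<phi> \<tau>' \<phi>' where t: "traversal G p es \<tau> \<phi>" and t': "traversal G p es' \<tau>' \<phi>'"
    using assms traverses_traversal by metis
  have eq: "map \<tau> [0..<Suc (length es)] = map \<tau>' [0..<Suc (length es')]"
    using traversal_sorted_list[OF t] traversal_sorted_list[OF t'] by simp
  then have len: "length es = length es'" by (metis Suc_inject diff_zero length_map length_upt)
  have \<tau>: "\<tau> i = \<tau>' i" if "i \<le> length es" for i
  proof -
    have "map \<tau> [0..<Suc (length es)] ! i = map \<tau>' [0..<Suc (length es')] ! i" using eq by simp
    then show ?thesis using that len by (simp del: upt_Suc add: less_Suc_eq_le)
  qed
  show ?thesis
  proof (rule nth_equalityI[OF len])
    fix i assume i: "i < length es"
    then have i': "i < length es'" using len by simp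
    note st = traversal_step[OF t i] and st' = traversal_step[OF t' i']
    define s where "s = (\<tau> i + \<tau> (Suc i)) / 2"
    have s: "s \<in> {\<tau> i..\<tau> (Suc i)}" "\<tau> i < s" "s < \<tau> (Suc i)" using st(2) by (auto simp: s_def)
    have s': "s \<in> {\<tau>' i..\<tau>' (Suc i)}" using s \<tau>[of i] \<tau>[of "Suc i"] i by simp
    have "\<phi> i s \<in> {0<..<1}"
      using strict_mono_onD[OF st(3), of "\<tau> i" s] strict_mono_onD[OF st(3), of s "\<tau> (Suc i)"]
      st(2,6,7) s by force
    moreover have "\<phi>' i s \<in> {0..1}" using st'(4) s' by blast
    moreover have "gparam G (es ! i) (\<phi> i s) = gparam G (es' ! i) (\<phi>' i s)"
      using st(8)[OF s(1)] st'(8)[OF s'] by simp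
    ultimately show "es ! i = es' ! i" using edge_inj(1) st(1) st'(1) by blast
  qed
qed

lemma edge_path_eq: "traverses G p es \<Longrightarrow> edge_path G p = es"
  unfolding edge_path_def using traverses_unique by blast

section \<open>Orientation preserving paths\<close>

lemma op_path_edge:
  assumes e: "e \<in> gedges G"
  shows "op_path G (gparam G e)"
  unfolding op_path_def
proof (intro conjI ballI allI impI; (elim conjE)?)
  show "pathin (gspace G) (gparam G e)" using pathin_edge e .
  fix e' J \<phi>
  assume e': "e' \<in> gedges G" and J: "is_interval J" "J \<subseteq> {0..1}" and \<phi>: "continuous_on J \<phi>" "\<phi> ` J \<subseteq> {0..1}"
    and eq: "\<forall>t\<in>J. gparam G e t = gparam G e' (\<phi> t)"
  \<comment> \<open>If \<open>e\<close> is a loop, the path does not determine the branch \<phi> at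
    the vertex. It is computed at inner times and then extended by continuity.\<close>
  have inner: "\<phi> t = t" if "t \<in> J" "t \<in> {0<..<1}" for t
    using edge_inj(2)[OF e e' that(2), of "\<phi> t"] eq \<phi>(2) that by auto
  show "strict_mono_on J \<phi>"
  proof (rule strict_mono_onI)
    fix s t assume st: "s \<in> J" "t \<in> J" "s < t"
    then have sub: "{s..t} \<subseteq> J" using J(1) unfolding is_interval_1 by (meson atLeastAtMost_iff subsetI)
    have clos: "closure {s<..<t} = {s..t}" using st by simp
    have "\<phi> x - x = 0" if "x \<in> {s..t}" for x
    proof (rule continuous_constant_on_closure[of "{s<..<t}" "\<lambda>x. \<phi> x - x"])
      show "continuous_on (closure {s<..<t}) (\<lambda>x. \<phi> x - x)"
        unfolding clos using \<phi>(1) sub by (intro continuous_intros) (rule continuous_on_subset)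
      fix y assume y: "y \<in> {s<..<t}"
      then have "y \<in> J" using sub by auto
      moreover have "y \<in> {0<..<1}" using y st J(2) by fastforce
      ultimately show "\<phi> y - y = 0" using inner by simp
    qed (use that clos in simp)
    from this[of s] this[of t] st show "\<phi> s < \<phi> t" by simp
  qed
qed

lemma path_closure_closedin:
  assumes p: "pathin (gspace G) p" and C: "closedin (gspace G) C"
    and S: "S \<subseteq> {0..1}" "p ` S \<subseteq> C" and x: "x \<in> closure S"
  shows "p x \<in> C"
proof -
  have "closedin (top_of_set {0..1}) {t \<in> {0..1}. p t \<in> C}"
    using closedin_continuous_map_preimage[OF p[unfolded pathin_def] C] by simp
  then have "closed {t \<in> {0..1}. p t \<in> C}" by (rule closedin_closed_trans) simp
  moreover have "S \<subseteq> {t \<in> {0..1}. p t \<in> C}" using S by auto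
  ultimately have "closure S \<subseteq> {t \<in> {0..1}. p t \<in> C}" by (metis closure_minimal)
  then show ?thesis using x by auto
qed

text \<open>A connected set that misses the vertices stays in one open edge, and orientation makes
  its coordinate strictly increasing. If the coordinate stayed away from \<open>0\<close> near
  \<open>a\<close>, then \<open>p a\<close> would lie in a closed piece of the edge that contains no
  vertex; likewise for \<open>1\<close> at \<open>b\<close>. Hence the edge is traversed
  completely.\<close>

lemma op_path_gap:
  assumes op: "op_path G p" and ab: "0 \<le> a" "a < b" "b \<le> 1"
    and v: "p a \<in> gverts G" "p b \<in> gverts G" "\<And>t. t \<in> {a<..<b} \<Longrightarrow> p t \<notin> gverts G"
  obtains e \<phi> where "e \<in> gedges G" "strict_mono_on {a..b} \<phi>" "\<phi> ` {a..b} = {0..1}"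
    "\<And>t. t \<in> {a..b} \<Longrightarrow> p t = gparam G e (\<phi> t)"
proof -
  have p: "pathin (gspace G) p" using op by (simp add: op_path_def)
  then have pc: "continuous_map (top_of_set {a<..<b}) (gspace G) p"
    unfolding pathin_def by (rule continuous_map_from_subtopology_mono) (use ab in auto)
  have "connectedin (gspace G) (p ` {a<..<b})"
    by (rule connectedin_continuous_map_image[OF pc]) (simp add: connectedin_subtopology)
  moreover have "p ` {a<..<b} \<inter> gverts G = {}" using v(3) by auto
  moreover have "p ` {a<..<b} \<noteq> {}" using ab by simp
  ultimately obtain e where e: "e \<in> gedges G" "p ` {a<..<b} \<subseteq> gparam G e ` {0<..<1}"
    by (rule connectedin_edge)
  then have "\<forall>t\<in>{a<..<b}. \<exists>s. s \<in> {0<..<1} \<and> p t = gparam G e s" by blast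
  then obtain \<theta> where \<theta>: "\<And>t. t \<in> {a<..<b} \<Longrightarrow> \<theta> t \<in> {0<..<1} \<and> p t = gparam G e (\<theta> t)"
    by metis
  have cont: "continuous_on {a<..<b} \<theta>"
    using continuous_map_coordinate[OF e(1) pc, of \<theta>] \<theta> by simp
  have "is_interval {a<..<b} \<and> {a<..<b} \<subseteq> {0..1} \<and> continuous_on {a<..<b} \<theta> \<and>
      \<theta> ` {a<..<b} \<subseteq> {0..1} \<and> (\<forall>t\<in>{a<..<b}. p t = gparam G e (\<theta> t))"
    using \<theta> ab cont by (fastforce simp: is_interval_convex_1)
  then have mono: "strict_mono_on {a<..<b} \<theta>"
    using op e(1) unfolding op_path_def by blast
  define m where "m = (a + b) / 2"
  have m: "a < m" "m < b" using ab by (auto simp: m_def)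
  have \<theta>m: "\<theta> m \<in> {0<..<1}" using \<theta> m by simp
  have sub: "{a<..<m} \<subseteq> {0..1}" "{m<..<b} \<subseteq> {0..1}" using ab m by auto
  have clos: "a \<in> closure {a<..<m}" "b \<in> closure {m<..<b}" using m by auto
  have lo: "\<theta> t \<in> {0<..<1}" "\<theta> t \<le> \<theta> m" "p t = gparam G e (\<theta> t)" if "t \<in> {a<..<m}" for t
    using that m \<theta>[of t] strict_mono_onD[OF mono, of t m] by auto
  have hi: "\<theta> t \<in> {0<..<1}" "\<theta> m \<le> \<theta> t" "p t = gparam G e (\<theta> t)" if "t \<in> {m<..<b}" for t
    using that m \<theta>[of t] strict_mono_onD[OF mono, of m t] by auto
  have low: "\<exists>t\<in>{a<..<m}. \<theta> t < \<epsilon>" if "0 < \<epsilon>" for \<epsilon>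
  proof (rule ccontr)
    assume "\<not> ?thesis"
    then have ge: "\<epsilon> \<le> \<theta> t" if "t \<in> {a<..<m}" for t using that by force
    have "p ` {a<..<m} \<subseteq> gparam G e ` {\<epsilon>..\<theta> m}"
      using ge lo by (auto intro!: image_eqI)
    then have "p a \<in> gparam G e ` {\<epsilon>..\<theta> m}"
      using path_closure_closedin[OF p closedin_edge_image[OF e(1)], of "{\<epsilon>..\<theta> m}" "{a<..<m}" a]
        sub clos \<theta>m \<open>0 < \<epsilon>\<close> by auto
    then show False using v(1) edge_vertex_iff[OF e(1)] \<theta>m \<open>0 < \<epsilon>\<close> by force
  qed
  have high: "\<exists>t\<in>{m<..<b}. \<epsilon> < \<theta> t" if "\<epsilon> < 1" for \<epsilon>
  proof (rule ccontr)
    assume "\<not> ?thesis"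
    then have ge: "\<theta> t \<le> \<epsilon>" if "t \<in> {m<..<b}" for t using that by force
    have "p ` {m<..<b} \<subseteq> gparam G e ` {\<theta> m..\<epsilon>}"
      using ge hi by (auto intro!: image_eqI)
    then have "p b \<in> gparam G e ` {\<theta> m..\<epsilon>}"
      using path_closure_closedin[OF p closedin_edge_image[OF e(1)], of "{\<theta> m..\<epsilon>}" "{m<..<b}" b]
        sub clos \<theta>m \<open>\<epsilon> < 1\<close> by auto
    then show False using v(2) edge_vertex_iff[OF e(1)] \<theta>m \<open>\<epsilon> < 1\<close> by force
  qed
  \<comment> \<open>The closed piece of the edge up to \<open>\<theta> m\<close> meets the vertices
    in its start only, which rules out the other end for \<open>p a\<close>.\<close>
  have pa: "p a = gparam G e 0"
  proof -
    have "p ` {a<..<m} \<subseteq> gparam G e ` {0..\<theta> m}"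
      using lo by (fastforce intro!: image_eqI)
    then have "p a \<in> gparam G e ` {0..\<theta> m}"
      using path_closure_closedin[OF p closedin_edge_image[OF e(1)], of "{0..\<theta> m}" "{a<..<m}" a]
        sub clos \<theta>m by auto
    then show ?thesis using v(1) edge_vertex_iff[OF e(1)] \<theta>m by force
  qed
  have pb: "p b = gparam G e 1"
  proof -
    have "p ` {m<..<b} \<subseteq> gparam G e ` {\<theta> m..1}"
      using hi by (fastforce intro!: image_eqI)
    then have "p b \<in> gparam G e ` {\<theta> m..1}"
      using path_closure_closedin[OF p closedin_edge_image[OF e(1)], of "{\<theta> m..1}" "{m<..<b}" b]
        sub clos \<theta>m by auto
    then show ?thesis using v(2) edge_vertex_iff[OF e(1)] \<theta>m by force
  qed
  define \<phi> where "\<phi> t = (if t \<le> a then 0 else if b \<le> t then 1 else \<theta> t)" for t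
  show ?thesis
  proof (rule that[OF e(1), of \<phi>])
    show "strict_mono_on {a..b} \<phi>"
      using \<theta> strict_mono_onD[OF mono] ab unfolding \<phi>_def by (intro strict_mono_onI) auto
    show "\<phi> ` {a..b} = {0..1}"
    proof
      show "\<phi> ` {a..b} \<subseteq> {0..1}"
      proof (rule image_subsetI)
        fix t assume "t \<in> {a..b}"
        then show "\<phi> t \<in> {0..1}" using \<theta>[of t] unfolding \<phi>_def by auto
      qed
      show "{0..1} \<subseteq> \<phi> ` {a..b}"
      proof
        fix y :: real assume y: "y \<in> {0..1}"
        consider "y = 0" | "y = 1" | "0 < y" "y < 1" using y by fastforce
        then show "y \<in> \<phi> ` {a..b}"
        proof cases
          case 1 then have "y = \<phi> a" by (simp add: \<phi>_def)
          then show ?thesis using ab by auto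
        next
          case 2 then have "y = \<phi> b" using ab by (simp add: \<phi>_def)
          then show ?thesis using ab by auto
        next
          case 3
          obtain s where s: "s \<in> {a<..<m}" "\<theta> s < y" using low 3 by blast
          obtain t where t: "t \<in> {m<..<b}" "y < \<theta> t" using high 3 by blast
          have "continuous_on {s..t} \<theta>" by (rule continuous_on_subset[OF cont]) (use s t in auto)
          then obtain x where "s \<le> x" "x \<le> t" "\<theta> x = y"
            using IVT'[of \<theta> s y t] s t by auto
          then have "x \<in> {a..b}" "y = \<phi> x" using s t by (auto simp: \<phi>_def)
          then show ?thesis by blast
        qed
      qed
    qed
    show "p t = gparam G e (\<phi> t)" if "t \<in> {a..b}" for t
      using that pa pb \<theta>[of t] unfolding \<phi>_def by auto
  qed
qed

text \<open>On an interval of vertex times \<open>p\<close> would be constant, as finitely many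
  points of a Hausdorff space are discrete. A constant piece is also the constant branch
  \<open>0\<close> of an outgoing edge, which is not strictly increasing.\<close>

lemma op_path_leaves_vertices:
  assumes op: "op_path G p" and ab: "0 \<le> a" "a < b" "b \<le> 1"
  shows "\<exists>t\<in>{a<..<b}. p t \<notin> gverts G"
proof (rule ccontr)
  assume "\<not> ?thesis"
  then have v: "p t \<in> gverts G" if "t \<in> {a<..<b}" for t using that by blast
  have p: "pathin (gspace G) p" using op by (simp add: op_path_def)
  obtain c d where cd: "a < c" "c < d" "d < b" using ab(2) dense by metis
  have closed: "closed ({t \<in> {0..1}. p t \<in> S})" if "S \<subseteq> gverts G" for S
  proof (rule closedin_closed_trans[of "{0..1}"])
    have "finite S" using that finite_verts finite_subset by blast
    then have "closedin (gspace G) S"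
      using Hausdorff that verts_topspace closedin_Hausdorff_finite by (metis subset_iff)
    then show "closedin (top_of_set {0..1}) {t \<in> {0..1}. p t \<in> S}"
      using closedin_continuous_map_preimage[OF p[unfolded pathin_def]] by fastforce
  qed simp
  have const: "p t = p c" if t: "t \<in> {c..d}" for t
  proof (rule ccontr)
    assume ne: "p t \<noteq> p c"
    let ?A = "{t \<in> {0..1}. p t \<in> {p c}}" and ?B = "{t \<in> {0..1}. p t \<in> gverts G - {p c}}"
    have sub: "{c..d} \<subseteq> {0..1}" and vs: "\<And>s. s \<in> {c..d} \<Longrightarrow> p s \<in> gverts G" using cd ab v by auto
    have "closed ?A" "closed ?B" using closed[of "{p c}"] closed[of "gverts G - {p c}"] vs[of c] cd by auto
    moreover have "{c..d} \<subseteq> ?A \<union> ?B" using sub vs by blast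
    moreover have "c \<in> ?A \<inter> {c..d}" using sub cd by auto
    moreover have "t \<in> ?B \<inter> {c..d}" using sub vs t ne by auto
    moreover have "?A \<inter> ?B \<inter> {c..d} = {}" by auto
    moreover have "connected {c..d}" by simp
    ultimately show False unfolding connected_closed by blast
  qed
  obtain e where e: "e \<in> gedges G" "gparam G e 0 = p c" using out_edge v[of c] cd by auto
  have "\<forall>t\<in>{c..d}. p t = gparam G e 0" using const e(2) by metis
  then have "is_interval {c..d} \<and> {c..d} \<subseteq> {0..1} \<and> continuous_on {c..d} (\<lambda>_. 0::real) \<and>
      (\<lambda>_. 0::real) ` {c..d} \<subseteq> {0..1} \<and> (\<forall>t\<in>{c..d}. p t = gparam G e 0)"
    using cd ab by (auto simp: is_interval_convex_1)
  then have "strict_mono_on {c..d} (\<lambda>_. 0::real)"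
    using op e(1) unfolding op_path_def by blast
  then show False using strict_mono_onD[of "{c..d}" "\<lambda>_. 0::real" c d] cd by simp
qed

lemma op_path_vertex_times_closed:
  assumes "op_path G p"
  shows "closed {t \<in> {0..1}. p t \<in> gverts G}"
proof (rule closedin_closed_trans[of "{0..1}"])
  have "closedin (gspace G) (gverts G)"
    using Hausdorff finite_verts verts_topspace closedin_Hausdorff_finite by (metis subset_iff)
  then show "closedin (top_of_set {0..1}) {t \<in> {0..1}. p t \<in> gverts G}"
    using closedin_continuous_map_preimage assms unfolding op_path_def pathin_def by fastforce
qed simp

text \<open>Infinitely many visits would accumulate at a time \<open>x\<close> with
  \<open>p x\<close> a vertex. Close to \<open>x\<close> there would be a full gap, in which
  \<open>p\<close> runs through the middle of an edge; but the middles form a finite, hence closed,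
  set that misses the vertices.\<close>

lemma op_path_vertex_times_finite:
  assumes op: "op_path G p"
  shows "finite {t \<in> {0..1}. p t \<in> gverts G}" (is "finite ?T")
proof (rule ccontr)
  assume inf: "infinite ?T"
  have clT: "closed ?T" by (rule op_path_vertex_times_closed[OF op])
  have "bounded ?T" by (rule bounded_subset[of "{0..1}"]) auto
  then have "compact ?T" using clT compact_eq_bounded_closed by blast
  then obtain x where x: "x \<in> ?T" "x islimpt ?T"
    using inf Heine_Borel_imp_Bolzano_Weierstrass[of ?T ?T] by blast
  define M where "M = (\<lambda>e. gparam G e (1/2)) ` gedges G"
  have "M \<subseteq> topspace (gspace G)" unfolding M_def using edge_topspace by auto
  then have "closedin (gspace G) M"
    using Hausdorff finite_edges closedin_Hausdorff_finite unfolding M_def by blast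
  then have "openin (gspace G) (topspace (gspace G) - M)" by blast
  then have "openin (top_of_set {0..1}) {t \<in> {0..1}. p t \<in> topspace (gspace G) - M}"
    using openin_continuous_map_preimage op unfolding op_path_def pathin_def by fastforce
  moreover define W where "W = {t \<in> {0..1}. p t \<in> topspace (gspace G) - M}"
  ultimately have "\<forall>x\<in>W. \<exists>\<epsilon>>0. \<forall>t\<in>{0..1}. dist t x < \<epsilon> \<longrightarrow> t \<in> W"
    by (simp add: openin_euclidean_subtopology_iff)
  moreover have "x \<in> W"
    using x(1) verts_topspace edge_vertex_iff[of _ "1/2"] unfolding M_def W_def by auto
  ultimately obtain \<epsilon> where \<epsilon>: "\<epsilon> > 0" "\<And>t. t \<in> {0..1} \<Longrightarrow> dist t x < \<epsilon> \<Longrightarrow> t \<in> W"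
    by blast
  have inf': "infinite (?T \<inter> ball x \<epsilon>)" using x(2) \<epsilon>(1) unfolding islimpt_eq_infinite_ball by blast
  then obtain u' where u': "u' \<in> ?T \<inter> ball x \<epsilon>" using infinite_imp_nonempty by blast
  have "infinite (?T \<inter> ball x \<epsilon> - {u'})" using inf' by simp
  then obtain v' where v': "v' \<in> ?T \<inter> ball x \<epsilon> - {u'}" using infinite_imp_nonempty by blast
  define u v where "u = min u' v'" and "v = max u' v'"
  have uv: "u \<in> ?T \<inter> ball x \<epsilon>" "v \<in> ?T \<inter> ball x \<epsilon>" "u < v"
    using u' v' unfolding u_def v_def min_def max_def by auto
  obtain t where t: "t \<in> {u<..<v}" "p t \<notin> gverts G"
    using op_path_leaves_vertices[OF op, of u v] uv by auto
  \<comment> \<open>The last visit before \<open>t\<close> and the first one after it bound a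
    gap.\<close>
  have "compact (?T \<inter> {u..t})" "compact (?T \<inter> {t..v})" using clT by (auto intro: closed_Int_compact)
  moreover have "u \<in> ?T \<inter> {u..t}" "v \<in> ?T \<inter> {t..v}" using uv t by auto
  ultimately obtain a b where a: "a \<in> ?T \<inter> {u..t}" "\<And>s. s \<in> ?T \<inter> {u..t} \<Longrightarrow> s \<le> a"
    and b: "b \<in> ?T \<inter> {t..v}" "\<And>s. s \<in> ?T \<inter> {t..v} \<Longrightarrow> b \<le> s"
    using compact_attains_sup[of "?T \<inter> {u..t}"] compact_attains_inf[of "?T \<inter> {t..v}"] by blast
  have ab: "0 \<le> a" "a < b" "b \<le> 1" "p a \<in> gverts G" "p b \<in> gverts G"
    using a(1) b(1) t(2) by (auto simp: le_less)
  have "p s \<notin> gverts G" if "s \<in> {a<..<b}" for s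
    using a(2)[of s] b(2)[of s] a(1) b(1) that by (cases "s \<le> t") auto
  from op_path_gap[OF op ab this] obtain e \<phi> where e: "e \<in> gedges G" "\<phi> ` {a..b} = {0..1}"
    "\<And>t. t \<in> {a..b} \<Longrightarrow> p t = gparam G e (\<phi> t)" by metis
  have "1/2 \<in> \<phi> ` {a..b}" using e(2) by simp
  then obtain s where s: "s \<in> {a..b}" "\<phi> s = 1/2" by (metis imageE)
  then have "p s = gparam G e (1/2)" using e(3)[of s] by metis
  then have "p s \<in> M" using e(1) unfolding M_def by blast
  moreover have "s \<in> {0..1}" "dist s x < \<epsilon>"
    using s(1) a(1) b(1) uv by (auto simp: dist_real_def)
  ultimately show False using \<epsilon>(2)[of s] by (simp add: W_def)
qed

theorem op_path_traverses:
  assumes op: "op_path G p" and ends: "p 0 \<in> gverts G" "p 1 \<in> gverts G"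
  shows "traverses G p (edge_path G p)"
proof -
  let ?T = "{t \<in> {0..1}. p t \<in> gverts G}"
  have fin: "finite ?T" by (rule op_path_vertex_times_finite[OF op])
  define xs where "xs = sorted_list_of_set ?T"
  define n where "n = length xs - 1"
  have set: "set xs = ?T" and sorted: "sorted xs" and dist: "distinct xs"
    using fin unfolding xs_def by auto
  have "0 \<in> set xs" "1 \<in> set xs" using ends set by auto
  then obtain i j where i: "i < length xs" "xs ! i = 0" and j: "j < length xs" "xs ! j = 1"
    by (metis in_set_conv_nth)
  have len: "length xs = Suc n" using i(1) unfolding n_def by simp
  have in01: "xs ! k \<in> {0..1}" "p (xs ! k) \<in> gverts G" if "k \<le> n" for k
    using nth_mem[of k xs] that set len by auto
  have x0: "xs ! 0 = 0" using sorted_nth_mono[OF sorted, of 0 i] i in01(1)[of 0] by auto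
  have xn: "xs ! n = 1" using sorted_nth_mono[OF sorted, of j n] j in01(1)[of n] len by auto
  have less: "xs ! k < xs ! Suc k" if "k < n" for k
    using strict_sorted_iff sorted dist that len
    by (metis lessI less_Suc_eq sorted_wrt_nth_less Suc_mono)
  have gap: "p t \<notin> gverts G" if k: "k < n" and t: "t \<in> {xs ! k<..<xs ! Suc k}" for k t
  proof
    assume "p t \<in> gverts G"
    moreover have "t \<in> {0..1}" using in01(1)[of k] in01(1)[of "Suc k"] k t by auto
    ultimately obtain l where l: "l < length xs" "xs ! l = t" using set
      by (metis (mono_tags, lifting) in_set_conv_nth mem_Collect_eq)
    then show False
      using sorted_nth_mono[OF sorted, of l k] sorted_nth_mono[OF sorted, of "Suc k" l] k t len
      by (cases "l \<le> k") auto
  qed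
  have "\<exists>e \<phi>. e \<in> gedges G \<and> strict_mono_on {xs ! k..xs ! Suc k} \<phi> \<and> \<phi> ` {xs ! k..xs ! Suc k} = {0..1} \<and>
      (\<forall>t\<in>{xs ! k..xs ! Suc k}. p t = gparam G e (\<phi> t))" if k: "k < n" for k
  proof -
    have "0 \<le> xs ! k" "xs ! Suc k \<le> 1" "p (xs ! k) \<in> gverts G" "p (xs ! Suc k) \<in> gverts G"
      using in01[of k] in01[of "Suc k"] k by auto
    from op_path_gap[OF op this(1) less[OF k] this(2-4) gap[OF k]] show ?thesis by metis
  qed
  then obtain e \<phi> where e: "\<And>k. k < n \<Longrightarrow> e k \<in> gedges G \<and> strict_mono_on {xs ! k..xs ! Suc k} (\<phi> k) \<and>
      \<phi> k ` {xs ! k..xs ! Suc k} = {0..1} \<and> (\<forall>t\<in>{xs ! k..xs ! Suc k}. p t = gparam G (e k) (\<phi> k t))"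
    by metis
  have "traversal G p (map e [0..<n]) (\<lambda>k. xs ! k) \<phi>"
    unfolding traversal_def using x0 xn less e by simp
  then have "traverses G p (map e [0..<n])" using traverses_traversal by metis
  then show ?thesis using edge_path_eq by metis
qed

end

section \<open>Angle functions\<close>

lemma Ints_valued_constant:
  fixes f :: "'a::topological_space \<Rightarrow> real"
  assumes S: "connected S" "continuous_on S f" and int: "\<And>x. x \<in> S \<Longrightarrow> f x \<in> \<int>"
    and "a \<in> S" "b \<in> S"
  shows "f a = f b"
proof -
  have "f constant_on S"
  proof (rule continuous_discrete_range_constant[OF S])
    fix x assume x: "x \<in> S"
    have "1 \<le> norm (f y - f x)" if "y \<in> S" "f y \<noteq> f x" for y
    proof -
      have "f y - f x \<in> \<int>" using int[OF that(1)] int[OF x] by (rule Ints_diff)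
      then obtain n where "f y - f x = of_int n" by (auto elim: Ints_cases)
      with that(2) show ?thesis by (cases "n = 0") auto
    qed
    then show "\<exists>e>0. \<forall>y. y \<in> S \<and> f y \<noteq> f x \<longrightarrow> e \<le> norm (f y - f x)"
      by (intro exI[of _ 1]) auto
  qed
  then show ?thesis using assms(4,5) unfolding constant_on_def by auto
qed

text \<open>The angles \<open>u\<close> may jump. The difference of the two continuous lifts is
  integer-valued, hence constant, so the increment of a lift is an invariant of the circle-valued
  path. All comparisons of winding numbers below rest on this.\<close>

lemma lift_difference_unique:
  fixes W W' u :: "real \<Rightarrow> real"
  assumes "continuous_on {a..b} W" "\<And>t. t \<in> {a..b} \<Longrightarrow> W t - u t \<in> \<int>"
    and "continuous_on {a..b} W'" "\<And>t. t \<in> {a..b} \<Longrightarrow> W' t - u t \<in> \<int>"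
    and "s \<in> {a..b}" "t \<in> {a..b}"
  shows "W t - W s = W' t - W' s"
proof -
  have "W t - W' t = W s - W' s"
  proof (rule Ints_valued_constant[of "{a..b}" "\<lambda>x. W x - W' x"])
    show "W x - W' x \<in> \<int>" if "x \<in> {a..b}" for x
      using Ints_diff[OF assms(2,4)[OF that]] by simp
  qed (use assms in \<open>auto intro: continuous_intros\<close>)
  then show ?thesis by simp
qed

lemma cis_2pi_cong:
  assumes "x - y \<in> \<int>"
  shows "cis (2 * pi * x) = cis (2 * pi * y)"
proof -
  have "cis (2 * pi * x) = cis (2 * pi * (x - y)) * cis (2 * pi * y)"
    unfolding cis_mult by (simp add: algebra_simps)
  then show ?thesis using assms by simp
qed

text \<open>The map to the circle is \<open>cis (2 * pi * angle G g x)\<close>. The real number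
  itself jumps by \<open>g e\<close> at the end of \<open>e\<close>, so it is continuous only modulo
  the integers.\<close>

definition angle :: "('v, 'e) digraph \<Rightarrow> ('e \<Rightarrow> int) \<Rightarrow> 'v \<Rightarrow> real" where
  "angle G g x = (if x \<in> gverts G then 0
     else THE r. \<exists>e\<in>gedges G. \<exists>t\<in>{0<..<1}. x = gparam G e t \<and> r = of_int (g e) * t)"

context fin_digraph
begin

lemma angle_vertex: "v \<in> gverts G \<Longrightarrow> angle G g v = 0"
  by (simp add: angle_def)

lemma angle_edge:
  assumes e: "e \<in> gedges G" and t: "t \<in> {0<..<1}"
  shows "angle G g (gparam G e t) = of_int (g e) * t"
proof -
  have "gparam G e t \<notin> gverts G" using edge_vertex_iff[OF e, of t] t by auto
  moreover have "(THE r. \<exists>e'\<in>gedges G. \<exists>t'\<in>{0<..<1}. gparam G e t = gparam G e' t' \<and> r = of_int (g e') * t')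
      = of_int (g e) * t"
  proof (rule the_equality)
    fix r assume "\<exists>e'\<in>gedges G. \<exists>t'\<in>{0<..<1}. gparam G e t = gparam G e' t' \<and> r = of_int (g e') * t'"
    then obtain e' t' where "e' \<in> gedges G" "t' \<in> {0<..<1}" "gparam G e t = gparam G e' t'"
      "r = of_int (g e') * t'" by blast
    then show "r = of_int (g e) * t" using edge_inj[OF e, of e' t t'] t by auto
  qed (use e t in blast)
  ultimately show ?thesis by (simp add: angle_def)
qed

lemma angle_edge_Ints:
  assumes e: "e \<in> gedges G" and t: "t \<in> {0..1}"
  shows "of_int (g e) * t - angle G g (gparam G e t) \<in> \<int>"
proof (cases "t \<in> {0<..<1}")
  case False
  then have "t = 0 \<or> t = 1" using t by auto
  then show ?thesis using edge_0[OF e] edge_1[OF e] by (auto simp: angle_vertex)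
qed (simp add: angle_edge e)

lemma angle_add:
  assumes "x \<in> topspace (gspace G)" "\<And>e. e \<in> gedges G \<Longrightarrow> h e = m * g e + n * g' e"
  shows "angle G h x = of_int m * angle G g x + of_int n * angle G g' x"
  using assms(1)
proof (cases rule: topspace_cases)
  case (edge e t)
  then show ?thesis using assms(2)[OF edge(1)] by (simp add: angle_edge algebra_simps)
qed (simp add: angle_vertex)

lemma continuous_map_cis_angle:
  "continuous_map (gspace G) euclidean (\<lambda>x. cis (2 * pi * angle G g x))"
proof (rule continuous_map_graphI)
  fix e assume e: "e \<in> gedges G"
  have "continuous_on {0..1} (\<lambda>t. cis (2 * pi * (of_int (g e) * t)))"
    by (intro continuous_intros)
  then have "continuous_on {0..1} ((\<lambda>x. cis (2 * pi * angle G g x)) \<circ> gparam G e)"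
    by (rule continuous_on_eq) (use cis_2pi_cong[OF angle_edge_Ints[OF e]] in auto)
  then show "continuous_map (top_of_set {0..1}) euclidean ((\<lambda>x. cis (2 * pi * angle G g x)) \<circ> gparam G e)"
    by simp
qed

lemma graph_function_extend:
  fixes w :: "'e \<Rightarrow> real \<Rightarrow> real"
  assumes w: "\<And>e. e \<in> gedges G \<Longrightarrow> continuous_on {0..1} (w e)"
    "\<And>e. e \<in> gedges G \<Longrightarrow> w e 0 = \<rho> (gparam G e 0)" "\<And>e. e \<in> gedges G \<Longrightarrow> w e 1 = \<rho> (gparam G e 1)"
  obtains r where "continuous_map (gspace G) euclideanreal r" "\<And>v. v \<in> gverts G \<Longrightarrow> r v = \<rho> v"
    "\<And>e t. e \<in> gedges G \<Longrightarrow> t \<in> {0..1} \<Longrightarrow> r (gparam G e t) = w e t"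
proof -
  define r where "r x = (if x \<in> gverts G then \<rho> x
    else THE y. \<exists>e\<in>gedges G. \<exists>t\<in>{0<..<1}. x = gparam G e t \<and> y = w e t)" for x
  have v: "r v = \<rho> v" if "v \<in> gverts G" for v using that by (simp add: r_def)
  have re: "r (gparam G e t) = w e t" if e: "e \<in> gedges G" and t: "t \<in> {0..1}" for e t
  proof (cases "t \<in> {0<..<1}")
    case True
    have "gparam G e t \<notin> gverts G" using edge_vertex_iff[OF e t] True by auto
    moreover have "(THE y. \<exists>e'\<in>gedges G. \<exists>t'\<in>{0<..<1}. gparam G e t = gparam G e' t' \<and> y = w e' t') = w e t"
    proof (rule the_equality)
      fix y assume "\<exists>e'\<in>gedges G. \<exists>t'\<in>{0<..<1}. gparam G e t = gparam G e' t' \<and> y = w e' t'"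
      then obtain e' t' where "e' \<in> gedges G" "t' \<in> {0<..<1}" "gparam G e t = gparam G e' t'"
        "y = w e' t'" by blast
      then show "y = w e t" using edge_inj[OF e, of e' t t'] True by auto
    qed (use e True in blast)
    ultimately show ?thesis by (simp add: r_def)
  next
    case False
    then have "t = 0 \<or> t = 1" using t by auto
    then show ?thesis using edge_0[OF e] edge_1[OF e] w(2,3)[OF e] v by auto
  qed
  have "continuous_map (gspace G) euclideanreal r"
  proof (rule continuous_map_graphI)
    fix e assume e: "e \<in> gedges G"
    have "continuous_on {0..1} (r \<circ> gparam G e)"
      by (rule continuous_on_eq[OF w(1)[OF e]]) (simp add: re[OF e])
    then show "continuous_map (top_of_set {0..1}) euclideanreal (r \<circ> gparam G e)" by simp
  qed
  then show ?thesis using that v re by blast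
qed

lemma traversal_lift:
  assumes trav: "traversal G p es \<tau> \<phi>"
  obtains W where "continuous_on {0..1} W" "W 0 = 0" "W 1 = of_int (\<Sum>e\<leftarrow>es. g e)"
    "\<And>t. t \<in> {0..1} \<Longrightarrow> W t - angle G g (p t) \<in> \<int>"
proof -
  have "\<exists>W. continuous_on {0..\<tau> m} W \<and> W 0 = 0 \<and> W (\<tau> m) = of_int (\<Sum>e\<leftarrow>take m es. g e) \<and>
    (\<forall>t\<in>{0..\<tau> m}. W t - angle G g (p t) \<in> \<int>)" if "m \<le> length es" for m
    using that
  proof (induction m)
    case 0
    have "0 \<in> {0..1::real}" by simp
    then have "p 0 \<in> gverts G" using traversal_vertex_iff[OF trav, of 0] traversal_ends[OF trav] by (metis le0)
    then show ?case using traversal_ends(1)[OF trav] by (intro exI[of _ "\<lambda>_. 0"]) (simp add: angle_vertex)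
  next
    case (Suc m)
    then obtain W where W: "continuous_on {0..\<tau> m} W" "W 0 = 0" "W (\<tau> m) = of_int (\<Sum>e\<leftarrow>take m es. g e)"
      "\<And>t. t \<in> {0..\<tau> m} \<Longrightarrow> W t - angle G g (p t) \<in> \<int>" by auto
    have m: "m < length es" using Suc by simp
    note st = traversal_step[OF trav m]
    have \<tau>m: "0 \<le> \<tau> m" using traversal_in[OF trav, of m] m by simp
    \<comment> \<open>The sum over the earlier edges is an integer, so a new piece that starts at
      this height still agrees with the angle modulo \<int>.\<close>
    define c :: real where "c = of_int (\<Sum>e\<leftarrow>take m es. g e)"
    define W' where "W' t = (if t \<le> \<tau> m then W t else c + of_int (g (es ! m)) * \<phi> m t)" for t
    have "continuous_on ({0..\<tau> m} \<union> {\<tau> m..\<tau> (Suc m)}) W'"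
      unfolding W'_def
      by (rule continuous_on_cases[OF _ _ W(1)])
        (use st(5,6) W(3) in \<open>auto intro!: continuous_intros simp: c_def\<close>)
    moreover have "{0..\<tau> m} \<union> {\<tau> m..\<tau> (Suc m)} = {0..\<tau> (Suc m)}" using \<tau>m st(2) by auto
    moreover have "W' 0 = 0" using \<tau>m W(2) by (simp add: W'_def)
    moreover have "W' (\<tau> (Suc m)) = of_int (\<Sum>e\<leftarrow>take (Suc m) es. g e)"
      using st(2,7) m by (simp add: W'_def c_def take_Suc_conv_app_nth)
    moreover have "W' t - angle G g (p t) \<in> \<int>" if t: "t \<in> {0..\<tau> (Suc m)}" for t
    proof (cases "t \<le> \<tau> m")
      case True
      then show ?thesis using W(4) t by (simp add: W'_def)
    next
      case False
      then have t': "t \<in> {\<tau> m..\<tau> (Suc m)}" using t by auto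
      have "\<phi> m t \<in> {0..1}" using st(4) t' by blast
      from angle_edge_Ints[OF st(1) this, of g]
      have "c + (of_int (g (es ! m)) * \<phi> m t - angle G g (p t)) \<in> \<int>"
        unfolding st(8)[OF t'] c_def by (intro Ints_add) auto
      then show ?thesis using False by (simp add: W'_def algebra_simps)
    qed
    ultimately show ?case by metis
  qed
  from this[of "length es"] show ?thesis using that traversal_ends[OF trav] by auto
qed

end

section \<open>Maps between graphs\<close>

text \<open>The image of an edge of \<open>H\<close> is a path of edges of \<open>G\<close>. So
  every point over the interior of an edge of \<open>G\<close> lies on a segment of \<open>H\<close>
  that is mapped onto that edge, and branching can occur over vertices only.\<close>

locale graph_cover = H: fin_digraph H + G: fin_digraph G
  for H :: "('w, 'd) digraph" and G :: "('v, 'e) digraph" +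
  fixes F :: "'w \<Rightarrow> 'v"
  assumes op_map: "op_map H G F"
    and onto: "F ` topspace (gspace H) = topspace (gspace G)"
    and verts: "F ` gverts H \<subseteq> gverts G"
begin

lemma continuous: "continuous_map (gspace H) (gspace G) F"
  using op_map by (simp add: op_map_def)

lemma traverses_edge:
  assumes "d \<in> gedges H"
  shows "traverses G (F \<circ> gparam H d) (edge_path G (F \<circ> gparam H d))"
proof (rule G.op_path_traverses)
  show "op_path G (F \<circ> gparam H d)" using op_map H.op_path_edge[OF assms] by (simp add: op_map_def)
qed (use verts H.edge_0 H.edge_1 assms in auto)

lemma pullback_eq:
  assumes "d \<in> gedges H"
  shows "pullback G H F g d = (\<Sum>e\<leftarrow>edge_path G (F \<circ> gparam H d). g e)"
  using assms by (simp add: pullback_def)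

text \<open>Along an edge of \<open>H\<close>, the lift of the angle of \<open>g\<close> and the
  linear function with the same total winding agree at both ends. Their difference vanishes at the
  vertices and therefore glues to the real function \<open>r\<close>, a homotopy relative to the
  vertices.\<close>

lemma angle_pullback:
  obtains r where "continuous_map (gspace H) euclideanreal r" "\<And>v. v \<in> gverts H \<Longrightarrow> r v = 0"
    "\<And>x. x \<in> topspace (gspace H) \<Longrightarrow> angle G g (F x) - angle H (pullback G H F g) x - r x \<in> \<int>"
proof -
  have "\<exists>W. continuous_on {0..1} W \<and> W 0 = 0 \<and> W 1 = of_int (pullback G H F g d) \<and>
    (\<forall>t\<in>{0..1}. W t - angle G g (F (gparam H d t)) \<in> \<int>)" if "d \<in> gedges H" for d
    using traverses_edge[OF that] unfolding traverses_traversal pullback_eq[OF that]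
    by (elim exE G.traversal_lift[where g = g]) (auto simp: o_def)
  then obtain W where W: "\<And>d. d \<in> gedges H \<Longrightarrow> continuous_on {0..1} (W d)"
    "\<And>d. d \<in> gedges H \<Longrightarrow> W d 0 = 0" "\<And>d. d \<in> gedges H \<Longrightarrow> W d 1 = of_int (pullback G H F g d)"
    "\<And>d t. d \<in> gedges H \<Longrightarrow> t \<in> {0..1} \<Longrightarrow> W d t - angle G g (F (gparam H d t)) \<in> \<int>"
    by metis
  obtain r where r: "continuous_map (gspace H) euclideanreal r" "\<And>v. v \<in> gverts H \<Longrightarrow> r v = 0"
    "\<And>d t. d \<in> gedges H \<Longrightarrow> t \<in> {0..1} \<Longrightarrow> r (gparam H d t) = W d t - of_int (pullback G H F g d) * t"
    by (rule H.graph_function_extend[of "\<lambda>d t. W d t - of_int (pullback G H F g d) * t" "\<lambda>_. 0"])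
      (auto intro!: continuous_intros simp: W)
  have "angle G g (F x) - angle H (pullback G H F g) x - r x \<in> \<int>" if x: "x \<in> topspace (gspace H)" for x
  proof -
    obtain d t where d: "d \<in> gedges H" "t \<in> {0<..1}" "x = gparam H d t"
      using H.topspace_edge_in[OF x] by blast
    then have t: "t \<in> {0..1}" by simp
    have "angle G g (F x) - angle H (pullback G H F g) x - r x =
        (of_int (pullback G H F g d) * t - angle H (pullback G H F g) x) - (W d t - angle G g (F x))"
      using r(3)[OF d(1) t] d(3) by simp
    also have "\<dots> \<in> \<int>"
      using Ints_diff[OF H.angle_edge_Ints[OF d(1) t] W(4)[OF d(1) t]] d(3) by simp
    finally show ?thesis .
  qed
  then show ?thesis using that r by blast
qed

text \<open>Computes the pullback from an arbitrary lift, without reference to edge words.\<close>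

lemma pullback_lift:
  assumes d: "d \<in> gedges H" and W: "continuous_on {0..1} W"
    "\<And>t. t \<in> {0..1} \<Longrightarrow> W t - angle G g (F (gparam H d t)) \<in> \<int>"
  shows "of_int (pullback G H F g d) = W 1 - W 0"
proof -
  obtain \<tau> \<phi> where "traversal G (F \<circ> gparam H d) (edge_path G (F \<circ> gparam H d)) \<tau> \<phi>"
    using traverses_edge[OF d] traverses_traversal by metis
  from G.traversal_lift[OF this, of g] obtain W' where W': "continuous_on {0..1} W'" "W' 0 = 0"
    "W' 1 = of_int (pullback G H F g d)"
    "\<And>t. t \<in> {0..1} \<Longrightarrow> W' t - angle G g (F (gparam H d t)) \<in> \<int>"
    unfolding pullback_eq[OF d] by (auto simp: o_def)
  have "W 1 - W 0 = W' 1 - W' 0"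
    using lift_difference_unique[OF W W'(1,4), of 0 1] by simp
  then show ?thesis using W' by simp
qed

text \<open>The point \<open>w\<close> is no vertex, since vertices are sent to vertices. It lies in
  one piece of the edge path of its edge, and the inverse of the reparametrization of that piece is
  the segment.\<close>

lemma segment_lift:
  assumes w: "w \<in> topspace (gspace H)" and e: "e \<in> gedges G" and t: "t \<in> {0<..<1}"
    and Fw: "F w = gparam G e t"
  obtains d \<psi> where "d \<in> gedges H" "strict_mono_on {0..1} \<psi>" "continuous_on {0..1} \<psi>"
    "\<psi> ` {0..1} \<subseteq> {0..1}" "\<And>s. s \<in> {0..1} \<Longrightarrow> F (gparam H d (\<psi> s)) = gparam G e s"
    "w = gparam H d (\<psi> t)"
proof -
  have nv: "F w \<notin> gverts G" using G.edge_vertex_iff[OF e, of t] t Fw by auto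
  then obtain d s where d: "d \<in> gedges H" "s \<in> {0<..<1}" "w = gparam H d s"
    using w verts by (auto elim!: H.topspace_cases)
  obtain \<tau> \<phi> where trav: "traversal G (F \<circ> gparam H d) (edge_path G (F \<circ> gparam H d)) \<tau> \<phi>"
    (is "traversal _ _ ?es _ _") using traverses_edge[OF d(1)] traverses_traversal by metis
  have s01: "s \<in> {0..1}" using d(2) by simp
  obtain i where i: "i < length ?es" "s \<in> {\<tau> i..\<tau> (Suc i)}" using traversal_locate[OF trav s01] .
  note st = traversal_step[OF trav i(1)]
  have "\<phi> i s \<in> {0..1}" using st(4) i(2) by blast
  moreover have "gparam G e t = gparam G (?es ! i) (\<phi> i s)" using st(8)[OF i(2)] d(3) Fw by simp
  ultimately have eq: "?es ! i = e" "\<phi> i s = t" using G.edge_inj[OF e st(1) t] by auto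
  obtain \<psi> where \<psi>: "strict_mono_on {0..1} \<psi>" "\<psi> ` {0..1} = {\<tau> i..\<tau> (Suc i)}" "continuous_on {0..1} \<psi>"
    "\<And>x. x \<in> {\<tau> i..\<tau> (Suc i)} \<Longrightarrow> \<psi> (\<phi> i x) = x" "\<And>y. y \<in> {0..1} \<Longrightarrow> \<phi> i (\<psi> y) = y"
    using strict_mono_onto_inverse[OF st(3,4)] by metis
  have "{\<tau> i..\<tau> (Suc i)} \<subseteq> {0..1}"
    using traversal_in[OF trav, of i] traversal_in[OF trav, of "Suc i"] i(1) by auto
  moreover have "F (gparam H d (\<psi> y)) = gparam G e y" if "y \<in> {0..1}" for y
  proof -
    have "\<psi> y \<in> {\<tau> i..\<tau> (Suc i)}" using \<psi>(2) that by blast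
    from st(8)[OF this] show ?thesis using eq(1) \<psi>(5)[OF that] by simp
  qed
  moreover have "w = gparam H d (\<psi> t)" using \<psi>(4)[OF i(2)] eq(2) d(3) by simp
  ultimately show ?thesis using that[OF d(1) \<psi>(1,3)] \<psi>(2) by simp
qed

text \<open>No branching over an open edge: the set of parameters at which \<open>p\<close> follows
  the segment is closed because \<open>H\<close> is Hausdorff, and open because it is the set at
  which \<open>p\<close> lies in an open piece of \<open>d\<close>.\<close>

lemma segment_unique:
  assumes T: "connected_space T" and p: "continuous_map T (gspace H) p"
    and e: "e \<in> gedges G" and \<alpha>: "\<And>s. s \<in> topspace T \<Longrightarrow> \<alpha> s \<in> {0<..<1} \<and> F (p s) = gparam G e (\<alpha> s)"
    and d: "d \<in> gedges H" and \<psi>: "strict_mono_on {0..1} \<psi>" "continuous_on {0..1} \<psi>"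
    "\<psi> ` {0..1} \<subseteq> {0..1}" "\<And>s. s \<in> {0..1} \<Longrightarrow> F (gparam H d (\<psi> s)) = gparam G e s"
    and s0: "s0 \<in> topspace T" "p s0 = gparam H d (\<psi> (\<alpha> s0))" and s: "s \<in> topspace T"
  shows "p s = gparam H d (\<psi> (\<alpha> s))"
proof -
  let ?A = "{s \<in> topspace T. p s = gparam H d (\<psi> (\<alpha> s))}"
  have \<psi>01: "\<psi> 0 \<in> {0..1}" "\<psi> 1 \<in> {0..1}" using \<psi>(3) by (simp_all add: image_subset_iff)
  have "continuous_map T (gspace G) (F \<circ> p)" using p continuous continuous_map_compose by blast
  then have "continuous_map T euclideanreal \<alpha>"
    using G.continuous_map_coordinate[OF e, of T "F \<circ> p" \<alpha>] \<alpha> by simp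
  then have "continuous_map T (top_of_set {0..1}) \<alpha>"
    using \<alpha> by (force simp: continuous_map_in_subtopology)
  moreover have "continuous_map (top_of_set {0..1}) (top_of_set {0..1}) \<psi>"
    using \<psi>(2,3) by (simp add: continuous_map_in_subtopology image_subset_iff_funcset)
  moreover have "continuous_map (top_of_set {0..1}) (gspace H) (gparam H d)"
    using H.pathin_edge[OF d] by (simp add: pathin_def)
  ultimately have "continuous_map T (gspace H) (gparam H d \<circ> (\<psi> \<circ> \<alpha>))"
    by (meson continuous_map_compose)
  then have "closedin T ?A"
    using closedin_continuous_maps_eq[OF H.Hausdorff p] by (simp add: o_def)
  moreover have "openin T ?A"
  proof -
    have "openin (gspace H) (gparam H d ` {\<psi> 0<..<\<psi> 1})"
      using H.openin_edge_interval[OF d] \<psi>01 by auto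
    then have op: "openin T {s \<in> topspace T. p s \<in> gparam H d ` {\<psi> 0<..<\<psi> 1}}"
      using openin_continuous_map_preimage[OF p] by blast
    \<comment> \<open>Within the open piece of \<open>d\<close> the position is forced by the image
      in \<open>G\<close>, so lying there already means agreement with the segment.\<close>
    have "{s \<in> topspace T. p s \<in> gparam H d ` {\<psi> 0<..<\<psi> 1}} = ?A"
    proof (intro Collect_cong conj_cong refl iffI)
      fix s assume s: "s \<in> topspace T" and "p s \<in> gparam H d ` {\<psi> 0<..<\<psi> 1}"
      then obtain u where u: "u \<in> {\<psi> 0<..<\<psi> 1}" "p s = gparam H d u" by blast
      then obtain y where y: "0 \<le> y" "y \<le> 1" "\<psi> y = u" using IVT'[of \<psi> 0 u 1] \<psi>(2) by auto
      then have "gparam G e (\<alpha> s) = gparam G e y" using \<psi>(4)[of y] \<alpha>[OF s] u by simp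
      then have "\<alpha> s = y" using G.edge_inj(2)[OF e e, of "\<alpha> s" y] \<alpha>[OF s] y by auto
      then show "p s = gparam H d (\<psi> (\<alpha> s))" using u y by simp
    next
      fix s assume s: "s \<in> topspace T" and "p s = gparam H d (\<psi> (\<alpha> s))"
      moreover have "\<psi> (\<alpha> s) \<in> {\<psi> 0<..<\<psi> 1}"
        using strict_mono_onD[OF \<psi>(1), of 0 "\<alpha> s"] strict_mono_onD[OF \<psi>(1), of "\<alpha> s" 1] \<alpha>[OF s] by auto
      ultimately show "p s \<in> gparam H d ` {\<psi> 0<..<\<psi> 1}" by blast
    qed
    then show ?thesis using op by simp
  qed
  ultimately have "?A = {} \<or> ?A = topspace T" using T connected_space_clopen_in by blast
  then show ?thesis using s0 s by blast
qed

end

lemma graph_cover_compose: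
  assumes "graph_cover K H F'" "graph_cover H G F"
  shows "graph_cover K G (F \<circ> F')"
proof -
  interpret A: graph_cover K H F' by fact
  interpret B: graph_cover H G F by fact
  show ?thesis
  proof
    show "op_map K G (F \<circ> F')" using A.op_map B.op_map
      unfolding op_map_def by (metis comp_assoc continuous_map_compose)
    show "(F \<circ> F') ` topspace (gspace K) = topspace (gspace G)"
      using A.onto B.onto by (metis image_comp)
    show "(F \<circ> F') ` gverts K \<subseteq> gverts G" using A.verts B.verts by auto
  qed
qed

text \<open>Adding the homotopies of the two stages to the linear winding gives a lift of the angle
  of \<open>g\<close> along \<open>d\<close>. Both homotopies vanish at vertices, so the increment
  of this lift is the winding number of the two-stage pullback. Edge words need not be
  concatenated.\<close>

lemma pullback_compose:
  assumes "graph_cover K H F'" "graph_cover H G F"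
  shows "pullback G K (F \<circ> F') g = pullback H K F' (pullback G H F g)"
proof -
  interpret A: graph_cover K H F' by fact
  interpret B: graph_cover H G F by fact
  interpret C: graph_cover K G "F \<circ> F'" using graph_cover_compose assms .
  obtain r where r: "continuous_map (gspace H) euclideanreal r" "\<And>v. v \<in> gverts H \<Longrightarrow> r v = 0"
    "\<And>x. x \<in> topspace (gspace H) \<Longrightarrow> angle G g (F x) - angle H (pullback G H F g) x - r x \<in> \<int>"
    using B.angle_pullback[of g] by blast
  obtain r' where r': "continuous_map (gspace K) euclideanreal r'" "\<And>v. v \<in> gverts K \<Longrightarrow> r' v = 0"
    "\<And>x. x \<in> topspace (gspace K) \<Longrightarrow> angle H (pullback G H F g) (F' x)
       - angle K (pullback H K F' (pullback G H F g)) x - r' x \<in> \<int>"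
    using A.angle_pullback[of "pullback G H F g"] by blast
  let ?g2 = "pullback H K F' (pullback G H F g)"
  have "pullback G K (F \<circ> F') g d = ?g2 d" if d: "d \<in> gedges K" for d
  proof -
    define W where "W t = of_int (?g2 d) * t + r' (gparam K d t) + r (F' (gparam K d t))" for t
    have path: "continuous_map (top_of_set {0..1}) (gspace K) (gparam K d)"
      using A.H.pathin_edge[OF d] by (simp add: pathin_def)
    have "continuous_on {0..1} (\<lambda>t. r' (gparam K d t))"
      using continuous_map_compose[OF path r'(1)] by (simp add: o_def)
    moreover have "continuous_on {0..1} (\<lambda>t. r (F' (gparam K d t)))"
      using continuous_map_compose[OF continuous_map_compose[OF path A.continuous] r(1)] by (simp add: o_def)
    ultimately have "continuous_on {0..1} W" unfolding W_def by (intro continuous_intros)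
    moreover have "W t - angle G g ((F \<circ> F') (gparam K d t)) \<in> \<int>" if t: "t \<in> {0..1}" for t
    proof -
      let ?x = "gparam K d t"
      have x: "?x \<in> topspace (gspace K)" using A.H.edge_topspace[OF d t] .
      then have "F' ?x \<in> topspace (gspace H)" using A.onto by blast
      note Ints_diff[OF Ints_diff[OF A.H.angle_edge_Ints[OF d t, of ?g2] r'(3)[OF x]] r(3)[OF this]]
      then show ?thesis by (simp add: W_def algebra_simps)
    qed
    ultimately have "of_int (pullback G K (F \<circ> F') g d) = W 1 - W 0"
      by (rule C.pullback_lift[OF d])
    also have "\<dots> = of_int (?g2 d)"
      using r(2) r'(2) A.H.edge_0[OF d] A.H.edge_1[OF d] A.verts by (simp add: W_def image_subset_iff)
    finally show ?thesis by simp
  qed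
  moreover have "pullback G K (F \<circ> F') g d = ?g2 d" if "d \<notin> gedges K" for d
    using that by (simp add: pullback_def)
  ultimately show ?thesis by blast
qed

section \<open>Monotone segments of edges\<close>

definition edge_segment :: "('v, 'e) digraph \<Rightarrow> 'e \<Rightarrow> (real \<Rightarrow> real) \<Rightarrow> (real \<Rightarrow> 'v) \<Rightarrow> bool" where
  "edge_segment G d \<psi> p \<longleftrightarrow> d \<in> gedges G \<and> strict_mono_on {0..1} \<psi> \<and> continuous_on {0..1} \<psi> \<and>
     \<psi> ` {0..1} \<subseteq> {0..1} \<and> (\<forall>t\<in>{0..1}. p t = gparam G d (\<psi> t))"

lemma edge_segmentD:
  assumes "edge_segment G d \<psi> p"
  shows "d \<in> gedges G" "strict_mono_on {0..1} \<psi>" "continuous_on {0..1} \<psi>" "\<psi> ` {0..1} \<subseteq> {0..1}"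
    "\<And>t. t \<in> {0..1} \<Longrightarrow> p t = gparam G d (\<psi> t)"
  using assms by (auto simp: edge_segment_def)

lemma continuous_maps_agree_on_closed_interval:
  assumes Z: "Hausdorff_space Z" and g: "continuous_map (top_of_set {0..1}) Z g"
    and g': "continuous_map (top_of_set {0..1}) Z g'"
    and eq: "\<And>t. t \<in> {0<..<1::real} \<Longrightarrow> g t = g' t" and t: "t \<in> {0..1}"
  shows "g t = g' t"
proof -
  have "closedin (top_of_set {0..1}) {t \<in> {0..1}. g t = g' t}"
    using closedin_continuous_maps_eq[OF Z g g'] by simp
  then have "closed {t \<in> {0..1}. g t = g' t}" by (rule closedin_closed_trans) simp
  moreover have "{0<..<1} \<subseteq> {t \<in> {0..1}. g t = g' t}" using eq by auto
  ultimately have "closure {0<..<1} \<subseteq> {t \<in> {0..1}. g t = g' t}" by (metis closure_minimal)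
  then show ?thesis using t by auto
qed

context fin_digraph
begin

lemma edge_segment_continuous:
  assumes "edge_segment G d \<psi> p"
  shows "continuous_map (top_of_set {0..1}) (gspace G) p"
proof -
  note D = edge_segmentD[OF assms]
  have "continuous_map (top_of_set {0..1}) (top_of_set {0..1}) \<psi>"
    using D(3,4) by (simp add: continuous_map_in_subtopology image_subset_iff_funcset)
  then have "continuous_map (top_of_set {0..1}) (gspace G) (gparam G d \<circ> \<psi>)"
    using pathin_edge[OF D(1)] continuous_map_compose unfolding pathin_def by blast
  then show ?thesis by (rule continuous_map_eq) (simp add: D(5))
qed

end

context graph_cover
begin

text \<open>Each piece of an edge path meets the point at most once. The finiteness later makes the
  dependence of a lift on its base point continuous, coordinate by coordinate.\<close>

lemma fibre_finite:
  assumes e: "e \<in> gedges G" and t: "t \<in> {0<..<1}"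
  shows "finite {w \<in> topspace (gspace H). F w = gparam G e t}"
proof -
  have fin: "finite {s \<in> {0..1}. F (gparam H d s) = gparam G e t}" if d: "d \<in> gedges H" for d
  proof -
    obtain \<tau> \<phi> where trav: "traversal G (F \<circ> gparam H d) (edge_path G (F \<circ> gparam H d)) \<tau> \<phi>"
      (is "traversal _ _ ?es _ _") using traverses_edge[OF d] traverses_traversal by metis
    have "finite {s \<in> {\<tau> i..\<tau> (Suc i)}. \<phi> i s = t}" if i: "i < length ?es" for i
    proof -
      have "inj_on (\<phi> i) {\<tau> i..\<tau> (Suc i)}"
        using traversal_step(3)[OF trav i] strict_mono_on_imp_inj_on by blast
      then have "inj_on (\<phi> i) {s \<in> {\<tau> i..\<tau> (Suc i)}. \<phi> i s = t}" by (rule inj_on_subset) auto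
      moreover have "\<phi> i ` {s \<in> {\<tau> i..\<tau> (Suc i)}. \<phi> i s = t} \<subseteq> {t}" by auto
      ultimately show ?thesis using finite_imageD finite_subset by blast
    qed
    then have "finite (\<Union>i<length ?es. {s \<in> {\<tau> i..\<tau> (Suc i)}. \<phi> i s = t})" by blast
    moreover have "{s \<in> {0..1}. F (gparam H d s) = gparam G e t}
        \<subseteq> (\<Union>i<length ?es. {s \<in> {\<tau> i..\<tau> (Suc i)}. \<phi> i s = t})"
    proof
      fix s assume "s \<in> {s \<in> {0..1}. F (gparam H d s) = gparam G e t}"
      then have s: "s \<in> {0..1}" "F (gparam H d s) = gparam G e t" by auto
      obtain i where i: "i < length ?es" "s \<in> {\<tau> i..\<tau> (Suc i)}" using traversal_locate[OF trav s(1)] .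
      note st = traversal_step[OF trav i(1)]
      have "\<phi> i s \<in> {0..1}" using st(4) i(2) by blast
      moreover have "gparam G e t = gparam G (?es ! i) (\<phi> i s)" using st(8)[OF i(2)] s(2) by simp
      ultimately have "\<phi> i s = t" using G.edge_inj(2)[OF e st(1) t] by auto
      then show "s \<in> (\<Union>i<length ?es. {s \<in> {\<tau> i..\<tau> (Suc i)}. \<phi> i s = t})" using i by blast
    qed
    ultimately show ?thesis using finite_subset by blast
  qed
  have "{w \<in> topspace (gspace H). F w = gparam G e t}
      \<subseteq> (\<Union>d\<in>gedges H. gparam H d ` {s \<in> {0..1}. F (gparam H d s) = gparam G e t})"
  proof
    fix w assume "w \<in> {w \<in> topspace (gspace H). F w = gparam G e t}"
    then have w: "w \<in> topspace (gspace H)" "F w = gparam G e t" by auto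
    then obtain d s where "d \<in> gedges H" "s \<in> {0<..1}" "w = gparam H d s"
      using H.topspace_edge_in[OF w(1)] by blast
    moreover from this have "s \<in> {s \<in> {0..1}. F (gparam H d s) = gparam G e t}" using w by simp
    ultimately show "w \<in> (\<Union>d\<in>gedges H. gparam H d ` {s \<in> {0..1}. F (gparam H d s) = gparam G e t})"
      by blast
  qed
  moreover have "finite (\<Union>d\<in>gedges H. gparam H d ` {s \<in> {0..1}. F (gparam H d s) = gparam G e t})"
    using fin H.finite_edges by blast
  ultimately show ?thesis using finite_subset by blast
qed

lemma traversal_segment:
  assumes d: "d \<in> gedges H" and trav: "traversal G (F \<circ> gparam H d) es \<tau> \<phi>" and i: "i < length es"
  obtains \<psi> where "edge_segment H d \<psi> (gparam H d \<circ> \<psi>)" "\<psi> 0 = \<tau> i" "\<psi> 1 = \<tau> (Suc i)"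
    "\<And>s. s \<in> {0..1} \<Longrightarrow> F (gparam H d (\<psi> s)) = gparam G (es ! i) s"
proof -
  note st = traversal_step[OF trav i]
  obtain \<psi> where \<psi>: "strict_mono_on {0..1} \<psi>" "\<psi> ` {0..1} = {\<tau> i..\<tau> (Suc i)}" "continuous_on {0..1} \<psi>"
    "\<And>x. x \<in> {\<tau> i..\<tau> (Suc i)} \<Longrightarrow> \<psi> (\<phi> i x) = x" "\<And>y. y \<in> {0..1} \<Longrightarrow> \<phi> i (\<psi> y) = y"
    using strict_mono_onto_inverse[OF st(3,4)] by metis
  have ends: "\<psi> 0 = \<tau> i" "\<psi> 1 = \<tau> (Suc i)" using strict_mono_onto_endpoints[OF \<psi>(1,2)] by auto
  have "{\<tau> i..\<tau> (Suc i)} \<subseteq> {0..1}"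
    using traversal_in[OF trav, of i] traversal_in[OF trav, of "Suc i"] i by auto
  then have "edge_segment H d \<psi> (gparam H d \<circ> \<psi>)" using d \<psi> by (simp add: edge_segment_def)
  moreover have "F (gparam H d (\<psi> y)) = gparam G (es ! i) y" if "y \<in> {0..1}" for y
  proof -
    have "\<psi> y \<in> {\<tau> i..\<tau> (Suc i)}" using \<psi>(2) that by blast
    from st(8)[OF this] show ?thesis using \<psi>(5)[OF that] by simp
  qed
  ultimately show ?thesis using that ends by blast
qed

text \<open>Here \<open>w\<close> may be a vertex or an interior point of an edge of
  \<open>H\<close>; in both cases it is a break point of an edge through it, and the piece on the
  proper side of it is taken.\<close>

lemma segment_to_vertex:
  assumes w: "w \<in> topspace (gspace H)" "F w \<in> gverts G" and u: "u = 0 \<or> u = 1"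
  obtains e d \<psi> where "e \<in> gedges G" "edge_segment H d \<psi> (gparam H d \<circ> \<psi>)"
    "\<And>s. s \<in> {0..1} \<Longrightarrow> F (gparam H d (\<psi> s)) = gparam G e s" "gparam H d (\<psi> u) = w"
proof -
  \<comment> \<open>For \<open>u = 1\<close> the segment ends at \<open>w\<close>, so
    \<open>w\<close> must not be the start of \<open>d\<close>; for \<open>u = 0\<close> it must not
    be its end.\<close>
  obtain d s where d: "d \<in> gedges H" "s \<in> {0..1}" "w = gparam H d s" "s \<noteq> 1 - u"
  proof (cases "u = 1")
    case True
    obtain d s where "d \<in> gedges H" "s \<in> {0<..1}" "w = gparam H d s"
      using H.topspace_edge_in[OF w(1)] by blast
    then show ?thesis using that[of d s] True by simp
  next
    case False
    obtain d s where "d \<in> gedges H" "s \<in> {0..<1}" "w = gparam H d s"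
      using H.topspace_edge_out[OF w(1)] by blast
    then show ?thesis using that[of d s] u False by simp
  qed
  obtain \<tau> \<phi> where trav: "traversal G (F \<circ> gparam H d) (edge_path G (F \<circ> gparam H d)) \<tau> \<phi>"
    (is "traversal _ _ ?es _ _") using traverses_edge[OF d(1)] traverses_traversal by metis
  have "(F \<circ> gparam H d) s \<in> gverts G" using w d by simp
  then obtain j where j: "j \<le> length ?es" "s = \<tau> j"
    using G.traversal_vertex_iff[OF trav d(2)] by blast
  have "\<exists>i<length ?es. s = (if u = 0 then \<tau> i else \<tau> (Suc i))"
  proof (cases "u = 0")
    case True
    then have "j < length ?es" using j d(4) traversal_ends(2)[OF trav] by (cases "j = length ?es") auto
    with True j show ?thesis by auto
  next
    case False
    then have "j \<noteq> 0" using u j d(4) traversal_ends(1)[OF trav] by (cases "j = 0") auto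
    then obtain i where "j = Suc i" using not0_implies_Suc by blast
    with False j show ?thesis by (intro exI[of _ i]) auto
  qed
  then obtain i where i: "i < length ?es" "s = (if u = 0 then \<tau> i else \<tau> (Suc i))" by blast
  obtain \<psi> where \<psi>: "edge_segment H d \<psi> (gparam H d \<circ> \<psi>)" "\<psi> 0 = \<tau> i" "\<psi> 1 = \<tau> (Suc i)"
    "\<And>s. s \<in> {0..1} \<Longrightarrow> F (gparam H d (\<psi> s)) = gparam G (?es ! i) s"
    using traversal_segment[OF d(1) trav i(1)] by blast
  have "gparam H d (\<psi> u) = w" using u i(2) \<psi>(2,3) d(3) by auto
  with \<psi>(1,4) traversal_step(1)[OF trav i(1)] show ?thesis using that by blast
qed

text \<open>Agreement is assumed at an inner parameter, because segments with a common end point may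
  branch there. Agreement at the ends then follows by continuity.\<close>

lemma segment_unique_closed:
  assumes p: "continuous_map (top_of_set {0..1}) (gspace H) p"
    and e: "e \<in> gedges G" and Fp: "\<And>s. s \<in> {0..1} \<Longrightarrow> F (p s) = gparam G e s"
    and d: "edge_segment H d \<psi> q" and Fq: "\<And>s. s \<in> {0..1} \<Longrightarrow> F (q s) = gparam G e s"
    and s0: "s0 \<in> {0<..<1}" "p s0 = q s0" and s: "s \<in> {0..1}"
  shows "p s = q s"
proof -
  note D = edge_segmentD[OF d]
  have "p t = q t" if t: "t \<in> {0<..<1}" for t
  proof -
    have "connected_space (top_of_set {0<..<1::real})" by (simp add: connected_space_subtopology)
    moreover have "continuous_map (top_of_set {0<..<1}) (gspace H) p"
      using p by (rule continuous_map_from_subtopology_mono) auto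
    ultimately have "p t = gparam H d (\<psi> t)"
      using segment_unique[of "top_of_set {0<..<1}" p e "\<lambda>s. s" d \<psi> s0 t] D e s0 t Fp Fq by simp
    then show ?thesis using D(5)[of t] t by simp
  qed
  then show ?thesis
    using continuous_maps_agree_on_closed_interval[OF H.Hausdorff p H.edge_segment_continuous[OF d]] s
    by blast
qed

end

section \<open>Inverse limits of graphs\<close>

locale graph_tower =
  fixes X :: "nat \<Rightarrow> ('v, 'e) digraph" and f :: "nat \<Rightarrow> 'v \<Rightarrow> 'v"
  assumes bond: "\<And>k. graph_cover (X (Suc k)) (X k) (f (Suc k))"
    and compact: "compact_space (inverse_limit X f)"
begin

abbreviation Y :: "(nat \<Rightarrow> 'v) topology" where "Y \<equiv> inverse_limit X f"

sublocale X: fin_digraph "X k" for k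
  using bond[of k] by (simp add: graph_cover_def)

lemma bonding_self [simp]: "bonding f k k = id"
  by (cases k) auto

lemma cover: "k \<le> m \<Longrightarrow> graph_cover (X m) (X k) (bonding f k m)"
proof (induction m rule: dec_induct)
  case base
  have "graph_cover_axioms (X k) (X k) id"
    by (simp add: graph_cover_axioms_def op_map_def id_def o_def)
  then show ?case unfolding bonding_self graph_cover_def using X.fin_digraph_axioms by blast
next
  case (step m)
  then have "bonding f k (Suc m) = bonding f k m \<circ> f (Suc m)" by simp
  then show ?case using graph_cover_compose[OF bond[of m] step(3)] by metis
qed

lemma bonding_compose:
  assumes "k \<le> l" "l \<le> m"
  shows "bonding f k m = bonding f k l \<circ> bonding f l m"
  using assms(2)
proof (induction m rule: dec_induct)
  case (step m)
  then show ?case using assms(1) by (simp add: o_assoc)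
qed simp

lemma bonding_step: "k < m \<Longrightarrow> bonding f k m = f (Suc k) \<circ> bonding f (Suc k) m"
  using bonding_compose[of k "Suc k" m] by simp

lemma topspace_Y:
  "x \<in> topspace Y \<longleftrightarrow> (\<forall>k. x k \<in> topspace (gspace (X k))) \<and> (\<forall>k. f (Suc k) (x (Suc k)) = x k)"
  by (auto simp: inverse_limit_def)

lemma continuous_map_proj: "continuous_map Y (gspace (X k)) (\<lambda>x. x k)"
  unfolding inverse_limit_def
  by (intro continuous_map_from_subtopology continuous_map_product_projection) simp

lemma continuous_map_of_proj:
  assumes "continuous_map (gspace (X m)) Z r"
  shows "continuous_map Y Z (\<lambda>x. r (x m))"
  using continuous_map_compose[OF continuous_map_proj assms] by (simp add: o_def)

lemma continuous_map_Y:
  assumes "\<And>k. continuous_map T (gspace (X k)) (\<lambda>t. g t k)" "\<And>t. t \<in> topspace T \<Longrightarrow> g t \<in> topspace Y"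
  shows "continuous_map T Y g"
  unfolding inverse_limit_def
  using assms topspace_Y by (auto simp: continuous_map_in_subtopology continuous_map_componentwise_UNIV)

lemma Hausdorff_Y: "Hausdorff_space Y"
  unfolding inverse_limit_def
  by (intro Hausdorff_space_subtopology) (simp add: Hausdorff_space_product_topology X.Hausdorff)

lemma bonding_proj: "x \<in> topspace Y \<Longrightarrow> k \<le> m \<Longrightarrow> bonding f k m (x m) = x k"
proof (induction m)
  case (Suc m)
  then show ?case by (cases "k = Suc m") (auto simp: topspace_Y)
qed simp

lemma proj_eq_le: "x \<in> topspace Y \<Longrightarrow> y \<in> topspace Y \<Longrightarrow> x m = y m \<Longrightarrow> k \<le> m \<Longrightarrow> x k = y k"
  using bonding_proj by metis

text \<open>Above level \<open>k\<close> preimages are chosen one level at a time; below it the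
  coordinates are forced.\<close>

lemma proj_onto:
  assumes w: "w \<in> topspace (gspace (X k))"
  obtains x where "x \<in> topspace Y" "x k = w"
proof -
  have "\<exists>y. \<forall>n. (y n \<in> topspace (gspace (X (k + n))) \<and> (n = 0 \<longrightarrow> y n = w)) \<and>
      f (Suc (k + n)) (y (Suc n)) = y n"
  proof (rule dependent_nat_choice)
    show "\<exists>x. x \<in> topspace (gspace (X (k + 0))) \<and> (0 = 0 \<longrightarrow> x = w)" using w by simp
    fix x n assume "x \<in> topspace (gspace (X (k + n))) \<and> (n = 0 \<longrightarrow> x = w)"
    then have "x \<in> f (Suc (k + n)) ` topspace (gspace (X (Suc (k + n))))"
      using graph_cover.onto[OF bond] by blast
    then show "\<exists>y. (y \<in> topspace (gspace (X (k + Suc n))) \<and> (Suc n = 0 \<longrightarrow> y = w)) \<and>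
        f (Suc (k + n)) y = x" by auto
  qed
  then obtain y where y: "\<And>n. y n \<in> topspace (gspace (X (k + n)))" "y 0 = w"
    "\<And>n. f (Suc (k + n)) (y (Suc n)) = y n" by auto
  define x where "x m = (if k \<le> m then y (m - k) else bonding f m k w)" for m
  have "x \<in> topspace Y"
    unfolding topspace_Y
  proof (intro conjI allI)
    fix m
    show "x m \<in> topspace (gspace (X m))"
    proof (cases "k \<le> m")
      case True
      then show ?thesis using y(1)[of "m - k"] by (simp add: x_def)
    next
      case False
      then show ?thesis using graph_cover.onto[OF cover, of m k] w by (auto simp: x_def)
    qed
    show "f (Suc m) (x (Suc m)) = x m"
    proof (cases "k \<le> m")
      case True
      then show ?thesis using y(3)[of "m - k"] by (simp add: x_def Suc_diff_le)
    next
      case False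
      have "x (Suc m) = bonding f (Suc m) k w"
        using False y(2) by (cases "Suc m = k") (auto simp: x_def)
      then show ?thesis using False bonding_step[of m k] by (simp add: x_def)
    qed
  qed
  moreover have "x k = w" using y(2) by (simp add: x_def)
  ultimately show ?thesis using that by blast
qed

text \<open>The pairs that agree at level \<open>n\<close> but whose values are at least \<epsilon>
  apart form a decreasing sequence of closed sets in the compact square. A pair in all of them would
  have equal entries, so one of the sets is empty.\<close>

lemma eventually_factors:
  fixes r :: "(nat \<Rightarrow> 'v) \<Rightarrow> 'b::real_normed_vector"
  assumes r: "continuous_map Y euclidean r" and \<epsilon>: "\<epsilon> > 0"
  obtains n where "\<And>m x y. n \<le> m \<Longrightarrow> x \<in> topspace Y \<Longrightarrow> y \<in> topspace Y \<Longrightarrow> x m = y m \<Longrightarrow> norm (r x - r y) < \<epsilon>"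
proof -
  let ?P = "prod_topology Y Y"
  define C where "C n = {p \<in> topspace ?P. fst p n = snd p n} \<inter> {p \<in> topspace ?P. norm (r (fst p) - r (snd p)) \<in> {\<epsilon>..}}" for n
  have "closedin ?P (C n)" for n
  proof -
    have 1: "continuous_map ?P (gspace (X n)) (\<lambda>p. fst p n)" "continuous_map ?P (gspace (X n)) (\<lambda>p. snd p n)"
      using continuous_map_compose[OF continuous_map_fst continuous_map_proj]
        continuous_map_compose[OF continuous_map_snd continuous_map_proj] by (auto simp: o_def)
    have 2: "continuous_map ?P euclidean (\<lambda>p. r (fst p))" "continuous_map ?P euclidean (\<lambda>p. r (snd p))"
      using continuous_map_compose[OF continuous_map_fst r] continuous_map_compose[OF continuous_map_snd r]
      by (auto simp: o_def)
    have "continuous_map ?P euclideanreal (\<lambda>p. norm (r (fst p) - r (snd p)))"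
      by (intro continuous_map_norm continuous_map_diff 2)
    then have "closedin ?P {p \<in> topspace ?P. norm (r (fst p) - r (snd p)) \<in> {\<epsilon>..}}"
      by (rule closedin_continuous_map_preimage) simp
    then show ?thesis unfolding C_def
      using closedin_continuous_maps_eq[OF X.Hausdorff 1] by (rule closedin_Int[rotated])
  qed
  moreover have "C m \<subseteq> C n" if "n \<le> m" for m n
    unfolding C_def using proj_eq_le[of _ _ m n] that by auto
  then have "decseq C" by (simp add: decseq_def)
  moreover have "compact_space ?P" using compact by (simp add: compact_space_prod_topology)
  moreover have "(\<Inter>n. C n) = {}"
  proof -
    have False if "p \<in> (\<Inter>n. C n)" for p
    proof -
      have "fst p = snd p" using that by (auto simp: C_def)
      moreover have "norm (r (fst p) - r (snd p)) \<ge> \<epsilon>" using that by (auto simp: C_def)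
      ultimately show False using \<epsilon> by simp
    qed
    then show ?thesis by blast
  qed
  ultimately obtain n where n: "C n = {}" using compact_space_imp_nest[of ?P C] by blast
  show ?thesis
  proof (rule that[of n])
    fix m x y assume *: "n \<le> m" "x \<in> topspace Y" "y \<in> topspace Y" "x m = y m"
    then have "x n = y n" using proj_eq_le by blast
    then show "norm (r x - r y) < \<epsilon>"
      using n *(2,3) unfolding C_def by (force simp: not_le)
  qed
qed

text \<open>The points of \<open>S\<close> that agree with \<open>y\<close> at level
  \<open>n\<close> form a decreasing sequence of nonempty closed sets; by compactness they have a
  common point, which must be \<open>y\<close>.\<close>

lemma closed_approximable:
  assumes S: "closedin Y S" and y: "y \<in> topspace Y" and app: "\<And>n. \<exists>s\<in>S. s n = y n"
  shows "y \<in> S"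
proof -
  have sub: "S \<subseteq> topspace Y" using S closedin_subset by blast
  define C where "C n = S \<inter> {x \<in> topspace Y. x n \<in> {y n}}" for n
  have "closedin Y (C n)" for n
  proof -
    have "closedin (gspace (X n)) {y n}"
      using y X.Hausdorff topspace_Y by (auto intro!: closedin_Hausdorff_sing_eq[THEN iffD2])
    then show ?thesis unfolding C_def
      using S closedin_continuous_map_preimage[OF continuous_map_proj] by blast
  qed
  moreover have "C n \<noteq> {}" for n using app[of n] sub by (auto simp: C_def)
  moreover have "C m \<subseteq> C n" if "n \<le> m" for m n
  proof
    fix x assume x: "x \<in> C m"
    then have "x n = y n" using proj_eq_le[OF _ y _ that] by (simp add: C_def)
    with x show "x \<in> C n" by (simp add: C_def)
  qed
  then have "decseq C" by (simp add: decseq_def)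
  ultimately obtain x where "x \<in> (\<Inter>n. C n)" using compact_space_imp_nest[OF compact, of C] by blast
  then have "x \<in> S" "x = y" by (auto simp: C_def)
  then show ?thesis by simp
qed

text \<open>The parametrization is fixed at level \<open>n\<close>, so a lift covers the whole edge.
  From \<open>n\<close> on, each coordinate stays in a single edge, because the bonding maps send
  vertices to vertices; below \<open>n\<close> it is determined by \<open>e\<close> and may run over
  many edges.\<close>

definition lifted :: "nat \<Rightarrow> 'e \<Rightarrow> (real \<Rightarrow> nat \<Rightarrow> 'v) \<Rightarrow> bool" where
  "lifted n e \<gamma> \<longleftrightarrow> e \<in> gedges (X n) \<and> (\<forall>t\<in>{0..1}. \<gamma> t \<in> topspace Y \<and> \<gamma> t n = gparam (X n) e t) \<and>
     (\<forall>m\<ge>n. \<exists>d \<psi>. edge_segment (X m) d \<psi> (\<lambda>t. \<gamma> t m))"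

lemma liftedD:
  assumes "lifted n e \<gamma>"
  shows "e \<in> gedges (X n)" "\<And>t. t \<in> {0..1} \<Longrightarrow> \<gamma> t \<in> topspace Y"
    "\<And>t. t \<in> {0..1} \<Longrightarrow> \<gamma> t n = gparam (X n) e t"
    "\<And>m. n \<le> m \<Longrightarrow> \<exists>d \<psi>. edge_segment (X m) d \<psi> (\<lambda>t. \<gamma> t m)"
  using assms by (auto simp: lifted_def)

lemma lifted_below:
  assumes "lifted n e \<gamma>" "t \<in> {0..1}" "m \<le> n"
  shows "\<gamma> t m = bonding f m n (gparam (X n) e t)"
  using liftedD(2,3)[OF assms(1,2)] bonding_proj[of "\<gamma> t" m n] assms(3) by simp

lemma lifted_continuous:
  assumes l: "lifted n e \<gamma>"
  shows "continuous_map (top_of_set {0..1}) Y \<gamma>"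
proof (rule continuous_map_Y)
  show "continuous_map (top_of_set {0..1}) (gspace (X m)) (\<lambda>t. \<gamma> t m)" for m
  proof (cases "n \<le> m")
    case True
    then show ?thesis using liftedD(4)[OF l] X.edge_segment_continuous by blast
  next
    case False
    then have "m \<le> n" by simp
    have "continuous_map (top_of_set {0..1}) (gspace (X m)) (bonding f m n \<circ> gparam (X n) e)"
      using X.pathin_edge[OF liftedD(1)[OF l]] graph_cover.continuous[OF cover[OF \<open>m \<le> n\<close>]]
        continuous_map_compose unfolding pathin_def by blast
    then show ?thesis
      by (rule continuous_map_eq) (simp add: lifted_below[OF l _ \<open>m \<le> n\<close>])
  qed
qed (use liftedD(2)[OF l] in simp)

text \<open>Segments through the coordinates of \<open>z\<close> are chosen independently at all
  levels from \<open>n\<close> on. They are compatible by uniqueness: the image of the segment at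
  level \<open>Suc m\<close> and the segment at level \<open>m\<close> lie over the same edge and
  meet at the inner parameter \<open>t\<close>.\<close>

lemma lifted_exists:
  assumes z: "z \<in> topspace Y" and e: "e \<in> gedges (X n)" and t: "t \<in> {0<..<1}"
    and zn: "z n = gparam (X n) e t"
  obtains \<gamma> where "lifted n e \<gamma>" "\<gamma> t = z"
proof -
  have "\<exists>d \<psi>. edge_segment (X m) d \<psi> (gparam (X m) d \<circ> \<psi>) \<and>
      (\<forall>s\<in>{0..1}. bonding f n m (gparam (X m) d (\<psi> s)) = gparam (X n) e s) \<and> z m = gparam (X m) d (\<psi> t)"
    if m: "n \<le> m" for m
  proof -
    have "z m \<in> topspace (gspace (X m))" using z topspace_Y by blast
    moreover have "bonding f n m (z m) = gparam (X n) e t" using bonding_proj[OF z m] zn by simp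
    ultimately obtain d \<psi> where "d \<in> gedges (X m)" "strict_mono_on {0..1} \<psi>" "continuous_on {0..1} \<psi>"
      "\<psi> ` {0..1} \<subseteq> {0..1}" "\<And>s. s \<in> {0..1} \<Longrightarrow> bonding f n m (gparam (X m) d (\<psi> s)) = gparam (X n) e s"
      "z m = gparam (X m) d (\<psi> t)"
      using graph_cover.segment_lift[OF cover[OF m] _ e t, of "z m"] by blast
    then show ?thesis by (intro exI[of _ d] exI[of _ \<psi>]) (simp add: edge_segment_def)
  qed
  then obtain d \<psi> where d: "\<And>m. n \<le> m \<Longrightarrow> edge_segment (X m) (d m) (\<psi> m) (gparam (X m) (d m) \<circ> \<psi> m)"
    and db: "\<And>m s. n \<le> m \<Longrightarrow> s \<in> {0..1} \<Longrightarrow> bonding f n m (gparam (X m) (d m) (\<psi> m s)) = gparam (X n) e s"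
    and dz: "\<And>m. n \<le> m \<Longrightarrow> z m = gparam (X m) (d m) (\<psi> m t)"
    by metis
  define \<gamma> where "\<gamma> s m = (if n \<le> m then gparam (X m) (d m) (\<psi> m s) else bonding f m n (gparam (X n) e s))" for s m
  have \<gamma>n: "\<gamma> s n = gparam (X n) e s" if "s \<in> {0..1}" for s
    using db[of n s] that by (simp add: \<gamma>_def)
  have seg: "edge_segment (X m) (d m) (\<psi> m) (\<lambda>s. \<gamma> s m)" if "n \<le> m" for m
    using d[OF that] that by (simp add: \<gamma>_def edge_segment_def)
  have step: "f (Suc m) (\<gamma> s (Suc m)) = \<gamma> s m" if s: "s \<in> {0..1}" for m s
  proof (cases "n \<le> m")
    case True
    then have m': "n \<le> Suc m" by simp
    have "continuous_map (top_of_set {0..1}) (gspace (X m)) (\<lambda>s. f (Suc m) (\<gamma> s (Suc m)))"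
      using continuous_map_compose[OF X.edge_segment_continuous[OF seg[OF m']] graph_cover.continuous[OF bond]]
      by (simp add: o_def)
    moreover have "bonding f n m (f (Suc m) (\<gamma> s (Suc m))) = gparam (X n) e s" if "s \<in> {0..1}" for s
      using db[OF m' that] True by (simp add: \<gamma>_def)
    moreover have "bonding f n m (\<gamma> s m) = gparam (X n) e s" if "s \<in> {0..1}" for s
      using db[OF True that] True by (simp add: \<gamma>_def)
    moreover have "f (Suc m) (z (Suc m)) = z m" using z topspace_Y by blast
    then have "f (Suc m) (\<gamma> t (Suc m)) = \<gamma> t m"
      using True by (simp add: \<gamma>_def dz[OF m', symmetric] dz[OF True, symmetric])
    ultimately show ?thesis
      using graph_cover.segment_unique_closed[OF cover[OF True], of "\<lambda>s. f (Suc m) (\<gamma> s (Suc m))"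
          e "d m" "\<psi> m" "\<lambda>s. \<gamma> s m" t s] e seg[OF True] t s by blast
  next
    case False
    have "\<gamma> s (Suc m) = bonding f (Suc m) n (gparam (X n) e s)"
    proof (cases "Suc m = n")
      case True
      then show ?thesis using \<gamma>n[OF s] by simp
    next
      case F: False
      then show ?thesis using False by (simp add: \<gamma>_def)
    qed
    then show ?thesis using False bonding_step[of m n] by (simp add: \<gamma>_def)
  qed
  have in_X: "\<gamma> s m \<in> topspace (gspace (X m))" if s: "s \<in> {0..1}" for s m
  proof (cases "n \<le> m")
    case True
    then have "\<psi> m s \<in> {0..1}" using edge_segmentD(4)[OF d[OF True]] s by blast
    then show ?thesis using True X.edge_topspace[OF edge_segmentD(1)[OF d[OF True]]] by (simp add: \<gamma>_def)
  next
    case False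
    then show ?thesis using graph_cover.onto[OF cover, of m n] X.edge_topspace[OF e s] by (auto simp: \<gamma>_def)
  qed
  have \<gamma>Y: "\<gamma> s \<in> topspace Y" if s: "s \<in> {0..1}" for s
    unfolding topspace_Y using step[OF s] in_X[OF s] by simp
  have "\<gamma> t m = z m" for m
  proof (cases "n \<le> m")
    case True
    then show ?thesis using dz[OF True] by (simp add: \<gamma>_def)
  next
    case False
    then show ?thesis using bonding_proj[OF z, of m n] zn by (simp add: \<gamma>_def)
  qed
  then have "\<gamma> t = z" by blast
  moreover have "lifted n e \<gamma>" unfolding lifted_def using e \<gamma>Y \<gamma>n seg by blast
  ultimately show ?thesis using that by blast
qed

lemma lifted_path_unique_at:
  assumes l: "lifted n e \<gamma>" and T: "connected_space T" and \<delta>: "continuous_map T Y \<delta>"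
    and \<alpha>: "\<And>s. s \<in> topspace T \<Longrightarrow> \<alpha> s \<in> {0<..<1} \<and> \<delta> s n = gparam (X n) e (\<alpha> s)"
    and s0: "s0 \<in> topspace T" "\<delta> s0 m = \<gamma> (\<alpha> s0) m" and m: "n \<le> m" and s: "s \<in> topspace T"
  shows "\<delta> s m = \<gamma> (\<alpha> s) m"
proof -
  obtain d \<psi> where d: "edge_segment (X m) d \<psi> (\<lambda>t. \<gamma> t m)" using liftedD(4)[OF l m] by blast
  note D = edge_segmentD[OF d]
  have \<delta>Y: "\<delta> s \<in> topspace Y" if "s \<in> topspace T" for s
    using \<delta> that by (auto simp: continuous_map_def)
  have "continuous_map T (gspace (X m)) (\<lambda>s. \<delta> s m)"
    using continuous_map_compose[OF \<delta> continuous_map_proj] by (simp add: o_def)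
  moreover have "\<alpha> s \<in> {0<..<1} \<and> bonding f n m (\<delta> s m) = gparam (X n) e (\<alpha> s)" if "s \<in> topspace T" for s
    using \<alpha>[OF that] bonding_proj[OF \<delta>Y[OF that] m] by simp
  moreover have "bonding f n m (gparam (X m) d (\<psi> s)) = gparam (X n) e s" if "s \<in> {0..1}" for s
    using D(5)[OF that] bonding_proj[OF liftedD(2)[OF l that] m] liftedD(3)[OF l that] by simp
  moreover have "\<delta> s0 m = gparam (X m) d (\<psi> (\<alpha> s0))" using s0 \<alpha>[OF s0(1)] D(5)[of "\<alpha> s0"] by simp
  ultimately have "\<delta> s m = gparam (X m) d (\<psi> (\<alpha> s))"
    using graph_cover.segment_unique[OF cover[OF m] T, of "\<lambda>s. \<delta> s m" e \<alpha> d \<psi> s0 s]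
      D(1-4) liftedD(1)[OF l] s0(1) s by blast
  then show ?thesis using D(5)[of "\<alpha> s"] \<alpha>[OF s] by simp
qed

text \<open>A curve that stays over an open edge cannot leave the lift on which it lies at one
  parameter. The position \<alpha> is not assumed to be monotone; this will be applied to the
  preimage of a curve in the other limit.\<close>

lemma lifted_path_unique:
  assumes l: "lifted n e \<gamma>" and T: "connected_space T" and \<delta>: "continuous_map T Y \<delta>"
    and \<alpha>: "\<And>s. s \<in> topspace T \<Longrightarrow> \<alpha> s \<in> {0<..<1} \<and> \<delta> s n = gparam (X n) e (\<alpha> s)"
    and s0: "s0 \<in> topspace T" "\<delta> s0 = \<gamma> (\<alpha> s0)" and s: "s \<in> topspace T"
  shows "\<delta> s = \<gamma> (\<alpha> s)"
proof
  fix m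
  show "\<delta> s m = \<gamma> (\<alpha> s) m"
  proof (cases "n \<le> m")
    case True
    show ?thesis by (rule lifted_path_unique_at[OF l T \<delta> \<alpha> s0(1) fun_cong[OF s0(2)] True s])
  next
    case False
    have "\<delta> s \<in> topspace Y" using \<delta> s by (auto simp: continuous_map_def)
    then show ?thesis
      using lifted_below[OF l, of "\<alpha> s" m] \<alpha>[OF s] False bonding_proj[of "\<delta> s" m n] by simp
  qed
qed

text \<open>The version for a single coordinate: agreement is assumed and obtained at level
  \<open>m\<close> alone. Thus the \<open>m\<close>-th coordinate of a lift depends on the
  \<open>m\<close>-th coordinate of one of its inner points only.\<close>

lemma lifted_determined_at:
  assumes l: "lifted n e \<gamma>" and \<delta>: "continuous_map (top_of_set {0..1}) Y \<delta>"
    "\<And>s. s \<in> {0..1} \<Longrightarrow> \<delta> s n = gparam (X n) e s"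
    and t0: "t0 \<in> {0<..<1}" "\<delta> t0 m = \<gamma> t0 m" and m: "n \<le> m" and t: "t \<in> {0..1}"
  shows "\<delta> t m = \<gamma> t m"
proof (rule continuous_maps_agree_on_closed_interval[OF X.Hausdorff _ _ _ t])
  show "continuous_map (top_of_set {0..1}) (gspace (X m)) (\<lambda>t. \<delta> t m)"
    "continuous_map (top_of_set {0..1}) (gspace (X m)) (\<lambda>t. \<gamma> t m)"
    using continuous_map_compose[OF \<delta>(1) continuous_map_proj]
      continuous_map_compose[OF lifted_continuous[OF l] continuous_map_proj] by (auto simp: o_def)
  show "\<delta> s m = \<gamma> s m" if s: "s \<in> {0<..<1}" for s
  proof -
    have "connected_space (top_of_set {0<..<1::real})" by (simp add: connected_space_subtopology)
    moreover have "continuous_map (top_of_set {0<..<1}) Y \<delta>"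
      using \<delta>(1) by (rule continuous_map_from_subtopology_mono) auto
    ultimately show ?thesis
      using lifted_path_unique_at[OF l, of "top_of_set {0<..<1}" \<delta> "\<lambda>s. s" t0 m s] \<delta>(2) t0 m s by simp
  qed
qed

lemma lifted_determined:
  assumes l: "lifted n e \<gamma>" and \<delta>: "continuous_map (top_of_set {0..1}) Y \<delta>"
    "\<And>s. s \<in> {0..1} \<Longrightarrow> \<delta> s n = gparam (X n) e s"
    and t0: "t0 \<in> {0<..<1}" "\<delta> t0 = \<gamma> t0" and t: "t \<in> {0..1}"
  shows "\<delta> t = \<gamma> t"
proof
  fix m
  show "\<delta> t m = \<gamma> t m"
  proof (cases "n \<le> m")
    case True
    show ?thesis by (rule lifted_determined_at[OF l \<delta> t0(1) fun_cong[OF t0(2)] True t])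
  next
    case False
    have "\<delta> t \<in> topspace Y" using \<delta>(1) t by (auto simp: continuous_map_def)
    then show ?thesis
      using lifted_below[OF l t, of m] \<delta>(2)[OF t] False bonding_proj[of "\<delta> t" m n] by simp
  qed
qed

text \<open>A lift of a deep edge contains, as a monotone piece, a lift of every edge that its image
  runs over. Orientations and lower bounds are carried between levels in this way.\<close>

lemma lifted_restrict:
  assumes l: "lifted N e \<gamma>" and n: "n \<le> N" and e': "e' \<in> set (edge_path (X n) (bonding f n N \<circ> gparam (X N) e))"
  obtains \<gamma>' \<psi> where "lifted n e' \<gamma>'" "continuous_on {0..1} \<psi>" "strict_mono_on {0..1} \<psi>" "\<psi> ` {0..1} \<subseteq> {0..1}"
    "\<And>t. t \<in> {0..1} \<Longrightarrow> \<gamma>' t = \<gamma> (\<psi> t)"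
proof -
  note e = liftedD(1)[OF l]
  obtain \<tau> \<phi> where trav: "traversal (X n) (bonding f n N \<circ> gparam (X N) e)
      (edge_path (X n) (bonding f n N \<circ> gparam (X N) e)) \<tau> \<phi>"
    (is "traversal _ _ ?es _ _")
    using graph_cover.traverses_edge[OF cover[OF n] e] traverses_traversal by metis
  obtain i where i: "i < length ?es" "?es ! i = e'" using e' by (metis in_set_conv_nth)
  obtain \<psi> where \<psi>: "edge_segment (X N) e \<psi> (gparam (X N) e \<circ> \<psi>)"
    "\<And>s. s \<in> {0..1} \<Longrightarrow> bonding f n N (gparam (X N) e (\<psi> s)) = gparam (X n) e' s"
    using graph_cover.traversal_segment[OF cover[OF n] e trav i(1)] i(2) by metis
  note P = edge_segmentD[OF \<psi>(1)]
  have \<psi>01: "\<psi> s \<in> {0..1}" if "s \<in> {0..1}" for s using P(4) that by blast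
  have "continuous_map (top_of_set {0..1}) (top_of_set {0..1}) \<psi>"
    using P(3,4) by (simp add: continuous_map_in_subtopology image_subset_iff_funcset)
  then have cont: "continuous_map (top_of_set {0..1}) Y (\<gamma> \<circ> \<psi>)"
    using lifted_continuous[OF l] continuous_map_compose by blast
  have at_n: "(\<gamma> \<circ> \<psi>) s n = gparam (X n) e' s" if s: "s \<in> {0..1}" for s
    using lifted_below[OF l \<psi>01[OF s] n] \<psi>(2)[OF s] by simp
  have e'n: "e' \<in> gedges (X n)" using traversal_step(1)[OF trav i(1)] i(2) by simp
  obtain \<gamma>' where \<gamma>': "lifted n e' \<gamma>'" "\<gamma>' (1/2) = (\<gamma> \<circ> \<psi>) (1/2)"
    using lifted_exists[OF _ e'n, of "(\<gamma> \<circ> \<psi>) (1/2)" "1/2"] at_n[of "1/2"] liftedD(2)[OF l \<psi>01, of "1/2"] by auto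
  have "(\<gamma> \<circ> \<psi>) t = \<gamma>' t" if "t \<in> {0..1}" for t
    by (rule lifted_determined[OF \<gamma>'(1) cont at_n _ _ that, of "1/2"]) (use \<gamma>'(2) in auto)
  then show ?thesis using that[OF \<gamma>'(1) P(3,2,4)] by simp
qed

text \<open>Parametrizes the lifts of \<open>e\<close> by their points over the middle of the edge.
  Its compactness is the source of the uniform bounds on increments.\<close>

definition mid_fibre :: "nat \<Rightarrow> 'e \<Rightarrow> (nat \<Rightarrow> 'v) set" where
  "mid_fibre n e = {z \<in> topspace Y. z n = gparam (X n) e (1/2)}"

definition lift_at :: "nat \<Rightarrow> 'e \<Rightarrow> (nat \<Rightarrow> 'v) \<Rightarrow> real \<Rightarrow> nat \<Rightarrow> 'v" where
  "lift_at n e z = (SOME \<gamma>. lifted n e \<gamma> \<and> \<gamma> (1/2) = z)"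

lemma lift_at:
  assumes "e \<in> gedges (X n)" "z \<in> mid_fibre n e"
  shows "lifted n e (lift_at n e z)" "lift_at n e z (1/2) = z"
proof -
  have "\<exists>\<gamma>. lifted n e \<gamma> \<and> \<gamma> (1/2) = z"
    using lifted_exists[of z e n "1/2"] assms by (auto simp: mid_fibre_def)
  then have "lifted n e (lift_at n e z) \<and> lift_at n e z (1/2) = z"
    unfolding lift_at_def by (rule someI_ex)
  then show "lifted n e (lift_at n e z)" "lift_at n e z (1/2) = z" by auto
qed

lemma lifted_eq_lift_at:
  assumes l: "lifted n e \<gamma>"
  shows "\<gamma> (1/2) \<in> mid_fibre n e" "\<And>t. t \<in> {0..1} \<Longrightarrow> \<gamma> t = lift_at n e (\<gamma> (1/2)) t"
proof -
  show m: "\<gamma> (1/2) \<in> mid_fibre n e" using liftedD(2,3)[OF l, of "1/2"] by (simp add: mid_fibre_def)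
  show "\<gamma> t = lift_at n e (\<gamma> (1/2)) t" if "t \<in> {0..1}" for t
    using lifted_determined[OF lift_at(1)[OF liftedD(1)[OF l] m] lifted_continuous[OF l] liftedD(3)[OF l], of "1/2" t]
      lift_at(2)[OF liftedD(1)[OF l] m] that by simp
qed

lemma mid_fibre_closed:
  assumes "e \<in> gedges (X n)"
  shows "closedin Y (mid_fibre n e)" "compactin Y (mid_fibre n e)"
proof -
  have "gparam (X n) e (1/2) \<in> topspace (gspace (X n))" using X.edge_topspace[OF assms] by simp
  then have "closedin (gspace (X n)) {gparam (X n) e (1/2)}"
    using X.Hausdorff by (simp add: closedin_Hausdorff_sing_eq)
  from closedin_continuous_map_preimage[OF continuous_map_proj this]
  show *: "closedin Y (mid_fibre n e)" by (simp add: mid_fibre_def)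
  show "compactin Y (mid_fibre n e)" by (rule closedin_compact_space[OF compact *])
qed

text \<open>
  The \<open>m\<close>-th coordinate of the lifted edge through \<open>z\<close> depends only on \<open>z m\<close>, which takes
  finitely many values on the fibre.
\<close>
lemma continuous_map_lift_at:
  assumes e: "e \<in> gedges (X n)" and u: "u \<in> {0..1}"
  shows "continuous_map (subtopology Y (mid_fibre n e)) Y (\<lambda>z. lift_at n e z u)"
proof (rule continuous_map_Y)
  let ?T = "subtopology Y (mid_fibre n e)"
  have top: "topspace ?T = mid_fibre n e" by (auto simp: mid_fibre_def)
  have inX: "lift_at n e z u m \<in> topspace (gspace (X m))" if "z \<in> mid_fibre n e" for z m
    using liftedD(2)[OF lift_at(1)[OF e that] u] topspace_Y by blast
  show "lift_at n e z u \<in> topspace Y" if "z \<in> topspace ?T" for z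
    using liftedD(2)[OF lift_at(1)[OF e] u] that top by blast
  fix m
  show "continuous_map ?T (gspace (X m)) (\<lambda>z. lift_at n e z u m)"
  proof (cases "n \<le> m")
    case False
    have eq: "bonding f m n (gparam (X n) e u) = lift_at n e z u m" if "z \<in> topspace ?T" for z
      using lifted_below[OF lift_at(1)[OF e] u, of z m] that top False by simp
    have "bonding f m n (gparam (X n) e u) \<in> topspace (gspace (X m))"
      using graph_cover.onto[OF cover, of m n] X.edge_topspace[OF e u] False by auto
    then have "continuous_map ?T (gspace (X m)) (\<lambda>_. bonding f m n (gparam (X n) e u))" by simp
    then show ?thesis using eq by (rule continuous_map_eq)
  next
    case True
    have dep: "lift_at n e z u m = lift_at n e z' u m"
      if z: "z \<in> mid_fibre n e" "z' \<in> mid_fibre n e" "z m = z' m" for z z'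
    proof -
      have "lift_at n e z (1/2) m = lift_at n e z' (1/2) m"
        unfolding lift_at(2)[OF e z(1)] lift_at(2)[OF e z(2)] by (rule z(3))
      moreover have "1/2 \<in> {0<..<1::real}" by simp
      ultimately show ?thesis
        using lifted_determined_at[OF lift_at(1)[OF e z(2)] lifted_continuous[OF lift_at(1)[OF e z(1)]]
          liftedD(3)[OF lift_at(1)[OF e z(1)]] _ _ True u] by blast
    qed
    define Fib where "Fib = {w \<in> topspace (gspace (X m)). bonding f n m w = gparam (X n) e (1/2)}"
    have fin: "finite Fib"
      unfolding Fib_def using graph_cover.fibre_finite[OF cover[OF True] e] by simp
    have zF: "z m \<in> Fib" if "z \<in> mid_fibre n e" for z
      using that bonding_proj[of z n m] True topspace_Y by (auto simp: mid_fibre_def Fib_def)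
    show ?thesis
      unfolding continuous_map_closedin top
    proof (intro conjI allI impI funcsetI)
      show "lift_at n e z u m \<in> topspace (gspace (X m))" if "z \<in> mid_fibre n e" for z
        using inX[OF that] .
      fix C assume "closedin (gspace (X m)) C"
      \<comment> \<open>By \<open>dep\<close>, the condition on \<open>z\<close> depends only on
        \<open>z m\<close>, so the preimage of \<open>C\<close> is described by this finite, hence
        closed, set.\<close>
      define B where "B = {w \<in> Fib. \<exists>z\<in>mid_fibre n e. z m = w \<and> lift_at n e z u m \<in> C}"
      have "B \<subseteq> Fib" unfolding B_def by blast
      moreover have "Fib \<subseteq> topspace (gspace (X m))" unfolding Fib_def by blast
      ultimately have "finite B" "B \<subseteq> topspace (gspace (X m))" using fin finite_subset by auto
      then have "closedin (gspace (X m)) B"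
        using X.Hausdorff closedin_Hausdorff_finite by blast
      then have "closedin ?T {z \<in> topspace ?T. z m \<in> B}"
        using closedin_continuous_map_preimage[OF continuous_map_from_subtopology[OF continuous_map_proj]] by blast
      moreover have "{z \<in> topspace ?T. z m \<in> B} = {z \<in> mid_fibre n e. lift_at n e z u m \<in> C}"
        unfolding top
      proof (intro Collect_cong conj_cong refl iffI)
        fix z assume z: "z \<in> mid_fibre n e"
        show "lift_at n e z u m \<in> C" if zB: "z m \<in> B"
        proof -
          obtain z' where "z' \<in> mid_fibre n e" "z' m = z m" "lift_at n e z' u m \<in> C"
            using zB unfolding B_def by blast
          then show ?thesis using dep[OF z, of z'] by simp
        qed
        show "z m \<in> B" if "lift_at n e z u m \<in> C"
          unfolding B_def using zF[OF z] z that by blast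
      qed
      ultimately show "closedin ?T {z \<in> mid_fibre n e. lift_at n e z u m \<in> C}" by simp
    qed
  qed
qed

text \<open>Segments ending at the coordinates of \<open>y\<close> exist at every level, but
  independent choices need not be compatible, since lifts branch at the ends. Instead, the set
  \<open>S\<close> of the ends of all lifts is compact and contains, for every \<open>n\<close>, a
  point with the same \<open>n\<close>-th coordinate as \<open>y\<close>.\<close>

lemma lifted_to_vertex:
  assumes y: "y \<in> topspace Y" "y 0 \<in> gverts (X 0)" and u: "u = 0 \<or> u = 1"
  obtains e \<gamma> where "lifted 0 e \<gamma>" "\<gamma> u = y"
proof -
  have u01: "u \<in> {0..1}" using u by auto
  define S where "S = (\<Union>e\<in>gedges (X 0). (\<lambda>z. lift_at 0 e z u) ` mid_fibre 0 e)"
  have "closedin Y S"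
    unfolding S_def
  proof (rule closedin_Union)
    show "finite ((\<lambda>e. (\<lambda>z. lift_at 0 e z u) ` mid_fibre 0 e) ` gedges (X 0))"
      using X.finite_edges by blast
    fix K assume "K \<in> (\<lambda>e. (\<lambda>z. lift_at 0 e z u) ` mid_fibre 0 e) ` gedges (X 0)"
    then obtain e where e: "e \<in> gedges (X 0)" and K: "K = (\<lambda>z. lift_at 0 e z u) ` mid_fibre 0 e" by blast
    have "compactin (subtopology Y (mid_fibre 0 e)) (mid_fibre 0 e)"
      using mid_fibre_closed(2)[OF e] by (simp add: compactin_subtopology)
    then have "compactin Y K"
      unfolding K using image_compactin continuous_map_lift_at[OF e u01] by blast
    then show "closedin Y K" using compactin_imp_closedin Hausdorff_Y by blast
  qed
  moreover have "\<exists>s\<in>S. s n = y n" for n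
  proof -
    have yn: "y n \<in> topspace (gspace (X n))" "bonding f 0 n (y n) \<in> gverts (X 0)"
      using y topspace_Y bonding_proj[OF y(1), of 0 n] by auto
    obtain e d \<psi> where e: "e \<in> gedges (X 0)" and d: "edge_segment (X n) d \<psi> (gparam (X n) d \<circ> \<psi>)"
      and b: "\<And>s. s \<in> {0..1} \<Longrightarrow> bonding f 0 n (gparam (X n) d (\<psi> s)) = gparam (X 0) e s"
      and w: "gparam (X n) d (\<psi> u) = y n"
      using graph_cover.segment_to_vertex[OF cover[of 0 n] yn u] by auto
    note D = edge_segmentD[OF d]
    have "\<psi> (1/2) \<in> {0..1}" using D(4) by (simp add: image_subset_iff)
    then have "gparam (X n) d (\<psi> (1/2)) \<in> topspace (gspace (X n))" using X.edge_topspace[OF D(1)] by blast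
    \<comment> \<open>Any point of the limit over the middle of the segment will do: its lift
      follows the segment at level \<open>n\<close> and so ends over \<open>y n\<close>.\<close>
    then obtain z where z: "z \<in> topspace Y" "z n = gparam (X n) d (\<psi> (1/2))" using proj_onto by blast
    then have zm: "z \<in> mid_fibre 0 e" using bonding_proj[OF z(1), of 0 n] b[of "1/2"] by (simp add: mid_fibre_def)
    note L = lift_at[OF e zm]
    have "continuous_map (top_of_set {0..1}) (gspace (X n)) (\<lambda>s. lift_at 0 e z s n)"
      using continuous_map_compose[OF lifted_continuous[OF L(1)] continuous_map_proj] by (simp add: o_def)
    moreover have "bonding f 0 n (lift_at 0 e z s n) = gparam (X 0) e s" if "s \<in> {0..1}" for s
      using bonding_proj[OF liftedD(2)[OF L(1) that], of 0 n] liftedD(3)[OF L(1) that] by simp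
    moreover have "lift_at 0 e z (1/2) n = (gparam (X n) d \<circ> \<psi>) (1/2)" using L(2) z by simp
    ultimately have "lift_at 0 e z u n = (gparam (X n) d \<circ> \<psi>) u"
      using graph_cover.segment_unique_closed[OF cover[of 0 n], of "\<lambda>s. lift_at 0 e z s n"
          e d \<psi> "gparam (X n) d \<circ> \<psi>" "1/2" u] e d b u01 by simp
    then have "lift_at 0 e z u n = y n" using w by simp
    then show ?thesis using e zm unfolding S_def by blast
  qed
  ultimately have "y \<in> S" using closed_approximable y(1) by blast
  then obtain e z where "e \<in> gedges (X 0)" "z \<in> mid_fibre 0 e" "y = lift_at 0 e z u"
    unfolding S_def by blast
  then show ?thesis using that lift_at(1) by blast
qed

end

section \<open>Circle-valued functions\<close>

text \<open>
  A function \<open>U\<close> with \<open>cis (2 * pi * U x)\<close> continuous represents a map to the circle; two of them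
  are homotopic iff they differ by a continuous real function modulo \<open>\<int>\<close>.
\<close>
definition circle_equiv :: "'a topology \<Rightarrow> ('a \<Rightarrow> real) \<Rightarrow> ('a \<Rightarrow> real) \<Rightarrow> bool" where
  "circle_equiv T U V \<longleftrightarrow>
     (\<exists>r. continuous_map T euclideanreal r \<and> (\<forall>x\<in>topspace T. U x - V x - r x \<in> \<int>))"

lemma circle_equiv_refl: "circle_equiv T U U"
  unfolding circle_equiv_def by (intro exI[of _ "\<lambda>_. 0"]) simp

lemma circle_equiv_linear:
  assumes "circle_equiv T U V" "circle_equiv T U' V'"
  shows "circle_equiv T (\<lambda>x. of_int m * U x + of_int n * U' x) (\<lambda>x. of_int m * V x + of_int n * V' x)"
proof -
  obtain r r' where r: "continuous_map T euclideanreal r" "\<And>x. x \<in> topspace T \<Longrightarrow> U x - V x - r x \<in> \<int>"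
    "continuous_map T euclideanreal r'" "\<And>x. x \<in> topspace T \<Longrightarrow> U' x - V' x - r' x \<in> \<int>"
    using assms unfolding circle_equiv_def by blast
  have "continuous_map T euclideanreal (\<lambda>x. of_int m * r x + of_int n * r' x)"
    by (intro continuous_intros r)
  moreover have "of_int m * U x + of_int n * U' x - (of_int m * V x + of_int n * V' x)
      - (of_int m * r x + of_int n * r' x) \<in> \<int>" if "x \<in> topspace T" for x
  proof -
    have "of_int m * (U x - V x - r x) + of_int n * (U' x - V' x - r' x) \<in> \<int>"
      using r(2,4)[OF that] by (intro Ints_add Ints_mult Ints_of_int)
    then show ?thesis by (simp add: algebra_simps)
  qed
  ultimately show ?thesis unfolding circle_equiv_def by blast
qed

lemma circle_equiv_sym: "circle_equiv T U V \<Longrightarrow> circle_equiv T V U"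
  unfolding circle_equiv_def
proof (elim exE conjE)
  fix r assume r: "continuous_map T euclideanreal r" "\<forall>x\<in>topspace T. U x - V x - r x \<in> \<int>"
  have "V x - U x - - r x \<in> \<int>" if "x \<in> topspace T" for x
    using r(2) that Ints_minus[of "U x - V x - r x"] by (simp add: algebra_simps)
  moreover have "continuous_map T euclideanreal (\<lambda>x. - r x)" by (intro continuous_intros r)
  ultimately show "\<exists>r. continuous_map T euclideanreal r \<and> (\<forall>x\<in>topspace T. V x - U x - r x \<in> \<int>)"
    by blast
qed

lemma circle_equiv_trans:
  assumes "circle_equiv T U V" "circle_equiv T V W"
  shows "circle_equiv T U W"
  using circle_equiv_linear[OF circle_equiv_linear[OF assms, of 1 1] circle_equiv_refl[of T V], of 1 "-1"]
  by (simp add: algebra_simps)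

lemma circle_equiv_compose:
  assumes "circle_equiv T U V" "continuous_map S T h"
  shows "circle_equiv S (U \<circ> h) (V \<circ> h)"
proof -
  obtain r where r: "continuous_map T euclideanreal r" "\<And>x. x \<in> topspace T \<Longrightarrow> U x - V x - r x \<in> \<int>"
    using assms unfolding circle_equiv_def by blast
  have "h x \<in> topspace T" if "x \<in> topspace S" for x
    using assms(2) that by (auto simp: continuous_map_def)
  then show ?thesis
    unfolding circle_equiv_def using continuous_map_compose[OF assms(2) r(1)] r(2) by auto
qed

lemma circle_equiv_cong:
  assumes "circle_equiv T U V" "\<And>x. x \<in> topspace T \<Longrightarrow> U x = U' x" "\<And>x. x \<in> topspace T \<Longrightarrow> V x = V' x"
  shows "circle_equiv T U' V'"
  using assms unfolding circle_equiv_def by simp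

lemma cis_2pi_eqD:
  assumes "cis (2 * pi * x) = cis (2 * pi * y)"
  shows "x - y \<in> \<int>"
proof -
  have "cis (2 * pi * x - 2 * pi * y) = 1" using assms cis_divide[of "2 * pi * x" "2 * pi * y"] by simp
  then have "cos (2 * pi * (x - y)) = 1" by (simp add: cis.ctr complex_eq_iff algebra_simps)
  then obtain n :: int where "2 * pi * (x - y) = of_int n * 2 * pi" using cos_one_2pi_int by blast
  then have "x - y = of_int n" by simp
  then show ?thesis by simp
qed

text \<open>The quotient of two nearby points of the circle is near \<open>1\<close>, where
  \<open>Arg\<close> is continuous and vanishes.\<close>

lemma cis_close_imp_near_Ints:
  assumes "\<epsilon> > 0"
  obtains \<delta> where "\<delta> > 0"
    "\<And>x y. norm (cis (2 * pi * x) - cis (2 * pi * y)) < \<delta> \<Longrightarrow> \<exists>i::int. \<bar>x - y - of_int i\<bar> < \<epsilon>"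
proof -
  have "isCont Arg 1" by (rule continuous_at_Arg) (simp add: complex_nonpos_Reals_iff)
  moreover have "0 < 2 * pi * \<epsilon>" using assms by simp
  ultimately obtain \<delta> where "\<delta> > 0" "\<forall>z. dist z 1 < \<delta> \<longrightarrow> dist (Arg z) (Arg 1) < 2 * pi * \<epsilon>"
    unfolding continuous_at_eps_delta by blast
  then have \<delta>: "\<delta> > 0" "\<And>z. norm (z - 1) < \<delta> \<Longrightarrow> \<bar>Arg z\<bar> < 2 * pi * \<epsilon>"
    by (auto simp: dist_norm)
  show ?thesis
  proof (rule that[OF \<delta>(1)])
    fix x y assume a: "norm (cis (2 * pi * x) - cis (2 * pi * y)) < \<delta>"
    let ?z = "cis (2 * pi * (x - y))"
    have "cis (2 * pi * x) - cis (2 * pi * y) = cis (2 * pi * y) * (?z - 1)"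
      by (simp add: right_diff_distrib cis_mult algebra_simps)
    then have "norm (?z - 1) < \<delta>" using a by (simp add: norm_mult)
    then have arg: "\<bar>Arg ?z\<bar> < 2 * pi * \<epsilon>" by (rule \<delta>(2))
    have "cis (2 * pi * (Arg ?z / (2 * pi))) = ?z" by (simp add: cis_Arg)
    then have "x - y - Arg ?z / (2 * pi) \<in> \<int>" by (intro cis_2pi_eqD) simp
    then obtain i where "x - y - Arg ?z / (2 * pi) = of_int i" by (auto elim: Ints_cases)
    then have "x - y - of_int i = Arg ?z / (2 * pi)" by linarith
    then have "\<bar>x - y - of_int i\<bar> = \<bar>Arg ?z / (2 * pi)\<bar>" by (rule arg_cong)
    also have "\<dots> = \<bar>Arg ?z\<bar> / (2 * pi)" by (simp add: abs_divide)
    also have "\<dots> < \<epsilon>" using arg by (simp add: divide_less_eq mult.commute)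
    finally show "\<exists>i::int. \<bar>x - y - of_int i\<bar> < \<epsilon>" by blast
  qed
qed

text \<open>A continuous logarithm exists on the contractible interval; on the unit circle its real
  part is \<open>0\<close>.\<close>

lemma circle_path_lift:
  fixes U :: "real \<Rightarrow> real"
  assumes "continuous_on {0..1} (\<lambda>t. cis (2 * pi * U t))"
  obtains W where "continuous_on {0..1} W" "\<And>t. t \<in> {0..1} \<Longrightarrow> W t - U t \<in> \<int>"
proof -
  obtain g where g: "continuous_on {0..1} g" "\<And>t. t \<in> {0..1} \<Longrightarrow> cis (2 * pi * U t) = exp (g t)"
    using continuous_logarithm_on_contractible[OF assms] convex_imp_contractible[of "{0..1::real}"]
    by (metis cis_neq_zero convex_real_interval(5))
  show ?thesis
  proof (rule that[of "\<lambda>t. Im (g t) / (2 * pi)"])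
    show "continuous_on {0..1} (\<lambda>t. Im (g t) / (2 * pi))" by (intro continuous_intros g) simp
    fix t :: real assume t: "t \<in> {0..1}"
    have "exp (Re (g t)) = 1" using g(2)[OF t] by (metis norm_cis norm_exp_eq_Re)
    then have "Re (g t) = 0" by simp
    then have "exp (g t) = cis (Im (g t))" by (simp add: exp_eq_polar)
    then have "cis (2 * pi * (Im (g t) / (2 * pi))) = cis (2 * pi * U t)" using g(2)[OF t] by simp
    then show "Im (g t) / (2 * pi) - U t \<in> \<int>" by (rule cis_2pi_eqD)
  qed
qed

lemma continuous_map_cis:
  assumes "continuous_map T euclideanreal r"
  shows "continuous_map T euclidean (\<lambda>x. cis (2 * pi * r x))"
proof -
  have "continuous_map euclideanreal euclidean (\<lambda>t. cis (2 * pi * t))"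
    by (simp, intro continuous_intros)
  from continuous_map_compose[OF assms this] show ?thesis by (simp add: o_def)
qed

lemma continuous_map_mult:
  fixes u v :: "'a \<Rightarrow> complex"
  assumes "continuous_map T euclidean u" "continuous_map T euclidean v"
  shows "continuous_map T euclidean (\<lambda>x. u x * v x)"
  using assms by (auto simp: continuous_map_atin intro: tendsto_mult)

lemma circle_equiv_imp_continuous:
  assumes "circle_equiv T U V" "continuous_map T euclidean (\<lambda>x. cis (2 * pi * V x))"
  shows "continuous_map T euclidean (\<lambda>x. cis (2 * pi * U x))"
proof -
  obtain r where r: "continuous_map T euclideanreal r" "\<And>x. x \<in> topspace T \<Longrightarrow> U x - V x - r x \<in> \<int>"
    using assms unfolding circle_equiv_def by blast
  have "continuous_map T euclidean (\<lambda>x. cis (2 * pi * V x) * cis (2 * pi * r x))"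
    by (intro continuous_map_mult assms continuous_map_cis r)
  then show ?thesis
  proof (rule continuous_map_eq)
    fix x assume "x \<in> topspace T"
    then have "U x - (V x + r x) \<in> \<int>" using r(2) by (simp add: algebra_simps)
    then show "cis (2 * pi * V x) * cis (2 * pi * r x) = cis (2 * pi * U x)"
      using cis_2pi_cong by (simp add: cis_mult distrib_left)
  qed
qed

text \<open>Values within a quarter turn of \<open>1\<close> have positive real part and so avoid
  the branch cut of \<open>Arg\<close>, which then gives a continuous logarithm.\<close>

lemma circle_equiv_zeroI:
  assumes D: "continuous_map T euclidean (\<lambda>x. cis (2 * pi * D x))"
    and near: "\<And>x. x \<in> topspace T \<Longrightarrow> \<exists>i::int. \<bar>D x - of_int i\<bar> < 1/4"
  obtains r where "continuous_map T euclideanreal r" "\<And>x. x \<in> topspace T \<Longrightarrow> D x - r x \<in> \<int>"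
proof (rule that[of "\<lambda>x. Arg (cis (2 * pi * D x)) / (2 * pi)"])
  have "cis (2 * pi * D x) \<notin> \<real>\<^sub>\<le>\<^sub>0" if "x \<in> topspace T" for x
  proof -
    obtain i :: int where i: "\<bar>D x - of_int i\<bar> < 1/4" using near[OF \<open>x \<in> topspace T\<close>] by blast
    have "cis (2 * pi * D x) = cis (2 * pi * (D x - of_int i))" by (rule cis_2pi_cong) simp
    moreover have "0 < cos (2 * pi * (D x - of_int i))"
    proof (rule cos_gt_zero_pi)
      show "- (pi / 2) < 2 * pi * (D x - of_int i)" "2 * pi * (D x - of_int i) < pi / 2"
      proof -
        have "D x - of_int i < 1/4" "- (1/4) < D x - of_int i" using i by linarith+
        then have "2 * pi * (D x - of_int i) < 2 * pi * (1/4)" "2 * pi * (- (1/4)) < 2 * pi * (D x - of_int i)"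
          by (intro mult_strict_left_mono; simp)+
        then show "- (pi / 2) < 2 * pi * (D x - of_int i)" "2 * pi * (D x - of_int i) < pi / 2" by auto
      qed
    qed
    ultimately show ?thesis by (simp add: complex_nonpos_Reals_iff)
  qed
  then have 1: "continuous_map T (top_of_set (- \<real>\<^sub>\<le>\<^sub>0)) (\<lambda>x. cis (2 * pi * D x))"
    using D by (auto simp: continuous_map_in_subtopology)
  have 2: "continuous_map (top_of_set (- \<real>\<^sub>\<le>\<^sub>0)) euclideanreal (\<lambda>z. Arg z / (2 * pi))"
    by (simp, intro continuous_intros continuous_at_imp_continuous_on ballI continuous_at_Arg) auto
  show "continuous_map T euclideanreal (\<lambda>x. Arg (cis (2 * pi * D x)) / (2 * pi))"
    using continuous_map_compose[OF 1 2] by (simp add: o_def)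
  show "D x - Arg (cis (2 * pi * D x)) / (2 * pi) \<in> \<int>" for x
    by (rule cis_2pi_eqD) (simp add: cis_Arg)
qed

text \<open>The linear interpolation of the potential \<rho> along the edges is a global real
  function that agrees with the angle modulo \<int>.\<close>

lemma (in fin_digraph) angle_coboundary:
  assumes "\<And>e. e \<in> gedges G \<Longrightarrow> h e = \<rho> (gparam G e 1) - \<rho> (gparam G e 0)"
  obtains r where "continuous_map (gspace G) euclideanreal r"
    "\<And>x. x \<in> topspace (gspace G) \<Longrightarrow> angle G h x - r x \<in> \<int>"
proof -
  obtain r where r: "continuous_map (gspace G) euclideanreal r" "\<And>v. v \<in> gverts G \<Longrightarrow> r v = of_int (\<rho> v)"
    "\<And>e t. e \<in> gedges G \<Longrightarrow> t \<in> {0..1} \<Longrightarrow> r (gparam G e t) = of_int (h e) * t + of_int (\<rho> (gparam G e 0))"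
    by (rule graph_function_extend[of "\<lambda>e t. of_int (h e) * t + of_int (\<rho> (gparam G e 0))" "\<lambda>v. of_int (\<rho> v)"])
      (auto intro!: continuous_intros simp: assms)
  have "angle G h x - r x \<in> \<int>" if "x \<in> topspace (gspace G)" for x
    using that
  proof (cases rule: topspace_cases)
    case vertex
    then show ?thesis using r(2) by (simp add: angle_vertex)
  next
    case (edge e t)
    then show ?thesis using r(3)[of e t] by (simp add: angle_edge)
  qed
  then show ?thesis using that r by blast
qed

section \<open>Angles on the inverse limit and their homotopy classes\<close>

context graph_tower
begin

definition lim_angle :: "nat \<Rightarrow> ('e \<Rightarrow> int) \<Rightarrow> (nat \<Rightarrow> 'v) \<Rightarrow> real" where
  "lim_angle k g x = angle (X k) g (x k)"

definition pull :: "nat \<Rightarrow> nat \<Rightarrow> ('e \<Rightarrow> int) \<Rightarrow> 'e \<Rightarrow> int" where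
  "pull k m g = pullback (X k) (X m) (bonding f k m) g"

lemma pull_compose:
  assumes "k \<le> l" "l \<le> m"
  shows "pull k m g = pull l m (pull k l g)"
  unfolding pull_def bonding_compose[OF assms] by (rule pullback_compose[OF cover[OF assms(2)] cover[OF assms(1)]])

lemma pull_self:
  assumes "e \<in> gedges (X k)"
  shows "pull k k g e = g e"
proof -
  have "of_int (pull k k g e) = of_int (g e) * 1 - of_int (g e) * (0::real)"
    unfolding pull_def
    by (rule graph_cover.pullback_lift[OF cover[OF order_refl] assms])
      (use X.angle_edge_Ints[OF assms] in \<open>auto intro!: continuous_intros\<close>)
  then show ?thesis by simp
qed

lemma continuous_map_cis_lim_angle:
  "continuous_map Y euclidean (\<lambda>x. cis (2 * pi * lim_angle k g x))"
  using continuous_map_compose[OF continuous_map_proj X.continuous_map_cis_angle]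
  by (simp add: o_def lim_angle_def)

lemma lim_angle_pull:
  assumes "k \<le> m"
  obtains r where "continuous_map (gspace (X m)) euclideanreal r"
    "\<And>x. x \<in> topspace Y \<Longrightarrow> lim_angle k g x - lim_angle m (pull k m g) x - r (x m) \<in> \<int>"
proof -
  obtain r where r: "continuous_map (gspace (X m)) euclideanreal r"
    "\<And>x. x \<in> topspace (gspace (X m)) \<Longrightarrow> angle (X k) g (bonding f k m x) - angle (X m) (pull k m g) x - r x \<in> \<int>"
    unfolding pull_def by (rule graph_cover.angle_pullback[OF cover[OF assms], of g]) blast
  have "lim_angle k g x - lim_angle m (pull k m g) x - r (x m) \<in> \<int>" if x: "x \<in> topspace Y" for x
    using r(2)[of "x m"] x topspace_Y bonding_proj[OF x assms] by (simp add: lim_angle_def)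
  then show ?thesis using that r(1) by blast
qed

lemma circle_equiv_pull:
  assumes "k \<le> m"
  shows "circle_equiv Y (lim_angle k g) (lim_angle m (pull k m g))"
proof -
  obtain r where r: "continuous_map (gspace (X m)) euclideanreal r"
    "\<And>x. x \<in> topspace Y \<Longrightarrow> lim_angle k g x - lim_angle m (pull k m g) x - r (x m) \<in> \<int>"
    using lim_angle_pull[OF assms, of g] by blast
  have "continuous_map Y euclideanreal (\<lambda>x. r (x m))"
    by (rule continuous_map_of_proj[OF r(1)])
  then show ?thesis unfolding circle_equiv_def using r(2) by blast
qed

lemma lifted_edge_exists:
  assumes "e \<in> gedges (X n)"
  obtains \<gamma> where "lifted n e \<gamma>"
proof -
  have "gparam (X n) e (1/2) \<in> topspace (gspace (X n))" using X.edge_topspace[OF assms] by simp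
  then obtain z where "z \<in> topspace Y" "z n = gparam (X n) e (1/2)" using proj_onto by blast
  then have "z \<in> mid_fibre n e" by (simp add: mid_fibre_def)
  then show ?thesis using that lift_at(1)[OF assms] by blast
qed

lemma lifted_lim_angle:
  assumes "lifted n e \<gamma>" "t \<in> {0..1}"
  shows "of_int (g e) * t - lim_angle n g (\<gamma> t) \<in> \<int>"
  using X.angle_edge_Ints[OF liftedD(1)[OF assms(1)] assms(2)] liftedD(3)[OF assms]
  by (simp add: lim_angle_def)

lemma lifted_compose_continuous:
  fixes s :: "(nat \<Rightarrow> 'v) \<Rightarrow> 'b::topological_space"
  assumes "lifted n e \<gamma>" "continuous_map Y euclidean s"
  shows "continuous_on {0..1} (\<lambda>t. s (\<gamma> t))"
  using continuous_map_compose[OF lifted_continuous[OF assms(1)] assms(2)] by (simp add: o_def)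

text \<open>After subtracting the homotopy of the pullback, the trivialization is an integer over
  every vertex. At a level where it varies by less than \<open>1\<close> over each point, that
  integer depends on the vertex only and is the potential; lifted edges show that its differences
  are the values of the pullback.\<close>

lemma lim_angle_null:
  assumes "circle_equiv Y (lim_angle k g) (\<lambda>_. 0)"
  obtains m \<rho> where "k \<le> m"
    "\<And>e. e \<in> gedges (X m) \<Longrightarrow> pull k m g e = \<rho> (gparam (X m) e 1) - \<rho> (gparam (X m) e 0)"
proof -
  obtain r where r: "continuous_map Y euclideanreal r" "\<And>x. x \<in> topspace Y \<Longrightarrow> lim_angle k g x - r x \<in> \<int>"
    using assms unfolding circle_equiv_def by auto
  obtain n where n: "\<And>m x y. n \<le> m \<Longrightarrow> x \<in> topspace Y \<Longrightarrow> y \<in> topspace Y \<Longrightarrow> x m = y m \<Longrightarrow> norm (r x - r y) < 1"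
    using eventually_factors[OF r(1), of 1] by auto
  define m where "m = max k n"
  have km: "k \<le> m" and nm: "n \<le> m" by (auto simp: m_def)
  obtain r' where r': "continuous_map (gspace (X m)) euclideanreal r'"
    "\<And>x. x \<in> topspace Y \<Longrightarrow> lim_angle k g x - lim_angle m (pull k m g) x - r' (x m) \<in> \<int>"
    using lim_angle_pull[OF km, of g] by blast
  define h where "h = pull k m g"
  define s where "s x = r x - r' (x m)" for x
  have "continuous_map Y euclideanreal (\<lambda>x. r' (x m))"
    by (rule continuous_map_of_proj[OF r'(1)])
  then have s: "continuous_map Y euclideanreal s" unfolding s_def by (intro continuous_intros r(1))
  have hs: "s x - lim_angle m h x \<in> \<int>" if x: "x \<in> topspace Y" for x
    using Ints_diff[OF r'(2)[OF x] r(2)[OF x]] by (simp add: s_def h_def algebra_simps)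
  have sv: "s x \<in> \<int>" if "x \<in> topspace Y" "x m \<in> gverts (X m)" for x
    using hs[OF that(1)] X.angle_vertex[OF that(2)] by (simp add: lim_angle_def)
  have "\<exists>x. x \<in> topspace Y \<and> x m = v" if "v \<in> gverts (X m)" for v
    using proj_onto X.verts_topspace[OF that] by metis
  then obtain q where q: "\<And>v. v \<in> gverts (X m) \<Longrightarrow> q v \<in> topspace Y \<and> q v m = v" by metis
  define \<rho> where "\<rho> v = \<lfloor>s (q v)\<rfloor>" for v
  have \<rho>: "s x = of_int (\<rho> (x m))" if x: "x \<in> topspace Y" "x m \<in> gverts (X m)" for x
  proof -
    note qv = q[OF x(2)]
    have "s (q (x m)) \<in> \<int>" using sv qv x(2) by simp
    moreover have "s x \<in> \<int>" using sv x by simp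
    moreover have "\<bar>s x - s (q (x m))\<bar> < 1"
      using n[OF nm x(1), of "q (x m)"] qv by (simp add: s_def)
    ultimately show ?thesis unfolding \<rho>_def by (auto elim!: Ints_cases)
  qed
  have "h e = \<rho> (gparam (X m) e 1) - \<rho> (gparam (X m) e 0)" if e: "e \<in> gedges (X m)" for e
  proof -
    obtain \<gamma> where \<gamma>: "lifted m e \<gamma>" using lifted_edge_exists[OF e] .
    have "of_int (h e) * 1 - of_int (h e) * 0 = s (\<gamma> 1) - s (\<gamma> 0)"
    proof (rule lift_difference_unique[where u = "\<lambda>t. lim_angle m h (\<gamma> t)"])
      show "continuous_on {0..1::real} (\<lambda>t. of_int (h e) * t)" by (intro continuous_intros)
      show "continuous_on {0..1} (\<lambda>t. s (\<gamma> t))" by (rule lifted_compose_continuous[OF \<gamma> s])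
      show "of_int (h e) * t - lim_angle m h (\<gamma> t) \<in> \<int>" if "t \<in> {0..1}" for t
        by (rule lifted_lim_angle[OF \<gamma> that])
      show "s (\<gamma> t) - lim_angle m h (\<gamma> t) \<in> \<int>" if "t \<in> {0..1}" for t
        by (rule hs[OF liftedD(2)[OF \<gamma> that]])
    qed auto
    moreover have "s (\<gamma> 0) = of_int (\<rho> (gparam (X m) e 0))" "s (\<gamma> 1) = of_int (\<rho> (gparam (X m) e 1))"
      using \<rho>[OF liftedD(2)[OF \<gamma>]] liftedD(3)[OF \<gamma>] X.edge_0[OF e] X.edge_1[OF e] by auto
    ultimately show ?thesis by linarith
  qed
  then show ?thesis using that km by (simp add: h_def)
qed

text \<open>At a level where the circle map varies little over each point, it is nearly a map of the
  graph. One lift of each edge then suffices to measure its winding, up to an error that is too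
  small to change the homotopy class.\<close>

lemma lim_angle_onto:
  assumes U: "continuous_map Y euclidean (\<lambda>x. cis (2 * pi * U x))"
  obtains n g where "circle_equiv Y U (lim_angle n g)"
proof -
  \<comment> \<open>The errors below are \<open>1/16\<close> at each end of an edge, hence
    \<open>1/8\<close> for \<open>K\<close>, and \<open>1/16 + 1/16 + 1/8 = 1/4\<close> for
    \<open>D\<close>, which is the bound in \<open>circle_equiv_zeroI\<close>.\<close>
  obtain \<delta> where \<delta>: "\<delta> > 0"
    "\<And>x y. norm (cis (2 * pi * x) - cis (2 * pi * y)) < \<delta> \<Longrightarrow> \<exists>i::int. \<bar>x - y - of_int i\<bar> < 1/16"
    using cis_close_imp_near_Ints[of "1/16"] by auto
  obtain n where n: "\<And>m x y. n \<le> m \<Longrightarrow> x \<in> topspace Y \<Longrightarrow> y \<in> topspace Y \<Longrightarrow> x m = y m \<Longrightarrow>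
      norm (cis (2 * pi * U x) - cis (2 * pi * U y)) < \<delta>"
    using eventually_factors[OF U \<delta>(1)] by blast
  have near: "\<exists>i::int. \<bar>U x - U y - of_int i\<bar> < 1/16"
    if "x \<in> topspace Y" "y \<in> topspace Y" "x n = y n" for x y
    using \<delta>(2) n[OF order_refl that] by blast
  have "\<exists>x. x \<in> topspace Y \<and> x n = v" if "v \<in> gverts (X n)" for v
    using proj_onto X.verts_topspace[OF that] by metis
  then obtain q where q: "\<And>v. v \<in> gverts (X n) \<Longrightarrow> q v \<in> topspace Y \<and> q v n = v" by metis
  define \<rho> where "\<rho> v = U (q v)" for v
  have "\<exists>\<gamma> W. lifted n e \<gamma> \<and> continuous_on {0..1} W \<and> (\<forall>t\<in>{0..1}. W t - U (\<gamma> t) \<in> \<int>)"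
    if e: "e \<in> gedges (X n)" for e
  proof -
    obtain \<gamma> where \<gamma>: "lifted n e \<gamma>" using lifted_edge_exists[OF e] .
    obtain W where "continuous_on {0..1} W" "\<And>t. t \<in> {0..1} \<Longrightarrow> W t - U (\<gamma> t) \<in> \<int>"
      using circle_path_lift[OF lifted_compose_continuous[OF \<gamma> U]] by blast
    with \<gamma> show ?thesis by blast
  qed
  then obtain \<gamma> W where \<gamma>: "\<And>e. e \<in> gedges (X n) \<Longrightarrow> lifted n e (\<gamma> e)"
    and W: "\<And>e. e \<in> gedges (X n) \<Longrightarrow> continuous_on {0..1} (W e)"
    and WU: "\<And>e t. e \<in> gedges (X n) \<Longrightarrow> t \<in> {0..1} \<Longrightarrow> W e t - U (\<gamma> e t) \<in> \<int>"
    by metis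
  have end_near: "\<exists>i::int. \<bar>W e u - \<rho> (gparam (X n) e u) - of_int i\<bar> < 1/16"
    if e: "e \<in> gedges (X n)" and u: "u = 0 \<or> u = 1" for e u
  proof -
    have u01: "u \<in> {0..1}" and v: "gparam (X n) e u \<in> gverts (X n)"
      using u X.edge_0[OF e] X.edge_1[OF e] by auto
    obtain i :: int where i: "\<bar>U (\<gamma> e u) - \<rho> (gparam (X n) e u) - of_int i\<bar> < 1/16"
      using near[OF liftedD(2)[OF \<gamma>[OF e] u01], of "q (gparam (X n) e u)"] q[OF v] liftedD(3)[OF \<gamma>[OF e] u01]
      unfolding \<rho>_def by auto
    obtain j where "W e u - U (\<gamma> e u) = of_int j" using WU[OF e u01] by (auto elim: Ints_cases)
    then have "W e u - \<rho> (gparam (X n) e u) - of_int (i + j) = U (\<gamma> e u) - \<rho> (gparam (X n) e u) - of_int i"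
      by simp
    then show ?thesis using i by (intro exI[of _ "i + j"]) (simp only:)
  qed
  \<comment> \<open>The winding along the chosen lift, with its two ends moved to the reference
    values \<rho>; up to \<open>1/8\<close> it is an integer.\<close>
  define K where "K e = W e 1 - W e 0 + \<rho> (gparam (X n) e 0) - \<rho> (gparam (X n) e 1)" for e
  have "\<exists>k::int. \<bar>K e - of_int k\<bar> < 1/8" if e: "e \<in> gedges (X n)" for e
  proof -
    obtain i0 i1 :: int where "\<bar>W e 0 - \<rho> (gparam (X n) e 0) - of_int i0\<bar> < 1/16"
      "\<bar>W e 1 - \<rho> (gparam (X n) e 1) - of_int i1\<bar> < 1/16"
      using end_near[OF e, of 0] end_near[OF e, of 1] by auto
    then have "\<bar>K e - of_int (i1 - i0)\<bar> < 1/8" unfolding K_def of_int_diff by linarith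
    then show ?thesis by blast
  qed
  then obtain g :: "'e \<Rightarrow> int" where g: "\<And>e. e \<in> gedges (X n) \<Longrightarrow> \<bar>K e - of_int (g e)\<bar> < 1/8" by metis
  \<comment> \<open>The lift without its linear part \<open>K e * t\<close> takes the values \<rho>
    at both ends, so these functions glue over the vertices.\<close>
  obtain r where r: "continuous_map (gspace (X n)) euclideanreal r" "\<And>v. v \<in> gverts (X n) \<Longrightarrow> r v = \<rho> v"
    "\<And>e t. e \<in> gedges (X n) \<Longrightarrow> t \<in> {0..1} \<Longrightarrow>
       r (gparam (X n) e t) = W e t - W e 0 + \<rho> (gparam (X n) e 0) - K e * t"
    by (rule X.graph_function_extend[of n "\<lambda>e t. W e t - W e 0 + \<rho> (gparam (X n) e 0) - K e * t" \<rho>])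
      (auto intro!: continuous_intros simp: W K_def)
  define D where "D x = U x - lim_angle n g x - r (x n)" for x
  have "\<exists>i::int. \<bar>D x - of_int i\<bar> < 1/4" if x: "x \<in> topspace Y" for x
  proof -
    have "x n \<in> topspace (gspace (X n))" using x topspace_Y by blast
    then show ?thesis
    proof (cases rule: X.topspace_cases)
      case vertex
      then have "D x = U x - U (q (x n))" by (simp add: D_def lim_angle_def X.angle_vertex r(2) \<rho>_def)
      moreover obtain i :: int where "\<bar>U x - U (q (x n)) - of_int i\<bar> < 1/16"
        using near[OF x, of "q (x n)"] q[OF vertex] by auto
      ultimately show ?thesis by (intro exI[of _ i]) simp
    next
      case (edge e t)
      then have t: "t \<in> {0..1}" by simp
      have Dx: "D x = (U x - U (\<gamma> e t)) - (W e t - U (\<gamma> e t)) + (W e 0 - \<rho> (gparam (X n) e 0)) + (K e - of_int (g e)) * t"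
        using r(3)[OF edge(1) t] edge by (simp add: D_def lim_angle_def X.angle_edge algebra_simps)
      obtain i :: int where i: "\<bar>U x - U (\<gamma> e t) - of_int i\<bar> < 1/16"
        using near[OF x liftedD(2)[OF \<gamma>[OF edge(1)] t]] liftedD(3)[OF \<gamma>[OF edge(1)] t] edge(3) by auto
      obtain j where j: "W e t - U (\<gamma> e t) = of_int j" using WU[OF edge(1) t] by (auto elim: Ints_cases)
      obtain k :: int where k: "\<bar>W e 0 - \<rho> (gparam (X n) e 0) - of_int k\<bar> < 1/16"
        using end_near[OF edge(1), of 0] by auto
      have "\<bar>(K e - of_int (g e)) * t\<bar> \<le> \<bar>K e - of_int (g e)\<bar> * 1"
        unfolding abs_mult using t by (intro mult_left_mono) auto
      then have "\<bar>(K e - of_int (g e)) * t\<bar> \<le> \<bar>K e - of_int (g e)\<bar>" by (simp only: mult_1_right)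
      then have "\<bar>(K e - of_int (g e)) * t\<bar> < 1/8" using g[OF edge(1)] by (rule le_less_trans)
      then have "\<bar>D x - of_int (i - j + k)\<bar> < 1/4" using i j k unfolding Dx of_int_add of_int_diff by linarith
      then show ?thesis by blast
    qed
  qed
  moreover have rn: "continuous_map Y euclideanreal (\<lambda>x. r (x n))"
    by (rule continuous_map_of_proj[OF r(1)])
  moreover have "continuous_map Y euclidean (\<lambda>x. cis (2 * pi * D x))"
  proof -
    have "continuous_map Y euclidean (\<lambda>x. cnj (cis (2 * pi * lim_angle n g x)))"
      using continuous_map_compose[OF continuous_map_cis_lim_angle[of n g], of euclidean cnj]
      by (simp add: o_def continuous_on_cnj)
    moreover have "continuous_map Y euclidean (\<lambda>x. cis (2 * pi * - r (x n)))"
      by (intro continuous_map_cis continuous_intros rn)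
    ultimately have "continuous_map Y euclidean (\<lambda>x. cis (2 * pi * U x) *
        cnj (cis (2 * pi * lim_angle n g x)) * cis (2 * pi * - r (x n)))"
      by (intro continuous_map_mult U)
    moreover have "cis (2 * pi * U x) * cnj (cis (2 * pi * lim_angle n g x)) * cis (2 * pi * - r (x n))
        = cis (2 * pi * D x)" for x
      unfolding cis_cnj cis_mult D_def by (simp add: algebra_simps)
    ultimately show ?thesis by simp
  qed
  ultimately obtain r' where r': "continuous_map Y euclideanreal r'" "\<And>x. x \<in> topspace Y \<Longrightarrow> D x - r' x \<in> \<int>"
    using circle_equiv_zeroI[of Y D] by blast
  have "continuous_map Y euclideanreal (\<lambda>x. r (x n) + r' x)" by (intro continuous_intros rn r')
  moreover have "U x - lim_angle n g x - (r (x n) + r' x) \<in> \<int>" if "x \<in> topspace Y" for x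
    using r'(2)[OF that] by (simp add: D_def algebra_simps)
  ultimately have "circle_equiv Y U (lim_angle n g)" unfolding circle_equiv_def by blast
  then show ?thesis using that by blast
qed

section \<open>Forward curves\<close>

definition positive :: "nat \<Rightarrow> ('e \<Rightarrow> int) \<Rightarrow> bool" where
  "positive k g \<longleftrightarrow> (\<forall>e\<in>gedges (X k). 0 < g e)"

text \<open>Direction is expressed by the growth of angles instead of coordinates in edges, so that
  it can be compared after composition with a homeomorphism.\<close>

definition forward :: "real set \<Rightarrow> (real \<Rightarrow> nat \<Rightarrow> 'v) \<Rightarrow> bool" where
  "forward I \<eta> \<longleftrightarrow> (\<forall>k g. positive k g \<longrightarrow>
     (\<exists>W. continuous_on I W \<and> strict_mono_on I W \<and> (\<forall>s\<in>I. W s - lim_angle k g (\<eta> s) \<in> \<int>)))"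

text \<open>Lifts from level \<open>0\<close> are used because each of their coordinates, at every
  level, moves monotonically in a single edge; so the positive angles of all levels increase along
  them.\<close>

lemma lifted_lim_angle_above:
  assumes l: "lifted 0 e \<gamma>" and pos: "positive k g"
  obtains W where "continuous_on {0..1} W" "strict_mono_on {0..1} W"
    "\<And>t. t \<in> {0..1} \<Longrightarrow> W t - lim_angle k g (\<gamma> t) \<in> \<int>"
proof -
  obtain d \<psi> where d: "edge_segment (X k) d \<psi> (\<lambda>t. \<gamma> t k)" using liftedD(4)[OF l, of k] by auto
  note D = edge_segmentD[OF d]
  have g: "0 < g d" using pos D(1) by (simp add: positive_def)
  show ?thesis
  proof (rule that[of "\<lambda>t. of_int (g d) * \<psi> t"])
    show "continuous_on {0..1} (\<lambda>t. of_int (g d) * \<psi> t)" by (intro continuous_intros D(3))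
    show "strict_mono_on {0..1} (\<lambda>t. of_int (g d) * \<psi> t)"
      using strict_mono_onD[OF D(2)] g by (intro strict_mono_onI) simp
    fix t :: real assume t: "t \<in> {0..1}"
    then have "\<psi> t \<in> {0..1}" using D(4) by blast
    then show "of_int (g d) * \<psi> t - lim_angle k g (\<gamma> t) \<in> \<int>"
      using X.angle_edge_Ints[OF D(1), of "\<psi> t" g] D(5)[OF t] by (simp add: lim_angle_def)
  qed
qed

text \<open>
  At a thread of vertices, a lifted edge ending there is followed by a lifted edge starting there.
\<close>
lemma forward_curve_through:
  assumes y: "y \<in> topspace Y"
  obtains \<eta> where "continuous_map (top_of_set {-1..1}) Y \<eta>" "\<eta> 0 = y" "forward {-1..1} \<eta>"
proof -
  have "y 0 \<in> topspace (gspace (X 0))" using y topspace_Y by blast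
  then show ?thesis
  proof (cases rule: X.topspace_cases)
    case vertex
    obtain a \<alpha> where a: "lifted 0 a \<alpha>" "\<alpha> 1 = y" using lifted_to_vertex[OF y vertex, of 1] by auto
    obtain b \<beta> where b: "lifted 0 b \<beta>" "\<beta> 0 = y" using lifted_to_vertex[OF y vertex, of 0] by auto
    define \<eta> where "\<eta> s = (if s \<le> 0 then \<alpha> (1 + s) else \<beta> s)" for s
    have "continuous_map (top_of_set {-1..1}) Y \<eta>"
      unfolding \<eta>_def
    proof (rule continuous_map_cases_le)
      have "continuous_map (top_of_set {-1..0}) (top_of_set {0..1::real}) (\<lambda>s. 1 + s)"
        by (auto simp: continuous_map_in_subtopology intro!: continuous_intros)
      from continuous_map_compose[OF this lifted_continuous[OF a(1)]]
      have "continuous_map (top_of_set {-1..0}) Y (\<lambda>s. \<alpha> (1 + s))" by (simp add: o_def)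
      moreover have "{x \<in> {-1..1}. x \<le> 0} = {-1..0::real}" by auto
      ultimately show "continuous_map (subtopology (top_of_set {-1..1}) {x \<in> topspace (top_of_set {-1..1}). x \<le> 0}) Y (\<lambda>s. \<alpha> (1 + s))"
        by (simp add: subtopology_subtopology Int_absorb1)
      have "{x \<in> {-1..1}. 0 \<le> x} = {0..1::real}" by auto
      then show "continuous_map (subtopology (top_of_set {-1..1}) {x \<in> topspace (top_of_set {-1..1}). 0 \<le> x}) Y \<beta>"
        using lifted_continuous[OF b(1)] by (simp add: subtopology_subtopology Int_absorb1)
    qed (use a b in \<open>auto intro!: continuous_intros\<close>)
    moreover have "\<eta> 0 = y" using a by (simp add: \<eta>_def)
    moreover have "forward {-1..1} \<eta>"
      unfolding forward_def
    proof (intro allI impI)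
      fix k g assume pos: "positive k g"
      obtain V where V: "continuous_on {0..1} V" "strict_mono_on {0..1} V"
        "\<And>t. t \<in> {0..1} \<Longrightarrow> V t - lim_angle k g (\<alpha> t) \<in> \<int>" using lifted_lim_angle_above[OF a(1) pos] by blast
      obtain W where W: "continuous_on {0..1} W" "strict_mono_on {0..1} W"
        "\<And>t. t \<in> {0..1} \<Longrightarrow> W t - lim_angle k g (\<beta> t) \<in> \<int>" using lifted_lim_angle_above[OF b(1) pos] by blast
      \<comment> \<open>The constant \<open>V 1 - W 0\<close> joins the two lifts continuously. It
        is an integer, because both values agree with the angle at \<open>y\<close> modulo
        \<int>.\<close>
      define Z where "Z s = (if s \<le> 0 then V (1 + s) else W s + (V 1 - W 0))" for s
      have "continuous_on ({-1..0} \<union> {0..1}) Z"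
        unfolding Z_def
      proof (rule continuous_on_cases)
        show "continuous_on {-1..0} (\<lambda>s. V (1 + s))"
          by (rule continuous_on_compose2[OF V(1)]) (auto intro!: continuous_intros)
        show "continuous_on {0..1} (\<lambda>s. W s + (V 1 - W 0))" by (intro continuous_intros W(1))
      qed auto
      moreover have "{-1..0} \<union> {0..1} = {-1..1::real}" by auto
      ultimately have "continuous_on {-1..1} Z" by simp
      moreover have "strict_mono_on {-1..1} Z"
      proof (rule strict_mono_onI)
        fix s t :: real assume st: "s \<in> {-1..1}" "t \<in> {-1..1}" "s < t"
        consider "t \<le> 0" | "s \<le> 0" "0 < t" | "0 < s" by linarith
        then show "Z s < Z t"
        proof cases
          case 1
          then show ?thesis using strict_mono_onD[OF V(2), of "1 + s" "1 + t"] st by (simp add: Z_def)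
        next
          case 2
          then have "V (1 + s) \<le> V 1" using strict_mono_on_leD[OF V(2), of "1 + s" 1] st by simp
          moreover have "W 0 < W t" using strict_mono_onD[OF W(2), of 0 t] 2 st by simp
          ultimately show ?thesis using 2 by (simp add: Z_def)
        next
          case 3
          then show ?thesis using strict_mono_onD[OF W(2), of s t] st by (simp add: Z_def)
        qed
      qed
      moreover have "Z s - lim_angle k g (\<eta> s) \<in> \<int>" if s: "s \<in> {-1..1}" for s
      proof (cases "s \<le> 0")
        case True
        then show ?thesis using V(3)[of "1 + s"] s by (simp add: Z_def \<eta>_def)
      next
        case False
        have "(V 1 - lim_angle k g y) - (W 0 - lim_angle k g y) \<in> \<int>"
          using Ints_diff[OF V(3)[of 1] W(3)[of 0]] a(2) b(2) by simp
        moreover have "W s - lim_angle k g (\<beta> s) \<in> \<int>" using W(3)[of s] s False by simp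
        ultimately have "(W s - lim_angle k g (\<beta> s)) + ((V 1 - lim_angle k g y) - (W 0 - lim_angle k g y)) \<in> \<int>"
          by (intro Ints_add)
        then show ?thesis using False by (simp add: Z_def \<eta>_def algebra_simps)
      qed
      ultimately show "\<exists>W. continuous_on {-1..1} W \<and> strict_mono_on {-1..1} W \<and>
          (\<forall>s\<in>{-1..1}. W s - lim_angle k g (\<eta> s) \<in> \<int>)" by blast
    qed
    ultimately show ?thesis using that by blast
  next
    case (edge e t)
    obtain \<gamma> where \<gamma>: "lifted 0 e \<gamma>" "\<gamma> t = y" using lifted_exists[OF y edge(1,2,3)] by blast
    define c where "c = min t (1 - t)"
    have c: "c > 0" "c \<le> t" "t + c \<le> 1" using edge(2) by (auto simp: c_def)
    have in01: "t + c * s \<in> {0..1}" if "s \<in> {-1..1}" for s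
    proof -
      have "c * s \<le> c * 1" "c * (-1) \<le> c * s" using that c by (intro mult_left_mono; simp)+
      then have "0 \<le> t + c * s" "t + c * s \<le> 1" using c by linarith+
      then show ?thesis by simp
    qed
    define \<eta> where "\<eta> s = \<gamma> (t + c * s)" for s
    have "continuous_map (top_of_set {-1..1}) (top_of_set {0..1}) (\<lambda>s. t + c * s)"
      using in01 by (auto simp: continuous_map_in_subtopology intro!: continuous_intros)
    from continuous_map_compose[OF this lifted_continuous[OF \<gamma>(1)]]
    have "continuous_map (top_of_set {-1..1}) Y \<eta>" by (simp add: o_def \<eta>_def[abs_def])
    moreover have "\<eta> 0 = y" using \<gamma>(2) by (simp add: \<eta>_def)
    moreover have "forward {-1..1} \<eta>"
      unfolding forward_def
    proof (intro allI impI)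
      fix k g assume pos: "positive k g"
      obtain V where V: "continuous_on {0..1} V" "strict_mono_on {0..1} V"
        "\<And>t. t \<in> {0..1} \<Longrightarrow> V t - lim_angle k g (\<gamma> t) \<in> \<int>" using lifted_lim_angle_above[OF \<gamma>(1) pos] by blast
      have "continuous_on {-1..1} (\<lambda>s. V (t + c * s))"
        by (rule continuous_on_compose2[OF V(1)]) (use in01 in \<open>auto intro!: continuous_intros\<close>)
      moreover have "strict_mono_on {-1..1} (\<lambda>s. V (t + c * s))"
        using strict_mono_onD[OF V(2) in01 in01] c(1) by (intro strict_mono_onI) simp
      moreover have "\<forall>s\<in>{-1..1}. V (t + c * s) - lim_angle k g (\<eta> s) \<in> \<int>"
        using V(3)[OF in01] by (simp add: \<eta>_def)
      ultimately show "\<exists>W. continuous_on {-1..1} W \<and> strict_mono_on {-1..1} W \<and>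
          (\<forall>s\<in>{-1..1}. W s - lim_angle k g (\<eta> s) \<in> \<int>)" by (intro exI conjI)
    qed
    ultimately show ?thesis using that by blast
  qed
qed

end

text \<open>The maximum of \<open>W\<close> on \<open>{s..t}\<close> can be attained only at
  \<open>t\<close>, because \<open>W\<close> still increases to the right of every earlier
  point.\<close>

lemma strict_mono_on_open_intervalI:
  fixes W :: "real \<Rightarrow> real"
  assumes cont: "continuous_on {0<..<1} W"
    and local: "\<And>t. t \<in> {0<..<1} \<Longrightarrow> \<exists>a b. a < t \<and> t < b \<and> strict_mono_on {a..b} W"
  shows "strict_mono_on {0<..<1} W"
proof (rule strict_mono_onI)
  fix s t :: real assume s: "s \<in> {0<..<1}" and t: "t \<in> {0<..<1}" and st: "s < t"
  have max: "m = t" if m: "m \<in> {s..t}" "\<And>x. x \<in> {s..t} \<Longrightarrow> W x \<le> W m" for m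
  proof (rule ccontr)
    assume "m \<noteq> t"
    then have mt: "m < t" using m by simp
    have "m \<in> {0<..<1}" using m(1) s t by simp
    then obtain a b where ab: "a < m" "m < b" "strict_mono_on {a..b} W" using local by blast
    define x where "x = min b t"
    have x: "m < x" "x \<in> {a..b}" "x \<in> {s..t}" using ab mt m(1) by (auto simp: x_def)
    have "W m < W x" using strict_mono_onD[OF ab(3), of m x] ab x by simp
    then show False using m(2)[OF x(3)] by simp
  qed
  have "continuous_on {s..t} W" by (rule continuous_on_subset[OF cont]) (use s t in auto)
  then obtain m where m: "m \<in> {s..t}" "\<And>x. x \<in> {s..t} \<Longrightarrow> W x \<le> W m"
    using continuous_attains_sup[of "{s..t}" W] st by auto
  then have "m = t" using max by blast
  then have "W s \<le> W t" using m st by simp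
  moreover have "W s \<noteq> W t"
  proof
    assume "W s = W t"
    then have "\<And>x. x \<in> {s..t} \<Longrightarrow> W x \<le> W s" using m \<open>m = t\<close> by simp
    then have "s = t" using max[of s] st by simp
    then show False using st by simp
  qed
  ultimately show "W s < W t" by simp
qed

lemma strict_mono_on_closed_intervalI:
  fixes W :: "real \<Rightarrow> real"
  assumes cont: "continuous_on {0..1} W" and mono: "strict_mono_on {0<..<1} W"
  shows "strict_mono_on {0..1} W"
proof (rule strict_mono_onI)
  fix s t :: real assume s: "s \<in> {0..1}" and t: "t \<in> {0..1}" and st: "s < t"
  obtain p where p: "s < p" "p < t" using st dense by blast
  obtain q where q: "p < q" "q < t" using p dense by blast
  have pq: "p \<in> {0<..<1}" "q \<in> {0<..<1}" using p q s t by auto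
  have "W s \<le> W p"
  proof (rule continuous_le_on_closure[of "{s<..<p}" W])
    show "continuous_on (closure {s<..<p}) W"
      by (rule continuous_on_subset[OF cont]) (use p pq s in auto)
    show "s \<in> closure {s<..<p}" using p by simp
    show "W x \<le> W p" if "x \<in> {s<..<p}" for x
      using strict_mono_onD[OF mono, of x p] that pq s by simp
  qed
  moreover have "W p < W q" using strict_mono_onD[OF mono pq q(1)] .
  moreover have "W q \<le> W t"
  proof (rule continuous_ge_on_closure[of "{q<..<t}" W])
    show "continuous_on (closure {q<..<t}) W"
      by (rule continuous_on_subset[OF cont]) (use q pq t in auto)
    show "t \<in> closure {q<..<t}" using q by simp
    show "W q \<le> W x" if "x \<in> {q<..<t}" for x
      using strict_mono_onD[OF mono, of q x] that pq t by simp
  qed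
  ultimately show "W s < W t" by simp
qed

lemma (in graph_cover) edge_in_edge_path:
  assumes d: "d \<in> gedges H" and e: "e \<in> gedges G" and mid: "gparam G e (1/2) \<in> F ` gparam H d ` {0..1}"
  shows "e \<in> set (edge_path G (F \<circ> gparam H d))"
proof -
  obtain \<tau> \<phi> where trav: "traversal G (F \<circ> gparam H d) (edge_path G (F \<circ> gparam H d)) \<tau> \<phi>"
    (is "traversal _ _ ?es _ _") using traverses_edge[OF d] traverses_traversal by metis
  obtain s where s: "s \<in> {0..1}" "gparam G e (1/2) = F (gparam H d s)" using mid by blast
  obtain i where i: "i < length ?es" "s \<in> {\<tau> i..\<tau> (Suc i)}" using traversal_locate[OF trav s(1)] .
  note st = traversal_step[OF trav i(1)]
  have "\<phi> i s \<in> {0..1}" using st(4) i(2) by blast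
  moreover have "gparam G e (1/2) = gparam G (?es ! i) (\<phi> i s)" using st(8)[OF i(2)] s(2) by simp
  ultimately have "e = ?es ! i" using G.edge_inj(1)[OF e st(1), of "1/2"] by simp
  then show ?thesis using i(1) by simp
qed

lemma (in graph_cover) edge_path_nonempty:
  assumes d: "d \<in> gedges H"
  shows "set (edge_path G (F \<circ> gparam H d)) \<noteq> {}" "set (edge_path G (F \<circ> gparam H d)) \<subseteq> gedges G"
proof -
  obtain \<tau> \<phi> where trav: "traversal G (F \<circ> gparam H d) (edge_path G (F \<circ> gparam H d)) \<tau> \<phi>"
    using traverses_edge[OF d] traverses_traversal by metis
  show "set (edge_path G (F \<circ> gparam H d)) \<noteq> {}" using traversal_nonempty[OF trav] by simp
  show "set (edge_path G (F \<circ> gparam H d)) \<subseteq> gedges G"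
    using traversal_step(1)[OF trav] by (auto simp: in_set_conv_nth)
qed

context graph_tower
begin

text \<open>In contrast to \<open>circle_equiv\<close>, the homotopy \<open>r\<close> is named: its
  values at the ends of lifted edges enter the estimates.\<close>

definition represents :: "nat \<Rightarrow> ('e \<Rightarrow> int) \<Rightarrow> ((nat \<Rightarrow> 'v) \<Rightarrow> real) \<Rightarrow> ((nat \<Rightarrow> 'v) \<Rightarrow> real) \<Rightarrow> bool" where
  "represents n g r U \<longleftrightarrow> continuous_map Y euclideanreal r \<and>
     (\<forall>x\<in>topspace Y. U x - lim_angle n g x - r x \<in> \<int>)"

lemma represents_lift:
  assumes "represents n g r U" "lifted n e \<gamma>"
  shows "continuous_on {0..1} (\<lambda>t. of_int (g e) * t + r (\<gamma> t))"
    "\<And>t. t \<in> {0..1} \<Longrightarrow> of_int (g e) * t + r (\<gamma> t) - U (\<gamma> t) \<in> \<int>"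
proof -
  show "continuous_on {0..1} (\<lambda>t. of_int (g e) * t + r (\<gamma> t))"
    using assms by (auto simp: represents_def intro!: continuous_intros lifted_compose_continuous)
  fix t :: real assume t: "t \<in> {0..1}"
  have "U (\<gamma> t) - lim_angle n g (\<gamma> t) - r (\<gamma> t) \<in> \<int>"
    using assms(1) liftedD(2)[OF assms(2) t] unfolding represents_def by blast
  from Ints_diff[OF lifted_lim_angle[OF assms(2) t, of g] this]
  show "of_int (g e) * t + r (\<gamma> t) - U (\<gamma> t) \<in> \<int>" by (simp add: algebra_simps)
qed

text \<open>The new homotopy differs from \<open>r\<close> by a function of \<open>x N\<close>.
  Hence its variation over a point of level \<open>N\<close> is that of \<open>r\<close>, and a
  bound on this variation can be fixed before the level is chosen.\<close>

lemma represents_pull: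
  assumes "represents n g r U" "n \<le> N"
  obtains r' where "represents N (pull n N g) r' U"
    "\<And>x y. x \<in> topspace Y \<Longrightarrow> y \<in> topspace Y \<Longrightarrow> x N = y N \<Longrightarrow> r' x - r' y = r x - r y"
proof -
  obtain q where q: "continuous_map (gspace (X N)) euclideanreal q"
    "\<And>x. x \<in> topspace Y \<Longrightarrow> lim_angle n g x - lim_angle N (pull n N g) x - q (x N) \<in> \<int>"
    using lim_angle_pull[OF assms(2), of g] by blast
  have "continuous_map Y euclideanreal (\<lambda>x. q (x N))"
    by (rule continuous_map_of_proj[OF q(1)])
  then have "continuous_map Y euclideanreal (\<lambda>x. r x + q (x N))"
    using assms(1) unfolding represents_def by (intro continuous_intros) auto
  moreover have "U x - lim_angle N (pull n N g) x - (r x + q (x N)) \<in> \<int>" if x: "x \<in> topspace Y" for x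
  proof -
    have "(U x - lim_angle n g x - r x) + (lim_angle n g x - lim_angle N (pull n N g) x - q (x N)) \<in> \<int>"
      using assms(1) q(2)[OF x] x unfolding represents_def by (intro Ints_add) auto
    then show ?thesis by (simp add: algebra_simps)
  qed
  ultimately have "represents N (pull n N g) (\<lambda>x. r x + q (x N)) U" unfolding represents_def by blast
  then show ?thesis by (rule that) simp
qed

end

section \<open>The direction of lifted edges under a homeomorphism\<close>

locale tower_homeo =
  A: graph_tower X1 f1 + B: graph_tower X2 f2
  for X1 :: "nat \<Rightarrow> ('v1, 'e1) digraph" and f1 :: "nat \<Rightarrow> 'v1 \<Rightarrow> 'v1"
    and X2 :: "nat \<Rightarrow> ('v2, 'e2) digraph" and f2 :: "nat \<Rightarrow> 'v2 \<Rightarrow> 'v2" +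
  fixes h h'
  assumes homeo: "homeomorphic_maps (inverse_limit X1 f1) (inverse_limit X2 f2) h h'"
    and simple_A: "simplicity_condition X1 f1" and simple_B: "simplicity_condition X2 f2"
begin

lemma homeomorphism: "continuous_map A.Y B.Y h" "continuous_map B.Y A.Y h'"
  "\<And>x. x \<in> topspace A.Y \<Longrightarrow> h' (h x) = x" "\<And>y. y \<in> topspace B.Y \<Longrightarrow> h (h' y) = y"
  "\<And>x. x \<in> topspace A.Y \<Longrightarrow> h x \<in> topspace B.Y"
  using homeo by (auto simp: homeomorphic_maps_def continuous_map_def)

definition transported_lift :: "nat \<Rightarrow> ('e2 \<Rightarrow> int) \<Rightarrow> real set \<Rightarrow> (real \<Rightarrow> nat \<Rightarrow> 'v1) \<Rightarrow> (real \<Rightarrow> real) \<Rightarrow> bool" where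
  "transported_lift k g I \<gamma> W \<longleftrightarrow> B.positive k g \<and> continuous_on I W \<and>
     (\<forall>t\<in>I. W t - B.lim_angle k g (h (\<gamma> t)) \<in> \<int>)"

definition oriented :: "real \<Rightarrow> (real \<Rightarrow> nat \<Rightarrow> 'v1) \<Rightarrow> bool" where
  "oriented \<sigma> \<gamma> \<longleftrightarrow> (\<forall>k g W. transported_lift k g {0..1} \<gamma> W \<longrightarrow> strict_mono_on {0..1} (\<lambda>t. \<sigma> * W t))"

text \<open>One interval serves all levels \<open>k\<close> and all positive functions
  \<open>g\<close>, so the sign belongs to the curve and not to the angle with which it is
  tested.\<close>

definition oriented_near :: "real \<Rightarrow> (real \<Rightarrow> nat \<Rightarrow> 'v1) \<Rightarrow> real \<Rightarrow> bool" where
  "oriented_near \<sigma> \<gamma> t \<longleftrightarrow> (\<exists>a b. a < t \<and> t < b \<and> {a..b} \<subseteq> {0<..<1} \<and>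
     (\<forall>k g W. transported_lift k g {0..1} \<gamma> W \<longrightarrow> strict_mono_on {a..b} (\<lambda>t. \<sigma> * W t)))"

text \<open>The constant \<open>1\<close> is positive on all edges, so a test angle is always
  available and \<open>oriented\<close> is never vacuous for a lifted edge.\<close>

lemma transported_lift_exists:
  assumes l: "A.lifted n e \<gamma>"
  obtains W where "transported_lift 0 (\<lambda>_. 1) {0..1} \<gamma> W"
proof -
  have "continuous_map A.Y euclidean (\<lambda>x. cis (2 * pi * B.lim_angle 0 (\<lambda>_. 1) (h x)))"
    using continuous_map_compose[OF homeomorphism(1) B.continuous_map_cis_lim_angle] by (simp add: o_def)
  from circle_path_lift[OF A.lifted_compose_continuous[OF l this]]
  obtain W where "continuous_on {0..1} W" "\<And>t. t \<in> {0..1} \<Longrightarrow> W t - B.lim_angle 0 (\<lambda>_. 1) (h (\<gamma> t)) \<in> \<int>"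
    by blast
  then have "transported_lift 0 (\<lambda>_. 1) {0..1} \<gamma> W" by (simp add: transported_lift_def B.positive_def)
  then show ?thesis by (rule that)
qed

text \<open>
  Near \<open>\<gamma> t\<close> the preimage under \<open>h\<close> of a forward curve through \<open>h (\<gamma> t)\<close> can only run along
  \<open>\<gamma>\<close>, so \<open>h \<circ> \<gamma>\<close> cannot turn around.
\<close>
lemma lifted_oriented_near:
  assumes l: "A.lifted n e \<gamma>" and t0: "t0 \<in> {0<..<1}"
  shows "oriented_near 1 \<gamma> t0 \<or> oriented_near (-1) \<gamma> t0"
proof -
  have t0': "t0 \<in> {0..1}" using t0 by simp
  note e = A.liftedD(1)[OF l]
  have \<gamma>0: "\<gamma> t0 \<in> topspace A.Y" by (rule A.liftedD(2)[OF l t0'])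
  obtain \<eta> where \<eta>: "continuous_map (top_of_set {-1..1}) B.Y \<eta>" "\<eta> 0 = h (\<gamma> t0)" "B.forward {-1..1} \<eta>"
    using B.forward_curve_through[OF homeomorphism(5)[OF \<gamma>0]] by blast
  have \<eta>B: "\<eta> s \<in> topspace B.Y" if "s \<in> {-1..1}" for s
    using \<eta>(1) that by (auto simp: continuous_map_def)
  define \<delta> where "\<delta> s = h' (\<eta> s)" for s
  have \<delta>c: "continuous_map (top_of_set {-1..1}) A.Y \<delta>"
    using continuous_map_compose[OF \<eta>(1) homeomorphism(2)] by (simp add: o_def \<delta>_def[abs_def])
  have \<delta>0: "\<delta> 0 = \<gamma> t0" using \<eta>(2) homeomorphism(3)[OF \<gamma>0] by (simp add: \<delta>_def)
  have "continuous_map (top_of_set {-1..1}) (gspace (X1 n)) (\<lambda>s. \<delta> s n)"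
    using continuous_map_compose[OF \<delta>c A.continuous_map_proj] by (simp add: o_def)
  then have "openin (top_of_set {-1..1}) {s \<in> {-1..1}. \<delta> s n \<in> gparam (X1 n) e ` {0<..<1}}"
    using openin_continuous_map_preimage A.X.openin_edge_interval[OF e, of 0 1] by fastforce
  moreover define Q where "Q = {s \<in> {-1..1}. \<delta> s n \<in> gparam (X1 n) e ` {0<..<1}}"
  ultimately have "\<forall>x\<in>Q. \<exists>\<epsilon>>0. \<forall>s\<in>{-1..1}. dist s x < \<epsilon> \<longrightarrow> s \<in> Q"
    by (simp add: openin_euclidean_subtopology_iff)
  moreover have "0 \<in> Q" using \<delta>0 A.liftedD(3)[OF l t0'] t0 by (simp add: Q_def)
  ultimately obtain \<epsilon> where \<epsilon>: "\<epsilon> > 0" "\<And>s. s \<in> {-1..1} \<Longrightarrow> dist s 0 < \<epsilon> \<Longrightarrow> s \<in> Q" by blast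
  \<comment> \<open>Halving \<epsilon> keeps the closed interval around \<open>0\<close> inside
    \<open>Q\<close>.\<close>
  define c where "c = min (\<epsilon> / 2) 1"
  have c: "c > 0" "c \<le> 1" "c < \<epsilon>" using \<epsilon>(1) by (auto simp: c_def)
  have "\<exists>a. a \<in> {0<..<1} \<and> \<delta> s n = gparam (X1 n) e a" if "s \<in> {-c..c}" for s
  proof -
    have "s \<in> Q" using \<epsilon>(2)[of s] that c by auto
    then show ?thesis unfolding Q_def by blast
  qed
  then obtain \<alpha> where \<alpha>: "\<And>s. s \<in> {-c..c} \<Longrightarrow> \<alpha> s \<in> {0<..<1} \<and> \<delta> s n = gparam (X1 n) e (\<alpha> s)"
    by metis
  have c0: "0 \<in> {-c..c}" using c by simp
  have \<alpha>0: "\<alpha> 0 = t0"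
    using A.X.edge_inj(2)[OF e e, of t0 "\<alpha> 0"] \<alpha>[OF c0] t0 \<delta>0 A.liftedD(3)[OF l t0'] by simp
  have \<delta>cc: "continuous_map (top_of_set {-c..c}) A.Y \<delta>"
    using \<delta>c by (rule continuous_map_from_subtopology_mono) (use c in auto)
  have \<delta>\<gamma>: "\<delta> s = \<gamma> (\<alpha> s)" if s: "s \<in> {-c..c}" for s
  proof (rule A.lifted_path_unique[OF l _ \<delta>cc, where \<alpha> = \<alpha> and ?s0.0 = 0])
    show "connected_space (top_of_set {-c..c})" by (simp add: connected_space_subtopology)
  qed (use \<alpha> \<alpha>0 \<delta>0 c0 s in auto)
  have \<eta>\<gamma>: "\<eta> s = h (\<gamma> (\<alpha> s))" if s: "s \<in> {-c..c}" for s
  proof -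
    have "s \<in> {-1..1}" using s c by auto
    then have "h (\<delta> s) = \<eta> s" unfolding \<delta>_def by (rule homeomorphism(4)[OF \<eta>B])
    then show ?thesis using \<delta>\<gamma>[OF s] by simp
  qed
  have \<alpha>c: "continuous_on {-c..c} \<alpha>"
    using A.X.continuous_map_coordinate[OF e, of "top_of_set {-c..c}" "\<lambda>s. \<delta> s n" \<alpha>] \<alpha>
      continuous_map_compose[OF \<delta>cc A.continuous_map_proj] by (simp add: o_def)
  \<comment> \<open>Along the preimage curve, \<open>V\<close> and \<open>W \<circ> \<alpha>\<close>
    lift the same angle, so \<open>W \<circ> \<alpha>\<close> increases as \<open>V\<close> does.
    Hence \<alpha> never returns to a value, and being continuous it is strictly monotone.\<close>
  have shift: "W (\<alpha> s) < W (\<alpha> s')"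
    if W: "transported_lift k g {0..1} \<gamma> W" and s: "s \<in> {-c..c}" "s' \<in> {-c..c}" "s < s'" for k g W s s'
  proof -
    obtain V where V: "continuous_on {-1..1} V" "strict_mono_on {-1..1} V"
      "\<And>s. s \<in> {-1..1} \<Longrightarrow> V s - B.lim_angle k g (\<eta> s) \<in> \<int>"
      using \<eta>(3) W unfolding B.forward_def transported_lift_def by metis
    have cc: "{-c..c} \<subseteq> {-1..1}" using c by auto
    have "V s' - V s = W (\<alpha> s') - W (\<alpha> s)"
    proof (rule lift_difference_unique[where u = "\<lambda>s. B.lim_angle k g (\<eta> s)"])
      show "continuous_on {-c..c} V" using V(1) cc continuous_on_subset by blast
      show "continuous_on {-c..c} (\<lambda>s. W (\<alpha> s))"
        using W \<alpha> by (intro continuous_on_compose2[OF _ \<alpha>c, of "{0..1}" W]) (force simp: transported_lift_def)+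
      show "W (\<alpha> s) - B.lim_angle k g (\<eta> s) \<in> \<int>" if "s \<in> {-c..c}" for s
        using W \<alpha>[OF that] \<eta>\<gamma>[OF that] by (simp add: transported_lift_def)
    qed (use V(3) cc s in auto)
    moreover have "V s < V s'" using strict_mono_onD[OF V(2)] s cc by blast
    ultimately show ?thesis by simp
  qed
  obtain W0 where W0: "transported_lift 0 (\<lambda>_. 1) {0..1} \<gamma> W0" using transported_lift_exists[OF l] .
  have "inj_on \<alpha> {-c..c}"
  proof (rule inj_onI)
    fix s s' assume "s \<in> {-c..c}" "s' \<in> {-c..c}" "\<alpha> s = \<alpha> s'"
    then show "s = s'" using shift[OF W0, of s s'] shift[OF W0, of s' s] by (cases s s' rule: linorder_cases) auto
  qed
  then consider "strict_mono_on {-c..c} \<alpha>" | "strict_antimono_on {-c..c} \<alpha>"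
    using injective_eq_monotone_map[OF _ \<alpha>c] by (auto simp: is_interval_convex_1)
  then show ?thesis
  proof cases
    case 1
    have ends: "\<alpha> (-c) < t0" "t0 < \<alpha> c"
      using strict_mono_onD[OF 1, of "-c" 0] strict_mono_onD[OF 1, of 0 c] c \<alpha>0 by auto
    have "strict_mono_on {\<alpha> (-c)..\<alpha> c} (\<lambda>t. 1 * W t)" if W: "transported_lift k g {0..1} \<gamma> W" for k g W
    proof (rule strict_mono_onI)
      fix x y assume x: "x \<in> {\<alpha> (-c)..\<alpha> c}" and y: "y \<in> {\<alpha> (-c)..\<alpha> c}" and xy: "x < y"
      obtain s where s: "-c \<le> s" "s \<le> c" "\<alpha> s = x" using IVT'[of \<alpha> "-c" x c] x \<alpha>c c by auto
      obtain s' where s': "-c \<le> s'" "s' \<le> c" "\<alpha> s' = y" using IVT'[of \<alpha> "-c" y c] y \<alpha>c c by auto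
      have "s < s'" using strict_mono_on_leD[OF 1, of s' s] s s' xy by force
      then show "1 * W x < 1 * W y" using shift[OF W, of s s'] s s' by simp
    qed
    moreover have "{\<alpha> (-c)..\<alpha> c} \<subseteq> {0<..<1}" using \<alpha>[of c] \<alpha>[of "-c"] c by auto
    ultimately have "oriented_near 1 \<gamma> t0" unfolding oriented_near_def using ends by blast
    then show ?thesis ..
  next
    case 2
    then have anti: "\<alpha> s' < \<alpha> s" if "s \<in> {-c..c}" "s' \<in> {-c..c}" "s < s'" for s s'
      using that by (auto simp: monotone_on_def)
    have ends: "\<alpha> c < t0" "t0 < \<alpha> (-c)"
      using anti[of "-c" 0] anti[of 0 c] c \<alpha>0 by auto
    have "strict_mono_on {\<alpha> c..\<alpha> (-c)} (\<lambda>t. -1 * W t)" if W: "transported_lift k g {0..1} \<gamma> W" for k g W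
    proof (rule strict_mono_onI)
      fix x y assume x: "x \<in> {\<alpha> c..\<alpha> (-c)}" and y: "y \<in> {\<alpha> c..\<alpha> (-c)}" and xy: "x < y"
      obtain s where s: "-c \<le> s" "s \<le> c" "\<alpha> s = x" using IVT2'[of \<alpha> c x "-c"] x \<alpha>c c by auto
      obtain s' where s': "-c \<le> s'" "s' \<le> c" "\<alpha> s' = y" using IVT2'[of \<alpha> c y "-c"] y \<alpha>c c by auto
      have "s' < s" using anti[of s s'] s s' xy by (cases s s' rule: linorder_cases) auto
      then show "-1 * W x < -1 * W y" using shift[OF W, of s' s] s s' by simp
    qed
    moreover have "{\<alpha> c..\<alpha> (-c)} \<subseteq> {0<..<1}" using \<alpha>[of c] \<alpha>[of "-c"] c by auto
    ultimately have "oriented_near (-1) \<gamma> t0" unfolding oriented_near_def using ends by blast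
    then show ?thesis ..
  qed
qed

lemma oriented_nearE:
  assumes "oriented_near \<sigma> \<gamma> t"
  obtains a b where "a < t" "t < b" "{a..b} \<subseteq> {0<..<1}"
    "\<And>k g W. transported_lift k g {0..1} \<gamma> W \<Longrightarrow> strict_mono_on {a..b} (\<lambda>t. \<sigma> * W t)"
  using assms unfolding oriented_near_def by blast

lemma oriented_near_strict_mono:
  assumes "oriented_near \<sigma> \<gamma> t" "transported_lift k g {0..1} \<gamma> W"
  shows "\<exists>a b. a < t \<and> t < b \<and> strict_mono_on {a..b} (\<lambda>t. \<sigma> * W t)"
  using assms unfolding oriented_near_def by blast

lemma open_oriented_near: "open {t. oriented_near \<sigma> \<gamma> t}"
  unfolding open_subopen[of "{t. oriented_near \<sigma> \<gamma> t}"]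
proof
  fix t assume "t \<in> {t. oriented_near \<sigma> \<gamma> t}"
  then obtain a b where ab: "a < t" "t < b" "{a..b} \<subseteq> {0<..<1}"
    "\<And>k g W. transported_lift k g {0..1} \<gamma> W \<Longrightarrow> strict_mono_on {a..b} (\<lambda>t. \<sigma> * W t)"
    using oriented_nearE by blast
  have "oriented_near \<sigma> \<gamma> s" if s: "s \<in> {a<..<b}" for s
    unfolding oriented_near_def by (intro exI[of _ a] exI[of _ b]) (use s ab(3,4) in simp)
  then have "{a<..<b} \<subseteq> {t. oriented_near \<sigma> \<gamma> t}" by blast
  then show "\<exists>T. open T \<and> t \<in> T \<and> T \<subseteq> {t. oriented_near \<sigma> \<gamma> t}"
    using ab by (intro exI[of _ "{a<..<b}"]) auto
qed

text \<open>The parameters with the two signs form disjoint open sets that cover the connected open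
  interval, so one sign holds throughout. Local monotonicity with a constant sign is global, and it
  extends to the ends by continuity.\<close>

lemma lifted_oriented:
  assumes l: "A.lifted n e \<gamma>"
  obtains \<sigma> where "\<sigma> = 1 \<or> \<sigma> = -1" "oriented \<sigma> \<gamma>"
proof -
  obtain W0 where W0: "transported_lift 0 (\<lambda>_. 1) {0..1} \<gamma> W0" using transported_lift_exists[OF l] .
  have disj: "False" if on: "oriented_near 1 \<gamma> t" "oriented_near (-1) \<gamma> t" for t
  proof -
    obtain a b where ab: "a < t" "t < b" "strict_mono_on {a..b} (\<lambda>t. 1 * W0 t)"
      using oriented_near_strict_mono[OF on(1) W0] by blast
    obtain a' b' where ab': "a' < t" "t < b'" "strict_mono_on {a'..b'} (\<lambda>t. -1 * W0 t)"
      using oriented_near_strict_mono[OF on(2) W0] by blast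
    have "1 * W0 t < 1 * W0 (min b b')" by (rule strict_mono_onD[OF ab(3)]) (use ab ab' in auto)
    moreover have "-1 * W0 t < -1 * W0 (min b b')" by (rule strict_mono_onD[OF ab'(3)]) (use ab ab' in auto)
    ultimately show False by simp
  qed
  have "{t. oriented_near 1 \<gamma> t} \<inter> {0<..<1} = {} \<or> {t. oriented_near (-1) \<gamma> t} \<inter> {0<..<1} = {}"
  proof (rule connectedD[OF _ open_oriented_near open_oriented_near])
    show "connected {0<..<1::real}" by simp
    show "{t. oriented_near 1 \<gamma> t} \<inter> {t. oriented_near (-1) \<gamma> t} \<inter> {0<..<1} = {}" using disj by blast
    show "{0<..<1} \<subseteq> {t. oriented_near 1 \<gamma> t} \<union> {t. oriented_near (-1) \<gamma> t}"
      using lifted_oriented_near[OF l] by blast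
  qed
  then obtain \<sigma> where \<sigma>: "\<sigma> = 1 \<or> \<sigma> = -1" "\<And>t. t \<in> {0<..<1} \<Longrightarrow> oriented_near \<sigma> \<gamma> t"
    using lifted_oriented_near[OF l] by blast
  have "strict_mono_on {0..1} (\<lambda>t. \<sigma> * W t)" if W: "transported_lift k g {0..1} \<gamma> W" for k g W
  proof -
    have cont: "continuous_on {0..1} (\<lambda>t. \<sigma> * W t)"
      using W unfolding transported_lift_def by (intro continuous_intros) auto
    show ?thesis
    proof (rule strict_mono_on_closed_intervalI[OF cont], rule strict_mono_on_open_intervalI)
      show "continuous_on {0<..<1} (\<lambda>t. \<sigma> * W t)"
        by (rule continuous_on_subset[OF cont]) auto
      show "\<exists>a b. a < t \<and> t < b \<and> strict_mono_on {a..b} (\<lambda>t. \<sigma> * W t)" if "t \<in> {0<..<1}" for t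
        by (rule oriented_near_strict_mono[OF \<sigma>(2)[OF that] W])
    qed
  qed
  then have "oriented \<sigma> \<gamma>" unfolding oriented_def by blast
  then show ?thesis using that \<sigma>(1) by blast
qed

lemma oriented_unique:
  assumes l: "A.lifted n e \<gamma>" and "oriented \<sigma> \<gamma>" "oriented \<sigma>' \<gamma>" "\<sigma> = 1 \<or> \<sigma> = -1" "\<sigma>' = 1 \<or> \<sigma>' = -1"
  shows "\<sigma> = \<sigma>'"
proof -
  obtain W where W: "transported_lift 0 (\<lambda>_. 1) {0..1} \<gamma> W" using transported_lift_exists[OF l] .
  have "strict_mono_on {0..1} (\<lambda>t. \<sigma> * W t)" "strict_mono_on {0..1} (\<lambda>t. \<sigma>' * W t)"
    using assms(2,3) W unfolding oriented_def by blast+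
  then have "\<sigma> * W 0 < \<sigma> * W 1" "\<sigma>' * W 0 < \<sigma>' * W 1" by (auto dest: strict_mono_onD[of _ _ 0 1])
  then show ?thesis using assms(4,5) by auto
qed

lemma transported_lift_restrict:
  assumes W: "transported_lift k g {0..1} \<gamma> W" and \<psi>: "continuous_on {0..1} \<psi>" "\<psi> ` {0..1} \<subseteq> {0..1}"
    and eq: "\<And>t. t \<in> {0..1} \<Longrightarrow> \<gamma>' t = \<gamma> (\<psi> t)"
  shows "transported_lift k g {0..1} \<gamma>' (W \<circ> \<psi>)"
proof -
  have "continuous_on {0..1} (W \<circ> \<psi>)"
    using W \<psi> continuous_on_subset unfolding transported_lift_def by (intro continuous_on_compose) auto
  moreover have "(W \<circ> \<psi>) t - B.lim_angle k g (h (\<gamma>' t)) \<in> \<int>" if t: "t \<in> {0..1}" for t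
  proof -
    have "\<psi> t \<in> {0..1}" using \<psi>(2) t by blast
    then show ?thesis using W eq[OF t] unfolding transported_lift_def by simp
  qed
  ultimately show ?thesis using W unfolding transported_lift_def by blast
qed

text \<open>Rather than extending every lift along \<open>\<gamma>'\<close> to \<gamma>, the proof
  takes the sign that \<open>\<gamma>'\<close> has by \<open>lifted_oriented\<close> and identifies
  it with one test angle at the two ends.\<close>

lemma oriented_restrict:
  assumes l: "A.lifted N e \<gamma>" and l': "A.lifted n e' \<gamma>'" and or: "oriented \<sigma> \<gamma>" and \<sigma>: "\<sigma> = 1 \<or> \<sigma> = -1"
    and \<psi>: "continuous_on {0..1} \<psi>" "strict_mono_on {0..1} \<psi>" "\<psi> ` {0..1} \<subseteq> {0..1}"
    and eq: "\<And>t. t \<in> {0..1} \<Longrightarrow> \<gamma>' t = \<gamma> (\<psi> t)"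
  shows "oriented \<sigma> \<gamma>'"
proof -
  obtain \<sigma>' where \<sigma>': "\<sigma>' = 1 \<or> \<sigma>' = -1" "oriented \<sigma>' \<gamma>'" using lifted_oriented[OF l'] .
  obtain W where W: "transported_lift 0 (\<lambda>_. 1) {0..1} \<gamma> W" using transported_lift_exists[OF l] .
  have "transported_lift 0 (\<lambda>_. 1) {0..1} \<gamma>' (W \<circ> \<psi>)" by (rule transported_lift_restrict[OF W \<psi>(1,3) eq])
  then have "strict_mono_on {0..1} (\<lambda>t. \<sigma>' * (W \<circ> \<psi>) t)" using \<sigma>'(2) unfolding oriented_def by blast
  then have 1: "\<sigma>' * W (\<psi> 0) < \<sigma>' * W (\<psi> 1)" by (auto dest: strict_mono_onD[of _ _ 0 1])
  have mono: "strict_mono_on {0..1} (\<lambda>t. \<sigma> * W t)" using or W unfolding oriented_def by blast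
  have \<psi>01: "\<psi> 0 \<in> {0..1}" "\<psi> 1 \<in> {0..1}" using \<psi>(3) by (simp_all add: image_subset_iff)
  have "\<psi> 0 < \<psi> 1" using strict_mono_onD[OF \<psi>(2), of 0 1] by simp
  then have "\<sigma> * W (\<psi> 0) < \<sigma> * W (\<psi> 1)" by (rule strict_mono_onD[OF mono \<psi>01])
  with 1 have "\<sigma> = \<sigma>'" using \<sigma> \<sigma>'(1) by auto
  then show ?thesis using \<sigma>'(2) by simp
qed

section \<open>Increments of transported angles along lifted edges\<close>

definition increment :: "('e1 \<Rightarrow> int) \<Rightarrow> ((nat \<Rightarrow> 'v1) \<Rightarrow> real) \<Rightarrow> 'e1 \<Rightarrow> (real \<Rightarrow> nat \<Rightarrow> 'v1) \<Rightarrow> real" where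
  "increment g r e \<gamma> = of_int (g e) + r (\<gamma> 1) - r (\<gamma> 0)"

lemma represents_transported_lift:
  assumes "A.represents n g' r (\<lambda>x. B.lim_angle k g (h x))" "A.lifted n e \<gamma>" "B.positive k g"
  shows "transported_lift k g {0..1} \<gamma> (\<lambda>t. of_int (g' e) * t + r (\<gamma> t))"
  using A.represents_lift[OF assms(1,2)] assms(3) by (simp add: transported_lift_def)

lemma increment_oriented:
  assumes "A.represents n g' r (\<lambda>x. B.lim_angle k g (h x))" "A.lifted n e \<gamma>" "B.positive k g" "oriented \<sigma> \<gamma>"
  shows "0 < \<sigma> * increment g' r e \<gamma>"
proof -
  have "strict_mono_on {0..1} (\<lambda>t. \<sigma> * (of_int (g' e) * t + r (\<gamma> t)))"
    using represents_transported_lift[OF assms(1-3)] assms(4) unfolding oriented_def by blast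
  from strict_mono_onD[OF this, of 0 1] show ?thesis by (simp add: increment_def algebra_simps)
qed

text \<open>The lifts of an edge form a compact family on which the increment is continuous. It
  never vanishes, because every lift has an orientation, and the graph has finitely many
  edges.\<close>

lemma increment_bound:
  assumes rep: "A.represents n g' r (\<lambda>x. B.lim_angle k g (h x))" and pos: "B.positive k g"
  obtains c where "c > 0" "\<And>e \<gamma>. A.lifted n e \<gamma> \<Longrightarrow> c \<le> \<bar>increment g' r e \<gamma>\<bar>"
proof -
  have r: "continuous_map A.Y euclideanreal r" using rep by (simp add: A.represents_def)
  define K where "K e = (\<lambda>z. increment g' r e (A.lift_at n e z)) ` A.mid_fibre n e" for e
  have "compact (K e)" if e: "e \<in> gedges (X1 n)" for e
  proof -
    have "continuous_map (subtopology A.Y (A.mid_fibre n e)) euclideanreal (\<lambda>z. r (A.lift_at n e z u))"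
      if "u \<in> {0..1}" for u
      using continuous_map_compose[OF A.continuous_map_lift_at[OF e that] r] by (simp add: o_def)
    then have "continuous_map (subtopology A.Y (A.mid_fibre n e)) euclideanreal
        (\<lambda>z. increment g' r e (A.lift_at n e z))"
      unfolding increment_def by (intro continuous_intros) auto
    moreover have "compactin (subtopology A.Y (A.mid_fibre n e)) (A.mid_fibre n e)"
      using A.mid_fibre_closed(2)[OF e] by (simp add: compactin_subtopology)
    ultimately have "compactin euclideanreal (K e)" unfolding K_def using image_compactin by blast
    then show ?thesis by simp
  qed
  then have "compact (\<Union>e\<in>gedges (X1 n). K e)" using A.X.finite_edges by (intro compact_UN) auto
  then have "open (- (\<Union>e\<in>gedges (X1 n). K e))" using compact_imp_closed by blast
  moreover have "0 \<notin> K e" if e: "e \<in> gedges (X1 n)" for e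
  proof
    assume "0 \<in> K e"
    then obtain z where z: "z \<in> A.mid_fibre n e" "increment g' r e (A.lift_at n e z) = 0"
      unfolding K_def by (metis (no_types, lifting) imageE)
    note l = A.lift_at(1)[OF e z(1)]
    obtain \<sigma> where "oriented \<sigma> (A.lift_at n e z)" using lifted_oriented[OF l] by blast
    then show False using increment_oriented[OF rep l pos] z(2) by fastforce
  qed
  then have "0 \<in> - (\<Union>e\<in>gedges (X1 n). K e)" by blast
  ultimately obtain c where c: "c > 0" "ball 0 c \<subseteq> - (\<Union>e\<in>gedges (X1 n). K e)"
    using open_contains_ball by blast
  show ?thesis
  proof (rule that[OF c(1)])
    fix e \<gamma> assume l: "A.lifted n e \<gamma>"
    note eq = A.lifted_eq_lift_at[OF l]
    have "increment g' r e \<gamma> = increment g' r e (A.lift_at n e (\<gamma> (1/2)))"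
      using eq(2)[of 0] eq(2)[of 1] by (simp add: increment_def)
    then have "increment g' r e \<gamma> \<in> K e" unfolding K_def using eq(1) by (metis image_eqI)
    then have "increment g' r e \<gamma> \<notin> ball 0 c" using c(2) A.liftedD(1)[OF l] by blast
    then show "c \<le> \<bar>increment g' r e \<gamma>\<bar>" by simp
  qed
qed

text \<open>A lift of a deeper edge contains a lift of some edge of level \<open>n\<close>, which
  contributes at least \<open>c\<close>; by monotonicity the rest of the arc takes nothing away. So
  \<open>c\<close> can be fixed first and the level \<open>N\<close> afterwards, in terms of
  \<open>c\<close>.\<close>

lemma increment_bound_above:
  assumes rep: "A.represents n g' r (\<lambda>x. B.lim_angle k g (h x))" and pos: "B.positive k g"
    and c: "\<And>e \<gamma>. A.lifted n e \<gamma> \<Longrightarrow> c \<le> \<bar>increment g' r e \<gamma>\<bar>" and nN: "n \<le> N"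
    and rep': "A.represents N (A.pull n N g') r' (\<lambda>x. B.lim_angle k g (h x))"
    and l: "A.lifted N e \<gamma>" and or: "oriented \<sigma> \<gamma>" and \<sigma>: "\<sigma> = 1 \<or> \<sigma> = -1"
  shows "c \<le> \<sigma> * increment (A.pull n N g') r' e \<gamma>"
proof -
  obtain e' where e': "e' \<in> set (edge_path (X1 n) (bonding f1 n N \<circ> gparam (X1 N) e))"
    using graph_cover.edge_path_nonempty(1)[OF A.cover[OF nN] A.liftedD(1)[OF l]] by (meson ex_in_conv)
  obtain \<gamma>' \<psi> where \<gamma>': "A.lifted n e' \<gamma>'" "continuous_on {0..1} \<psi>" "strict_mono_on {0..1} \<psi>"
    "\<psi> ` {0..1} \<subseteq> {0..1}" "\<And>t. t \<in> {0..1} \<Longrightarrow> \<gamma>' t = \<gamma> (\<psi> t)"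
    using A.lifted_restrict[OF l nN e'] by blast
  define W where "W = (\<lambda>t. of_int (A.pull n N g' e) * t + r' (\<gamma> t))"
  have W: "transported_lift k g {0..1} \<gamma> W"
    unfolding W_def by (rule represents_transported_lift[OF rep' l pos])
  define W' where "W' = (\<lambda>t. of_int (g' e') * t + r (\<gamma>' t))"
  have W': "transported_lift k g {0..1} \<gamma>' W'"
    unfolding W'_def by (rule represents_transported_lift[OF rep \<gamma>'(1) pos])
  have "(W \<circ> \<psi>) 1 - (W \<circ> \<psi>) 0 = W' 1 - W' 0"
    using transported_lift_restrict[OF W \<gamma>'(2,4,5)] W'
    unfolding transported_lift_def by (intro lift_difference_unique[where u = "\<lambda>t. B.lim_angle k g (h (\<gamma>' t))"]) auto
  also have "\<dots> = increment g' r e' \<gamma>'" by (simp add: W'_def increment_def)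
  finally have inc: "W (\<psi> 1) - W (\<psi> 0) = increment g' r e' \<gamma>'" by simp
  have mono: "strict_mono_on {0..1} (\<lambda>t. \<sigma> * W t)" using or W unfolding oriented_def by blast
  have \<psi>01: "\<psi> 0 \<in> {0..1}" "\<psi> 1 \<in> {0..1}" using \<gamma>'(4) by (simp_all add: image_subset_iff)
  have "\<psi> 0 < \<psi> 1" using strict_mono_onD[OF \<gamma>'(3), of 0 1] by simp
  then have "\<sigma> * W (\<psi> 0) < \<sigma> * W (\<psi> 1)" using strict_mono_onD[OF mono \<psi>01] by blast
  then have "\<sigma> * increment g' r e' \<gamma>' > 0" unfolding inc[symmetric] by (simp add: algebra_simps)
  then have "c \<le> \<sigma> * W (\<psi> 1) - \<sigma> * W (\<psi> 0)"
    using c[OF \<gamma>'(1)] \<sigma> unfolding inc[symmetric] by (auto simp: algebra_simps)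
  moreover have "\<sigma> * W 0 \<le> \<sigma> * W (\<psi> 0)" "\<sigma> * W (\<psi> 1) \<le> \<sigma> * W 1"
    using strict_mono_on_leD[OF mono, of 0 "\<psi> 0"] strict_mono_on_leD[OF mono, of "\<psi> 1" 1] \<psi>01 by auto
  moreover have "\<sigma> * increment (A.pull n N g') r' e \<gamma> = \<sigma> * W 1 - \<sigma> * W 0"
    by (simp add: W_def increment_def algebra_simps)
  ultimately show ?thesis by linarith
qed

lemma represents_exists:
  obtains n g' r where "A.represents n g' r (\<lambda>x. B.lim_angle k g (h x))"
proof -
  have "continuous_map A.Y euclidean (\<lambda>x. cis (2 * pi * B.lim_angle k g (h x)))"
    using continuous_map_compose[OF homeomorphism(1) B.continuous_map_cis_lim_angle] by (simp add: o_def)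
  from A.lim_angle_onto[OF this]
  obtain n g' where "circle_equiv A.Y (\<lambda>x. B.lim_angle k g (h x)) (A.lim_angle n g')" by blast
  then show ?thesis using that unfolding circle_equiv_def A.represents_def by blast
qed

text \<open>
  By compactness the orientation of a lift of a deep edge depends only on the edge, and by simplicity
  every deeper edge runs over all edges of that level.
\<close>
lemma eventually_oriented:
  obtains \<sigma> N0 where "\<sigma> = 1 \<or> \<sigma> = -1" "\<And>N e \<gamma>. N0 \<le> N \<Longrightarrow> A.lifted N e \<gamma> \<Longrightarrow> oriented \<sigma> \<gamma>"
proof -
  have pos: "B.positive 0 (\<lambda>_. 1)" by (simp add: B.positive_def)
  obtain n g' r where rep: "A.represents n g' r (\<lambda>x. B.lim_angle 0 (\<lambda>_. 1) (h x))"
    using represents_exists .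
  obtain c where c: "c > 0" "\<And>e \<gamma>. A.lifted n e \<gamma> \<Longrightarrow> c \<le> \<bar>increment g' r e \<gamma>\<bar>"
    using increment_bound[OF rep pos] by blast
  have r: "continuous_map A.Y euclideanreal r" using rep by (simp add: A.represents_def)
  obtain m where m: "\<And>M x y. m \<le> M \<Longrightarrow> x \<in> topspace A.Y \<Longrightarrow> y \<in> topspace A.Y \<Longrightarrow> x M = y M \<Longrightarrow> norm (r x - r y) < c"
    using A.eventually_factors[OF r c(1)] by blast
  \<comment> \<open>The simplicity condition speaks of levels from \<open>1\<close> on.\<close>
  define N where "N = max (max n m) 1"
  have N: "n \<le> N" "m \<le> N" "1 \<le> N" by (auto simp: N_def)
  obtain r' where r': "A.represents N (A.pull n N g') r' (\<lambda>x. B.lim_angle 0 (\<lambda>_. 1) (h x))"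
    "\<And>x y. x \<in> topspace A.Y \<Longrightarrow> y \<in> topspace A.Y \<Longrightarrow> x N = y N \<Longrightarrow> r' x - r' y = r x - r y"
    using A.represents_pull[OF rep N(1)] by blast
  \<comment> \<open>The ends of the two lifts lie over the same points, so their increments differ
    by less than \<open>2 * c\<close>; increments of opposite signs would be at least
    \<open>2 * c\<close> apart.\<close>
  have same: "oriented \<sigma> \<gamma>'" if l: "A.lifted N e \<gamma>" "A.lifted N e \<gamma>'" and or: "oriented \<sigma> \<gamma>"
    and \<sigma>: "\<sigma> = 1 \<or> \<sigma> = -1" for e \<gamma> \<gamma>' \<sigma>
  proof -
    obtain \<sigma>' where \<sigma>': "\<sigma>' = 1 \<or> \<sigma>' = -1" "oriented \<sigma>' \<gamma>'" using lifted_oriented[OF l(2)] .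
    let ?i = "increment (A.pull n N g') r' e"
    have b: "c \<le> \<sigma> * ?i \<gamma>" "c \<le> \<sigma>' * ?i \<gamma>'"
      using increment_bound_above[OF rep pos c(2) N(1) r'(1) l(1) or \<sigma>]
        increment_bound_above[OF rep pos c(2) N(1) r'(1) l(2) \<sigma>'(2,1)] by simp_all
    have "\<bar>r' (\<gamma> u) - r' (\<gamma>' u)\<bar> < c" if u: "u \<in> {0..1}" for u
    proof -
      have eq: "\<gamma> u N = \<gamma>' u N" using A.liftedD(3)[OF l(1) u] A.liftedD(3)[OF l(2) u] by simp
      note Y = A.liftedD(2)[OF l(1) u] A.liftedD(2)[OF l(2) u]
      show ?thesis using m[OF N(2) Y eq] r'(2)[OF Y eq] by simp
    qed
    then have "\<bar>r' (\<gamma> 0) - r' (\<gamma>' 0)\<bar> < c" "\<bar>r' (\<gamma> 1) - r' (\<gamma>' 1)\<bar> < c" by auto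
    then have "\<bar>?i \<gamma> - ?i \<gamma>'\<bar> < 2 * c" unfolding increment_def by linarith
    then have "\<sigma> = \<sigma>'" using b \<sigma> \<sigma>'(1) c(1) by (elim disjE; simp; linarith)
    then show ?thesis using \<sigma>'(2) by simp
  qed
  obtain \<kappa> where \<kappa>: "N \<le> \<kappa>" "\<And>l e. \<kappa> \<le> l \<Longrightarrow> e \<in> gedges (X1 l) \<Longrightarrow>
      bonding f1 N l ` gparam (X1 l) e ` {0..1} = topspace (gspace (X1 N))"
    using simple_A N(3) unfolding simplicity_condition_def by metis
  show ?thesis
  proof (cases "gedges (X1 \<kappa>) = {}")
    \<comment> \<open>Without edges the graph and the limit are empty, and there are no lifts at
      all.\<close>
    case True
    have "topspace (gspace (X1 \<kappa>)) = {}"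
    proof -
      have "x \<notin> topspace (gspace (X1 \<kappa>))" for x
        by (metis A.X.topspace_edge_in True empty_iff)
      then show ?thesis by blast
    qed
    have none: "\<not> A.lifted M e \<gamma>" for M e \<gamma>
    proof
      assume "A.lifted M e \<gamma>"
      then have "\<gamma> 0 \<in> topspace A.Y" by (rule A.liftedD(2)) simp
      then show False using A.topspace_Y \<open>topspace (gspace (X1 \<kappa>)) = {}\<close> by blast
    qed
    show ?thesis by (rule that[of 1 0]) (use none in auto)
  next
    case False
    then obtain d where d: "d \<in> gedges (X1 \<kappa>)" by blast
    obtain \<delta> where \<delta>: "A.lifted \<kappa> d \<delta>" using A.lifted_edge_exists[OF d] .
    obtain \<sigma> where \<sigma>: "\<sigma> = 1 \<or> \<sigma> = -1" "oriented \<sigma> \<delta>" using lifted_oriented[OF \<delta>] .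
    have at_N: "oriented \<sigma> \<gamma>" if l: "A.lifted N e \<gamma>" for e \<gamma>
    proof -
      note e = A.liftedD(1)[OF l]
      have "gparam (X1 N) e (1/2) \<in> bonding f1 N \<kappa> ` gparam (X1 \<kappa>) d ` {0..1}"
        unfolding \<kappa>(2)[OF order_refl d] using A.X.edge_topspace[OF e] by simp
      then have "e \<in> set (edge_path (X1 N) (bonding f1 N \<kappa> \<circ> gparam (X1 \<kappa>) d))"
        by (rule graph_cover.edge_in_edge_path[OF A.cover[OF \<kappa>(1)] d e])
      then obtain \<gamma>' \<psi> where "A.lifted N e \<gamma>'" "continuous_on {0..1} \<psi>" "strict_mono_on {0..1} \<psi>"
        "\<psi> ` {0..1} \<subseteq> {0..1}" "\<And>t. t \<in> {0..1} \<Longrightarrow> \<gamma>' t = \<delta> (\<psi> t)"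
        using A.lifted_restrict[OF \<delta> \<kappa>(1)] by blast
      then have "A.lifted N e \<gamma>'" "oriented \<sigma> \<gamma>'"
        using oriented_restrict[OF \<delta> _ \<sigma>(2,1)] by blast+
      then show ?thesis using same l \<sigma>(1) by blast
    qed
    show ?thesis
    proof (rule that[OF \<sigma>(1), of N])
      fix M e \<gamma> assume M: "N \<le> M" and l: "A.lifted M e \<gamma>"
      obtain \<sigma>' where \<sigma>': "\<sigma>' = 1 \<or> \<sigma>' = -1" "oriented \<sigma>' \<gamma>" using lifted_oriented[OF l] .
      obtain e' where "e' \<in> set (edge_path (X1 N) (bonding f1 N M \<circ> gparam (X1 M) e))"
        using graph_cover.edge_path_nonempty(1)[OF A.cover[OF M] A.liftedD(1)[OF l]] by (meson ex_in_conv)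
      then obtain \<gamma>' \<psi> where \<gamma>': "A.lifted N e' \<gamma>'" "continuous_on {0..1} \<psi>" "strict_mono_on {0..1} \<psi>"
        "\<psi> ` {0..1} \<subseteq> {0..1}" "\<And>t. t \<in> {0..1} \<Longrightarrow> \<gamma>' t = \<gamma> (\<psi> t)"
        using A.lifted_restrict[OF l M] by blast
      then have "oriented \<sigma>' \<gamma>'" using oriented_restrict[OF l \<gamma>'(1) \<sigma>'(2,1)] by blast
      then have "\<sigma> = \<sigma>'" using oriented_unique[OF \<gamma>'(1) at_N[OF \<gamma>'(1)]] \<sigma>(1) \<sigma>'(1) by blast
      then show "oriented \<sigma> \<gamma>" using \<sigma>'(2) by simp
    qed
  qed
qed

text \<open>
  The increments of an oriented representative are at least \<open>c\<close>, so its values on vertices, rounded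
  down, correct the cocycle to an integral one that is greater than \<open>-1\<close>.
\<close>
lemma positive_transfer:
  assumes \<sigma>: "(s::int) = 1 \<or> s = -1" and or: "\<And>N e \<gamma>. N0 \<le> N \<Longrightarrow> A.lifted N e \<gamma> \<Longrightarrow> oriented (of_int s) \<gamma>"
    and pos: "B.positive k g"
  obtains N q where "\<And>e. e \<in> gedges (X1 N) \<Longrightarrow> 0 \<le> q e"
    "circle_equiv A.Y (\<lambda>x. of_int s * B.lim_angle k g (h x)) (A.lim_angle N q)"
proof -
  obtain n0 g0 r0 where rep0: "A.represents n0 g0 r0 (\<lambda>x. B.lim_angle k g (h x))"
    using represents_exists .
  define n where "n = max n0 N0"
  have n: "n0 \<le> n" "N0 \<le> n" by (auto simp: n_def)
  define g' where "g' = A.pull n0 n g0"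
  obtain r where rep: "A.represents n g' r (\<lambda>x. B.lim_angle k g (h x))"
    using A.represents_pull[OF rep0 n(1)] unfolding g'_def by blast
  obtain c where c: "c > 0" "\<And>e \<gamma>. A.lifted n e \<gamma> \<Longrightarrow> c \<le> \<bar>increment g' r e \<gamma>\<bar>"
    using increment_bound[OF rep pos] by blast
  have r: "continuous_map A.Y euclideanreal r" using rep by (simp add: A.represents_def)
  \<comment> \<open>With \<open>c / 2\<close> the errors at the two ends of an edge add up to less
    than \<open>c\<close>, so the difference with the potential \<rho> remains positive.\<close>
  obtain m where m: "\<And>M x y. m \<le> M \<Longrightarrow> x \<in> topspace A.Y \<Longrightarrow> y \<in> topspace A.Y \<Longrightarrow> x M = y M \<Longrightarrow> norm (r x - r y) < c / 2"
    using A.eventually_factors[OF r, of "c / 2"] c(1) by auto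
  define N where "N = max n m"
  have N: "n \<le> N" "m \<le> N" "N0 \<le> N" using n by (auto simp: N_def)
  define gN where "gN = A.pull n N g'"
  obtain r' where r': "A.represents N gN r' (\<lambda>x. B.lim_angle k g (h x))"
    "\<And>x y. x \<in> topspace A.Y \<Longrightarrow> y \<in> topspace A.Y \<Longrightarrow> x N = y N \<Longrightarrow> r' x - r' y = r x - r y"
    using A.represents_pull[OF rep N(1)] unfolding gN_def by blast
  have "\<exists>x. x \<in> topspace A.Y \<and> x N = v" if "v \<in> gverts (X1 N)" for v
    using A.proj_onto A.X.verts_topspace[OF that] by metis
  then obtain p where p: "\<And>v. v \<in> gverts (X1 N) \<Longrightarrow> p v \<in> topspace A.Y \<and> p v N = v" by metis
  define \<rho> where "\<rho> v = of_int s * r' (p v)" for v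
  define q where "q e = s * gN e + (\<lfloor>\<rho> (gparam (X1 N) e 1)\<rfloor> - \<lfloor>\<rho> (gparam (X1 N) e 0)\<rfloor>)" for e
  have "0 \<le> q e" if e: "e \<in> gedges (X1 N)" for e
  proof -
    obtain \<gamma> where l: "A.lifted N e \<gamma>" using A.lifted_edge_exists[OF e] .
    have "c \<le> of_int s * increment gN r' e \<gamma>"
      using increment_bound_above[OF rep pos c(2) N(1) r'(1)[unfolded gN_def] l or[OF N(3) l]] \<sigma> unfolding gN_def by auto
    moreover have "\<bar>r' (\<gamma> u) - r' (p (gparam (X1 N) e u))\<bar> < c / 2" if u: "u = 0 \<or> u = 1" for u
    proof -
      have u01: "u \<in> {0..1}" and v: "gparam (X1 N) e u \<in> gverts (X1 N)"
        using u A.X.edge_0[OF e] A.X.edge_1[OF e] by auto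
      have eq: "\<gamma> u N = p (gparam (X1 N) e u) N" using A.liftedD(3)[OF l u01] p[OF v] by simp
      show ?thesis
        using m[OF N(2) A.liftedD(2)[OF l u01] conjunct1[OF p[OF v]] eq]
          r'(2)[OF A.liftedD(2)[OF l u01] conjunct1[OF p[OF v]] eq] by simp
    qed
    from this[of 0] this[of 1]
    have "\<bar>r' (\<gamma> 0) - r' (p (gparam (X1 N) e 0))\<bar> < c / 2" "\<bar>r' (\<gamma> 1) - r' (p (gparam (X1 N) e 1))\<bar> < c / 2" by auto
    ultimately have "0 < of_int (s * gN e) + \<rho> (gparam (X1 N) e 1) - \<rho> (gparam (X1 N) e 0)"
      using \<sigma> unfolding increment_def \<rho>_def by (elim disjE; simp; linarith)
    \<comment> \<open>Rounding down lowers the value at the terminal vertex by less than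
      \<open>1\<close>, and at the initial vertex it can only help. An integer above
      \<open>-1\<close> is nonnegative.\<close>
    then have "-1 < of_int (q e) - (0::real)"
      unfolding q_def of_int_add of_int_diff
      using of_int_floor_le[of "\<rho> (gparam (X1 N) e 0)"] real_of_int_floor_gt_diff_one[of "\<rho> (gparam (X1 N) e 1)"]
      by linarith
    then show ?thesis by simp
  qed
  moreover have "circle_equiv A.Y (\<lambda>x. of_int s * B.lim_angle k g (h x)) (A.lim_angle N q)"
  proof -
    define b where "b e = \<lfloor>\<rho> (gparam (X1 N) e 1)\<rfloor> - \<lfloor>\<rho> (gparam (X1 N) e 0)\<rfloor>" for e
    obtain w where w: "continuous_map (gspace (X1 N)) euclideanreal w"
      "\<And>x. x \<in> topspace (gspace (X1 N)) \<Longrightarrow> angle (X1 N) b x - w x \<in> \<int>"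
      using A.X.angle_coboundary[of N b "\<lambda>v. \<lfloor>\<rho> v\<rfloor>"] unfolding b_def by blast
    have wc: "continuous_map A.Y euclideanreal (\<lambda>x. w (x N))"
      by (rule A.continuous_map_of_proj[OF w(1)])
    have rc: "continuous_map A.Y euclideanreal r'" using r'(1) by (simp add: A.represents_def)
    have "continuous_map A.Y euclideanreal (\<lambda>x. of_int s * r' x - w (x N))"
      by (intro continuous_intros wc rc)
    moreover have "of_int s * B.lim_angle k g (h x) - A.lim_angle N q x - (of_int s * r' x - w (x N)) \<in> \<int>"
      if x: "x \<in> topspace A.Y" for x
    proof -
      have xN: "x N \<in> topspace (gspace (X1 N))" using x A.topspace_Y by blast
      have q: "A.lim_angle N q x = of_int s * A.lim_angle N gN x + of_int 1 * angle (X1 N) b (x N)"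
        unfolding A.lim_angle_def by (rule A.X.angle_add[OF xN]) (simp add: q_def b_def)
      have "B.lim_angle k g (h x) - A.lim_angle N gN x - r' x \<in> \<int>"
        using r'(1) x unfolding A.represents_def by blast
      then have "of_int s * (B.lim_angle k g (h x) - A.lim_angle N gN x - r' x) \<in> \<int>"
        by (intro Ints_mult Ints_of_int)
      from Ints_diff[OF this w(2)[OF xN]] show ?thesis unfolding q by (simp add: algebra_simps)
    qed
    ultimately show ?thesis unfolding circle_equiv_def by blast
  qed
  ultimately show ?thesis using that by blast
qed

end

section \<open>From nonnegative to strictly positive functions, and the transfer of cones\<close>

lemma (in graph_tower) pull_nonneg:
  assumes g: "\<forall>e\<in>gedges (X k). 0 \<le> g e" and km: "k \<le> m" and e: "e \<in> gedges (X m)"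
  shows "0 \<le> pull k m g e"
    and "e' \<in> set (edge_path (X k) (bonding f k m \<circ> gparam (X m) e)) \<Longrightarrow> g e' \<le> pull k m g e"
proof -
  let ?es = "edge_path (X k) (bonding f k m \<circ> gparam (X m) e)"
  have pull: "pull k m g e = sum_list (map g ?es)"
    unfolding pull_def by (rule graph_cover.pullback_eq[OF cover[OF km] e])
  have nn: "\<And>x. x \<in> set (map g ?es) \<Longrightarrow> 0 \<le> x"
    using graph_cover.edge_path_nonempty(2)[OF cover[OF km] e] g by auto
  show "0 \<le> pull k m g e" unfolding pull using nn by (rule sum_list_nonneg)
  assume "e' \<in> set ?es"
  then have "g e' \<in> set (map g ?es)" by simp
  then show "g e' \<le> pull k m g e" unfolding pull using nn member_le_sum_list by blast
qed

text \<open>The image of a deep edge is the whole graph, so its edge path contains \<open>e0\<close>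
  and its pullback value is at least \<open>g e0\<close>.\<close>

lemma (in graph_tower) simplicity_positive:
  assumes simple: "simplicity_condition X f" and g: "\<forall>e\<in>gedges (X k). 0 \<le> g e"
    and e0: "e0 \<in> gedges (X k)" "g e0 \<noteq> 0"
  obtains m where "k \<le> m" "positive m (pull k m g)"
proof -
  \<comment> \<open>The detour through level \<open>Suc k\<close> covers the case
    \<open>k = 0\<close>, to which the simplicity condition does not apply directly.\<close>
  obtain \<kappa> where \<kappa>: "Suc k \<le> \<kappa>" "\<And>l e. \<kappa> \<le> l \<Longrightarrow> e \<in> gedges (X l) \<Longrightarrow>
      bonding f (Suc k) l ` gparam (X l) e ` {0..1} = topspace (gspace (X (Suc k)))"
    using simple unfolding simplicity_condition_def by (metis le_add1 plus_1_eq_Suc)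
  have k: "k \<le> \<kappa>" using \<kappa>(1) by simp
  have "0 < pull k \<kappa> g e" if e: "e \<in> gedges (X \<kappa>)" for e
  proof -
    have "bonding f k \<kappa> ` gparam (X \<kappa>) e ` {0..1} = bonding f k (Suc k) ` topspace (gspace (X (Suc k)))"
      unfolding \<kappa>(2)[OF order_refl e, symmetric] bonding_compose[OF le_SucI[OF order_refl] \<kappa>(1)]
      by (simp add: image_comp o_assoc)
    also have "\<dots> = topspace (gspace (X k))" by (rule graph_cover.onto[OF cover]) simp
    finally have "gparam (X k) e0 (1/2) \<in> bonding f k \<kappa> ` gparam (X \<kappa>) e ` {0..1}"
      using X.edge_topspace[OF e0(1)] by simp
    then have "e0 \<in> set (edge_path (X k) (bonding f k \<kappa> \<circ> gparam (X \<kappa>) e))"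
      by (rule graph_cover.edge_in_edge_path[OF cover[OF k] e e0(1)])
    then have "g e0 \<le> pull k \<kappa> g e" by (rule pull_nonneg(2)[OF g k e])
    moreover have "0 < g e0" using bspec[OF g e0(1)] e0(2) by simp
    ultimately show ?thesis by simp
  qed
  then show ?thesis using that k unfolding positive_def by blast
qed

text \<open>The sign is chosen before \<open>k\<close> and \<open>g\<close>: it comes from the
  lifted edges alone. Only because of this can a single isomorphism absorb it.\<close>

theorem (in tower_homeo) cone_transfer:
  obtains s :: int where "s = 1 \<or> s = -1"
    "\<And>k g. \<forall>e\<in>gedges (X2 k). 0 \<le> g e \<Longrightarrow> \<exists>N q. (\<forall>e\<in>gedges (X1 N). 0 \<le> q e) \<and>
       circle_equiv A.Y (\<lambda>x. of_int s * B.lim_angle k g (h x)) (A.lim_angle N q)"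
proof -
  obtain \<sigma> N0 where \<sigma>: "\<sigma> = 1 \<or> \<sigma> = -1" "\<And>N e \<gamma>. N0 \<le> N \<Longrightarrow> A.lifted N e \<gamma> \<Longrightarrow> oriented \<sigma> \<gamma>"
    using eventually_oriented by blast
  define s :: int where "s = (if \<sigma> = 1 then 1 else -1)"
  have s: "s = 1 \<or> s = -1" "of_int s = \<sigma>" using \<sigma>(1) by (auto simp: s_def)
  show ?thesis
  proof (rule that[OF s(1)])
    fix k and g :: "'e2 \<Rightarrow> int" assume g: "\<forall>e\<in>gedges (X2 k). 0 \<le> g e"
    show "\<exists>N q. (\<forall>e\<in>gedges (X1 N). 0 \<le> q e) \<and>
       circle_equiv A.Y (\<lambda>x. of_int s * B.lim_angle k g (h x)) (A.lim_angle N q)"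
    proof (cases "\<exists>e0\<in>gedges (X2 k). g e0 \<noteq> 0")
      case True
      then obtain e0 where e0: "e0 \<in> gedges (X2 k)" "g e0 \<noteq> 0" by blast
      obtain m where m: "k \<le> m" "B.positive m (B.pull k m g)"
        using B.simplicity_positive[OF simple_B g e0] by blast
      obtain N q where q: "\<And>e. e \<in> gedges (X1 N) \<Longrightarrow> 0 \<le> q e"
        "circle_equiv A.Y (\<lambda>x. of_int s * B.lim_angle m (B.pull k m g) (h x)) (A.lim_angle N q)"
        using positive_transfer[OF s(1) _ m(2), of N0] \<sigma>(2) s(2) by auto
      have "circle_equiv A.Y (B.lim_angle k g \<circ> h) (B.lim_angle m (B.pull k m g) \<circ> h)"
        by (rule circle_equiv_compose[OF B.circle_equiv_pull[OF m(1)] homeomorphism(1)])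
      from circle_equiv_linear[OF this this, of s 0]
      have "circle_equiv A.Y (\<lambda>x. of_int s * B.lim_angle k g (h x)) (\<lambda>x. of_int s * B.lim_angle m (B.pull k m g) (h x))"
        by simp
      from circle_equiv_trans[OF this q(2)] show ?thesis using q(1) by blast
    next
      \<comment> \<open>The zero class never becomes strictly positive, but its angle vanishes
        identically.\<close>
      case False
      have "B.lim_angle k g (h x) = 0" if "x \<in> topspace A.Y" for x
        using B.X.angle_add[of "h x k" k g 0 g 0 g] homeomorphism(5)[OF that] B.topspace_Y False by (simp add: B.lim_angle_def)
      moreover have "A.lim_angle 0 (\<lambda>_. 0) x = 0" if "x \<in> topspace A.Y" for x
        using A.X.angle_add[of "x 0" 0 "\<lambda>_. 0" 0 "\<lambda>_. 0" 0 "\<lambda>_. 0"] that A.topspace_Y by (simp add: A.lim_angle_def)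
      ultimately have "circle_equiv A.Y (\<lambda>x. of_int s * B.lim_angle k g (h x)) (A.lim_angle 0 (\<lambda>_. 0))"
        by (intro circle_equiv_cong[OF circle_equiv_refl[of A.Y "\<lambda>_. 0"]]) auto
      then show ?thesis by (intro exI[of _ 0] exI[of _ "\<lambda>_. 0"]) simp
    qed
  qed
qed

section \<open>Graph groups\<close>

context fin_digraph
begin

lemma carrier_edge_functions: "carrier (edge_functions G) = (\<Pi>\<^sub>E e\<in>gedges G. UNIV)"
  by (simp add: edge_functions_def)

lemma mult_edge_functions: "a \<otimes>\<^bsub>edge_functions G\<^esub> b = (\<lambda>e\<in>gedges G. a e + b e)"
  by (simp add: edge_functions_def)

lemma comm_group_edge_functions: "comm_group (edge_functions G)"
proof (rule group.group_comm_groupI)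
  show "group (edge_functions G)" by (simp add: edge_functions_def)
qed (simp add: mult_edge_functions add.commute)

sublocale EF: comm_group "edge_functions G"
  by (rule comm_group_edge_functions)

lemma inv_edge_functions:
  assumes "a \<in> carrier (edge_functions G)"
  shows "inv\<^bsub>edge_functions G\<^esub> a = (\<lambda>e\<in>gedges G. - a e)"
  using assms by (simp add: edge_functions_def)

definition coboundary :: "('v \<Rightarrow> int) \<Rightarrow> 'e \<Rightarrow> int" where
  "coboundary \<rho> = (\<lambda>e\<in>gedges G. \<rho> (gparam G e 1) - \<rho> (gparam G e 0))"

text \<open>The minus sign arises because a vertex function is \<open>1\<close> on outgoing edges,
  whereas a coboundary is the value at the end minus the value at the start. A loop gets
  \<open>0\<close> in both descriptions.\<close>

lemma vertex_function_coboundary: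
  "vertex_function G v = coboundary (\<lambda>w. if w = v then -1 else 0)"
  by (auto simp: vertex_function_def coboundary_def fun_eq_iff restrict_def)

lemma vertex_functions_carrier: "vertex_function G ` gverts G \<subseteq> carrier (edge_functions G)"
  by (auto simp: carrier_edge_functions vertex_function_def)

lemma subgroup_vertex_subgroup: "subgroup (vertex_subgroup G) (edge_functions G)"
  unfolding vertex_subgroup_def by (rule EF.generate_is_subgroup[OF vertex_functions_carrier])

lemma coboundary_carrier: "coboundary \<rho> \<in> carrier (edge_functions G)"
  by (auto simp: carrier_edge_functions coboundary_def)

lemma coboundary_add: "coboundary (\<lambda>v. \<rho> v + \<rho>' v) = coboundary \<rho> \<otimes>\<^bsub>edge_functions G\<^esub> coboundary \<rho>'"
  by (auto simp: mult_edge_functions coboundary_def fun_eq_iff restrict_def)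

lemma coboundary_minus: "coboundary (\<lambda>v. - \<rho> v) = inv\<^bsub>edge_functions G\<^esub> coboundary \<rho>"
  unfolding inv_edge_functions[OF coboundary_carrier]
  by (auto simp: coboundary_def fun_eq_iff restrict_def)

text \<open>There are finitely many vertices, so every potential is an integer combination of
  indicators of vertices. This replaces the generated subgroup by a closed description.\<close>

lemma vertex_subgroup_eq: "vertex_subgroup G = range coboundary"
proof
  show "vertex_subgroup G \<subseteq> range coboundary"
  proof
    fix a assume "a \<in> vertex_subgroup G"
    then show "a \<in> range coboundary"
      unfolding vertex_subgroup_def
    proof (induction rule: generate.induct)
      case one
      have "\<one>\<^bsub>edge_functions G\<^esub> = coboundary (\<lambda>_. 0)"
        by (auto simp: edge_functions_def coboundary_def)
      then show ?case by simp
    next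
      case (incl a)
      then show ?case using vertex_function_coboundary by auto
    next
      case (inv a)
      then obtain v where "a = vertex_function G v" by blast
      then have "inv\<^bsub>edge_functions G\<^esub> a = coboundary (\<lambda>w. - (if w = v then -1 else 0))"
        unfolding vertex_function_coboundary by (simp only: coboundary_minus)
      then show ?case by blast
    next
      case (eng a b)
      then obtain \<rho> \<rho>' where "a = coboundary \<rho>" "b = coboundary \<rho>'" by blast
      then have "a \<otimes>\<^bsub>edge_functions G\<^esub> b = coboundary (\<lambda>w. \<rho> w + \<rho>' w)" by (simp only: coboundary_add)
      then show ?case by blast
    qed
  qed
  note sg = subgroup_vertex_subgroup
  have single: "coboundary (\<lambda>w. if w = v then n else 0) \<in> vertex_subgroup G" if v: "v \<in> gverts G" for v n
  proof -
    have m1: "coboundary (\<lambda>w. if w = v then -1 else 0) \<in> vertex_subgroup G"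
      unfolding vertex_function_coboundary[symmetric] vertex_subgroup_def
      by (rule generate.incl) (use v in blast)
    have nat: "coboundary (\<lambda>w. if w = v then - int k else 0) \<in> vertex_subgroup G" for k
    proof (induction k)
      case 0
      have "coboundary (\<lambda>w. if w = v then - int 0 else 0) = \<one>\<^bsub>edge_functions G\<^esub>"
        by (auto simp: edge_functions_def coboundary_def)
      then show ?case using subgroup.one_closed[OF sg] by simp
    next
      case (Suc k)
      have "(\<lambda>w. if w = v then - int (Suc k) else 0) =
          (\<lambda>w. (if w = v then - int k else 0) + (if w = v then -1 else 0))" by auto
      then show ?case using coboundary_add subgroup.m_closed[OF sg Suc m1] by simp
    qed
    show ?thesis
    proof (cases "n \<le> 0")
      case True
      then have "n = - int (nat (- n))" by simp
      then show ?thesis using nat by metis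
    next
      case False
      then have "(\<lambda>w. if w = v then n else 0) = (\<lambda>w. - (if w = v then - int (nat n) else 0))" by auto
      then show ?thesis using coboundary_minus subgroup.m_inv_closed[OF sg nat] by simp
    qed
  qed
  have supp: "coboundary (\<lambda>w. if w \<in> S then \<rho> w else 0) \<in> vertex_subgroup G"
    if "finite S" "S \<subseteq> gverts G" for S \<rho>
    using that
  proof (induction S rule: finite_induct)
    case empty
    have "coboundary (\<lambda>w. if w \<in> {} then \<rho> w else 0) = \<one>\<^bsub>edge_functions G\<^esub>"
      by (auto simp: edge_functions_def coboundary_def)
    then show ?case using subgroup.one_closed[OF sg] by simp
  next
    case (insert v S)
    have "(\<lambda>w. if w \<in> insert v S then \<rho> w else 0) =
        (\<lambda>w. (if w = v then \<rho> v else 0) + (if w \<in> S then \<rho> w else 0))" using insert(2) by auto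
    then show ?case using coboundary_add insert single[of v "\<rho> v"] subgroup.m_closed[OF sg] by simp
  qed
  show "range coboundary \<subseteq> vertex_subgroup G"
  proof
    fix a assume "a \<in> range coboundary"
    then obtain \<rho> where a: "a = coboundary \<rho>" by blast
    \<comment> \<open>Edges end in vertices, so the potential can be cut down to the finite set of
      vertices.\<close>
    have "coboundary \<rho> = coboundary (\<lambda>w. if w \<in> gverts G then \<rho> w else 0)"
      using edge_0 edge_1 by (auto simp: coboundary_def)
    then show "a \<in> vertex_subgroup G" using supp[OF finite_verts] a by simp
  qed
qed

lemma graph_class_eq_iff:
  assumes a: "a \<in> carrier (edge_functions G)" and b: "b \<in> carrier (edge_functions G)"
  shows "graph_class G a = graph_class G b \<longleftrightarrow>
    (\<exists>\<rho>. \<forall>e\<in>gedges G. a e - b e = \<rho> (gparam G e 1) - \<rho> (gparam G e 0))"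
proof -
  note sg = subgroup_vertex_subgroup
  have "graph_class G a = graph_class G b \<longleftrightarrow> a \<in> graph_class G b"
    unfolding graph_class_def using EF.repr_independence[OF _ b sg] EF.rcos_self[OF a sg] by metis
  also have "\<dots> \<longleftrightarrow> (\<exists>\<rho>. a = coboundary \<rho> \<otimes>\<^bsub>edge_functions G\<^esub> b)"
    unfolding graph_class_def r_coset_def vertex_subgroup_eq by auto
  also have "\<dots> \<longleftrightarrow> (\<exists>\<rho>. \<forall>e\<in>gedges G. a e - b e = \<rho> (gparam G e 1) - \<rho> (gparam G e 0))"
  proof (intro ex_cong1)
    fix \<rho>
    have "a = coboundary \<rho> \<otimes>\<^bsub>edge_functions G\<^esub> b \<longleftrightarrow>
        (\<forall>e\<in>gedges G. a e = \<rho> (gparam G e 1) - \<rho> (gparam G e 0) + b e)"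
      using a by (auto simp: mult_edge_functions coboundary_def carrier_edge_functions fun_eq_iff PiE_def extensional_def)
    then show "a = coboundary \<rho> \<otimes>\<^bsub>edge_functions G\<^esub> b \<longleftrightarrow>
        (\<forall>e\<in>gedges G. a e - b e = \<rho> (gparam G e 1) - \<rho> (gparam G e 0))" by force
  qed
  finally show ?thesis .
qed

lemma carrier_graph_group: "carrier (graph_group G) = graph_class G ` carrier (edge_functions G)"
  by (auto simp: graph_group_def FactGroup_def RCOSETS_def graph_class_def)

lemma mult_graph_group:
  assumes "a \<in> carrier (edge_functions G)" "b \<in> carrier (edge_functions G)"
  shows "graph_class G a \<otimes>\<^bsub>graph_group G\<^esub> graph_class G b = graph_class G (a \<otimes>\<^bsub>edge_functions G\<^esub> b)"
proof -
  have "vertex_subgroup G \<lhd> edge_functions G"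
    using EF.normal_iff_subgroup subgroup_vertex_subgroup by blast
  from normal.rcos_sum[OF this assms] show ?thesis
    by (simp add: graph_group_def FactGroup_def graph_class_def)
qed

end

lemma (in graph_cover) pullback_carrier: "pullback G H F g \<in> carrier (edge_functions H)"
  by (auto simp: H.carrier_edge_functions pullback_def)

text \<open>The differences of \<rho> telescope along the edge path of \<open>d\<close>.\<close>

lemma (in graph_cover) pullback_coboundary:
  assumes g: "\<forall>e\<in>gedges G. a e - b e = \<rho> (gparam G e 1) - \<rho> (gparam G e 0)" and d: "d \<in> gedges H"
  shows "pullback G H F a d - pullback G H F b d = \<rho> (F (gparam H d 1)) - \<rho> (F (gparam H d 0))"
proof -
  define p where "p = F \<circ> gparam H d"
  define es where "es = edge_path G p"
  obtain \<tau> \<phi> where trav: "traversal G p es \<tau> \<phi>"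
    using traverses_edge[OF d] traverses_traversal unfolding es_def p_def by metis
  have "m \<le> length es \<Longrightarrow> (\<Sum>e\<leftarrow>take m es. a e) - (\<Sum>e\<leftarrow>take m es. b e) = \<rho> (p (\<tau> m)) - \<rho> (p (\<tau> 0))" for m
  proof (induction m)
    case (Suc m)
    then have m: "m < length es" by simp
    note st = traversal_step[OF trav m]
    have "p (\<tau> m) = gparam G (es ! m) 0" "p (\<tau> (Suc m)) = gparam G (es ! m) 1"
      using st(8)[of "\<tau> m"] st(8)[of "\<tau> (Suc m)"] st(2,6,7) by auto
    then have "a (es ! m) - b (es ! m) = \<rho> (p (\<tau> (Suc m))) - \<rho> (p (\<tau> m))"
      using g st(1) by simp
    then show ?case using Suc m by (simp add: take_Suc_conv_app_nth)
  qed simp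
  from this[of "length es"] have "(\<Sum>e\<leftarrow>es. a e) - (\<Sum>e\<leftarrow>es. b e) = \<rho> (p 1) - \<rho> (p 0)"
    using traversal_ends[OF trav] by simp
  then show ?thesis unfolding pullback_eq[OF d] by (simp add: es_def p_def)
qed

text \<open>Since coboundaries are pulled back to coboundaries, all representatives yield one class,
  and \<open>the_elem\<close> in \<open>graph_group_map\<close> is applied to a singleton.\<close>

lemma (in graph_cover) graph_group_map_class:
  assumes a: "a \<in> carrier (edge_functions G)"
  shows "graph_group_map G H F (graph_class G a) = graph_class H (pullback G H F a)"
proof -
  note sg = G.subgroup_vertex_subgroup
  have "graph_class H (pullback G H F b) = graph_class H (pullback G H F a)" if b: "b \<in> graph_class G a" for b
  proof -
    have bc: "b \<in> carrier (edge_functions G)"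
      using b G.EF.r_coset_subset_G[OF subgroup.subset[OF sg] a] unfolding graph_class_def by blast
    have "graph_class G b = graph_class G a"
      using b G.EF.repr_independence[OF _ a sg] unfolding graph_class_def by blast
    then obtain \<rho> where "\<forall>e\<in>gedges G. b e - a e = \<rho> (gparam G e 1) - \<rho> (gparam G e 0)"
      using G.graph_class_eq_iff[OF bc a] by blast
    from pullback_coboundary[OF this] show ?thesis
      using H.graph_class_eq_iff[OF pullback_carrier pullback_carrier] by (intro iffD2[OF H.graph_class_eq_iff[OF pullback_carrier pullback_carrier]] exI[of _ "\<rho> \<circ> F"]) simp
  qed
  moreover have "a \<in> graph_class G a" unfolding graph_class_def by (rule G.EF.rcos_self[OF a sg])
  ultimately have "(\<lambda>g. graph_class H (pullback G H F g)) ` graph_class G a = {graph_class H (pullback G H F a)}"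
    by blast
  then show ?thesis unfolding graph_group_map_def by simp
qed

section \<open>Limit groups\<close>

context graph_tower
begin

abbreviation EdgeFun :: "nat \<Rightarrow> ('e \<Rightarrow> int) set" where
  "EdgeFun k \<equiv> carrier (edge_functions (X k))"

abbreviation limit_rel :: "((nat \<times> ('e \<Rightarrow> int) set) \<times> (nat \<times> ('e \<Rightarrow> int) set)) set" where
  "limit_rel \<equiv> direct_limit_rel (\<lambda>k. graph_group (X k)) (\<lambda>k. graph_group_map (X k) (X (Suc k)) (f (Suc k)))"

definition limit_class :: "nat \<Rightarrow> ('e \<Rightarrow> int) \<Rightarrow> (nat \<times> ('e \<Rightarrow> int) set) set" where
  "limit_class k g = limit_rel `` {(k, graph_class (X k) g)}"

lemma pull_carrier: "k \<le> m \<Longrightarrow> pull k m g \<in> EdgeFun m"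
  unfolding pull_def by (rule graph_cover.pullback_carrier[OF cover])

lemma pull_id:
  assumes "g \<in> EdgeFun k"
  shows "pull k k g = g"
proof (rule PiE_ext)
  show "pull k k g \<in> (\<Pi>\<^sub>E e\<in>gedges (X k). UNIV)" "g \<in> (\<Pi>\<^sub>E e\<in>gedges (X k). UNIV)"
    using pull_carrier[of k k g] assms by (simp_all add: X.carrier_edge_functions)
qed (rule pull_self)

lemma transition_class:
  assumes g: "g \<in> EdgeFun k" and "k \<le> m"
  shows "transition (\<lambda>k. graph_group_map (X k) (X (Suc k)) (f (Suc k))) k m (graph_class (X k) g) =
    graph_class (X m) (pull k m g)"
  using assms(2)
proof (induction m rule: dec_induct)
  case base
  have "transition (\<lambda>k. graph_group_map (X k) (X (Suc k)) (f (Suc k))) k k = id" by (cases k) auto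
  then show ?case using pull_id[OF g] by simp
next
  case (step m)
  have "pull k (Suc m) g = pull m (Suc m) (pull k m g)" using step(1) by (rule pull_compose) simp
  also have "\<dots> = pullback (X m) (X (Suc m)) (f (Suc m)) (pull k m g)" by (simp add: pull_def)
  finally show ?case
    using step graph_cover.graph_group_map_class[OF bond pull_carrier[OF step(1)]] by simp
qed

text \<open>The bridge from algebra to topology. A coboundary has a null-homotopic angle;
  conversely, by \<open>lim_angle_null\<close>, a difference with null-homotopic angle becomes a
  coboundary at a deeper level, which is equality in the direct limit.\<close>

lemma lim_angle_eq_iff:
  assumes g: "g \<in> EdgeFun k" and g': "g' \<in> EdgeFun l"
  shows "((k, graph_class (X k) g), (l, graph_class (X l) g')) \<in> limit_rel \<longleftrightarrow>
    circle_equiv Y (lim_angle k g) (lim_angle l g')"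
proof
  assume "((k, graph_class (X k) g), (l, graph_class (X l) g')) \<in> limit_rel"
  then obtain m where m: "k \<le> m" "l \<le> m" "graph_class (X m) (pull k m g) = graph_class (X m) (pull l m g')"
    using transition_class[OF g] transition_class[OF g'] by (auto simp: direct_limit_rel_def)
  then obtain \<rho> where \<rho>: "\<forall>e\<in>gedges (X m). pull k m g e - pull l m g' e = \<rho> (gparam (X m) e 1) - \<rho> (gparam (X m) e 0)"
    using X.graph_class_eq_iff[OF pull_carrier[OF m(1)] pull_carrier[OF m(2)]] by blast
  define b where "b e = pull k m g e - pull l m g' e" for e
  obtain w where w: "continuous_map (gspace (X m)) euclideanreal w"
    "\<And>x. x \<in> topspace (gspace (X m)) \<Longrightarrow> angle (X m) b x - w x \<in> \<int>"
    using X.angle_coboundary[of m b \<rho>] \<rho> unfolding b_def by blast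
  have "continuous_map Y euclideanreal (\<lambda>x. w (x m))"
    by (rule continuous_map_of_proj[OF w(1)])
  moreover have "lim_angle m (pull k m g) x - lim_angle m (pull l m g') x - w (x m) \<in> \<int>" if x: "x \<in> topspace Y" for x
  proof -
    have xm: "x m \<in> topspace (gspace (X m))" using x topspace_Y by blast
    have "angle (X m) b (x m) = of_int 1 * angle (X m) (pull k m g) (x m) + of_int (-1) * angle (X m) (pull l m g') (x m)"
      by (rule X.angle_add[OF xm]) (simp add: b_def)
    then show ?thesis using w(2)[OF xm] by (simp add: lim_angle_def)
  qed
  ultimately have "circle_equiv Y (lim_angle m (pull k m g)) (lim_angle m (pull l m g'))"
    unfolding circle_equiv_def by blast
  then show "circle_equiv Y (lim_angle k g) (lim_angle l g')"
    using circle_equiv_pull[OF m(1)] circle_equiv_pull[OF m(2)] circle_equiv_trans circle_equiv_sym by metis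
next
  assume eq: "circle_equiv Y (lim_angle k g) (lim_angle l g')"
  define n where "n = max k l"
  have kn: "k \<le> n" "l \<le> n" by (auto simp: n_def)
  define b where "b e = pull k n g e - pull l n g' e" for e
  have "circle_equiv Y (lim_angle n (pull k n g)) (lim_angle n (pull l n g'))"
    using eq circle_equiv_pull[OF kn(1)] circle_equiv_pull[OF kn(2)] circle_equiv_trans circle_equiv_sym by metis
  from circle_equiv_linear[OF this circle_equiv_refl[of Y "lim_angle n (pull l n g')"], of 1 "-1"]
  have "circle_equiv Y (\<lambda>x. lim_angle n (pull k n g) x - lim_angle n (pull l n g') x) (\<lambda>_. 0)" by simp
  moreover have "lim_angle n (pull k n g) x - lim_angle n (pull l n g') x = lim_angle n b x" if x: "x \<in> topspace Y" for x
  proof -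
    have xn: "x n \<in> topspace (gspace (X n))" using x topspace_Y by blast
    have "angle (X n) b (x n) = of_int 1 * angle (X n) (pull k n g) (x n) + of_int (-1) * angle (X n) (pull l n g') (x n)"
      by (rule X.angle_add[OF xn]) (simp add: b_def)
    then show ?thesis by (simp add: lim_angle_def)
  qed
  ultimately have "circle_equiv Y (lim_angle n b) (\<lambda>_. 0)" by (rule circle_equiv_cong) simp_all
  then obtain m \<rho> where m: "n \<le> m"
    and \<rho>: "\<And>e. e \<in> gedges (X m) \<Longrightarrow> pull n m b e = \<rho> (gparam (X m) e 1) - \<rho> (gparam (X m) e 0)"
    using lim_angle_null by blast
  have km: "k \<le> m" "l \<le> m" using kn m by auto
  have "pull k m g e - pull l m g' e = pull n m b e" if e: "e \<in> gedges (X m)" for e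
  proof -
    have "pull n m b e = (\<Sum>e'\<leftarrow>edge_path (X n) (bonding f n m \<circ> gparam (X m) e). pull k n g e' - pull l n g' e')"
      unfolding pull_def[of n] graph_cover.pullback_eq[OF cover[OF m] e] b_def ..
    also have "\<dots> = pull n m (pull k n g) e - pull n m (pull l n g') e"
      unfolding pull_def[of n] graph_cover.pullback_eq[OF cover[OF m] e] by (rule sum_list_subtractf)
    finally show ?thesis using pull_compose[OF kn(1) m] pull_compose[OF kn(2) m] by simp
  qed
  then have "graph_class (X m) (pull k m g) = graph_class (X m) (pull l m g')"
    using X.graph_class_eq_iff[OF pull_carrier[OF km(1)] pull_carrier[OF km(2)]] \<rho> by auto
  then show "((k, graph_class (X k) g), (l, graph_class (X l) g')) \<in> limit_rel"
    using transition_class[OF g km(1)] transition_class[OF g' km(2)] km g g' X.carrier_graph_group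
    by (auto simp: direct_limit_rel_def)
qed

lemma limit_rel_cases:
  assumes "(p, q) \<in> limit_rel"
  obtains k g l g' where "g \<in> EdgeFun k" "g' \<in> EdgeFun l" "p = (k, graph_class (X k) g)" "q = (l, graph_class (X l) g')"
  using assms X.carrier_graph_group by (auto simp: direct_limit_rel_def)

lemma limit_class_mem:
  assumes "g \<in> EdgeFun k"
  shows "p \<in> limit_class k g \<longleftrightarrow>
    (\<exists>l g'. g' \<in> EdgeFun l \<and> p = (l, graph_class (X l) g') \<and> circle_equiv Y (lim_angle k g) (lim_angle l g'))"
proof
  assume "p \<in> limit_class k g"
  then have r: "((k, graph_class (X k) g), p) \<in> limit_rel" by (simp add: limit_class_def)
  then obtain l g' where "g' \<in> EdgeFun l" "p = (l, graph_class (X l) g')" by (elim limit_rel_cases) blast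
  then show "\<exists>l g'. g' \<in> EdgeFun l \<and> p = (l, graph_class (X l) g') \<and> circle_equiv Y (lim_angle k g) (lim_angle l g')"
    using lim_angle_eq_iff[OF assms, of g' l] r by blast
next
  assume "\<exists>l g'. g' \<in> EdgeFun l \<and> p = (l, graph_class (X l) g') \<and> circle_equiv Y (lim_angle k g) (lim_angle l g')"
  then show "p \<in> limit_class k g" using lim_angle_eq_iff[OF assms] by (auto simp: limit_class_def)
qed

lemma limit_class_self: "g \<in> EdgeFun k \<Longrightarrow> (k, graph_class (X k) g) \<in> limit_class k g"
  using lim_angle_eq_iff circle_equiv_refl by (simp add: limit_class_def)

lemma limit_class_eq_iff:
  assumes g: "g \<in> EdgeFun k" and g': "g' \<in> EdgeFun l"
  shows "limit_class k g = limit_class l g' \<longleftrightarrow> circle_equiv Y (lim_angle k g) (lim_angle l g')"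
proof
  assume "limit_class k g = limit_class l g'"
  moreover have "(l, graph_class (X l) g') \<in> limit_class l g'"
    by (rule limit_class_self[OF g'])
  ultimately have "(l, graph_class (X l) g') \<in> limit_class k g" by simp
  then show "circle_equiv Y (lim_angle k g) (lim_angle l g')"
    using lim_angle_eq_iff[OF g g'] by (simp add: limit_class_def)
next
  assume "circle_equiv Y (lim_angle k g) (lim_angle l g')"
  then have "circle_equiv Y (lim_angle k g) V \<longleftrightarrow> circle_equiv Y (lim_angle l g') V" for V
    using circle_equiv_trans circle_equiv_sym by metis
  then show "limit_class k g = limit_class l g'"
    unfolding set_eq_iff limit_class_mem[OF g] limit_class_mem[OF g'] by simp
qed

lemma limit_class_pull:
  "g \<in> EdgeFun k \<Longrightarrow> k \<le> m \<Longrightarrow> limit_class k g = limit_class m (pull k m g)"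
  using limit_class_eq_iff[OF _ pull_carrier] circle_equiv_pull by blast

lemma carrier_limit_group: "carrier (limit_group X f) = {limit_class k g | k g. g \<in> EdgeFun k}"
  by (auto simp: limit_group_def direct_limit_def quotient_def limit_class_def X.carrier_graph_group)

lemma standard_cone_eq:
  "standard_cone X f = {limit_class k g | k g. g \<in> EdgeFun k \<and> (\<forall>e\<in>gedges (X k). 0 \<le> g e)}"
  by (auto simp: standard_cone_def direct_limit_cone_def limit_class_def graph_cone_def nonneg_edge_functions_def)

lemma lim_angle_mult:
  assumes "x \<in> topspace Y"
  shows "lim_angle k (g \<otimes>\<^bsub>edge_functions (X k)\<^esub> g') x = lim_angle k g x + lim_angle k g' x"
proof -
  have xk: "x k \<in> topspace (gspace (X k))" using assms topspace_Y by blast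
  have "angle (X k) (g \<otimes>\<^bsub>edge_functions (X k)\<^esub> g') (x k) = of_int 1 * angle (X k) g (x k) + of_int 1 * angle (X k) g' (x k)"
    by (rule X.angle_add[OF xk]) (simp add: X.mult_edge_functions)
  then show ?thesis by (simp add: lim_angle_def)
qed

text \<open>The product in \<open>direct_limit\<close> runs over all pairs of representatives at a
  common level. Angles are additive, so every such pair gives the same homotopy class.\<close>

lemma mult_limit_class:
  assumes g: "g \<in> EdgeFun k" and g': "g' \<in> EdgeFun k"
  shows "limit_class k g \<otimes>\<^bsub>limit_group X f\<^esub> limit_class k g' = limit_class k (g \<otimes>\<^bsub>edge_functions (X k)\<^esub> g')"
proof -
  let ?S = "{(m, x \<otimes>\<^bsub>graph_group (X m)\<^esub> y) | m x y. (m, x) \<in> limit_class k g \<and> (m, y) \<in> limit_class k g'}"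
  have image: "limit_rel `` S = C" if "\<And>p. p \<in> S \<Longrightarrow> limit_rel `` {p} = C" "S \<noteq> {}" for S C
    using that by blast
  have gg: "g \<otimes>\<^bsub>edge_functions (X k)\<^esub> g' \<in> EdgeFun k" using g g' X.EF.m_closed by blast
  have mult: "limit_class k g \<otimes>\<^bsub>limit_group X f\<^esub> limit_class k g' = limit_rel `` ?S"
    by (simp add: limit_group_def direct_limit_def)
  have "limit_rel `` {p} = limit_class k (g \<otimes>\<^bsub>edge_functions (X k)\<^esub> g')" if p: "p \<in> ?S" for p
  proof -
    obtain m x y where xy: "p = (m, x \<otimes>\<^bsub>graph_group (X m)\<^esub> y)" "(m, x) \<in> limit_class k g" "(m, y) \<in> limit_class k g'"
      using p by blast
    obtain a b where a: "a \<in> EdgeFun m" "x = graph_class (X m) a" "circle_equiv Y (lim_angle k g) (lim_angle m a)"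
      and b: "b \<in> EdgeFun m" "y = graph_class (X m) b" "circle_equiv Y (lim_angle k g') (lim_angle m b)"
      using xy(2,3) unfolding limit_class_mem[OF g] limit_class_mem[OF g'] by auto
    have ab: "a \<otimes>\<^bsub>edge_functions (X m)\<^esub> b \<in> EdgeFun m" using a b X.EF.m_closed by blast
    have "circle_equiv Y (\<lambda>z. lim_angle m a z + lim_angle m b z) (\<lambda>z. lim_angle k g z + lim_angle k g' z)"
      using circle_equiv_linear[OF circle_equiv_sym[OF a(3)] circle_equiv_sym[OF b(3)], of 1 1] by simp
    then have "circle_equiv Y (lim_angle m (a \<otimes>\<^bsub>edge_functions (X m)\<^esub> b)) (lim_angle k (g \<otimes>\<^bsub>edge_functions (X k)\<^esub> g'))"
      by (rule circle_equiv_cong) (simp_all add: lim_angle_mult)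
    then have "limit_class m (a \<otimes>\<^bsub>edge_functions (X m)\<^esub> b) = limit_class k (g \<otimes>\<^bsub>edge_functions (X k)\<^esub> g')"
      using limit_class_eq_iff[OF ab gg] by blast
    then show ?thesis using xy(1) a(2) b(2) X.mult_graph_group[OF a(1) b(1)] by (simp add: limit_class_def)
  qed
  moreover have "?S \<noteq> {}"
  proof -
    have "(k, graph_class (X k) g \<otimes>\<^bsub>graph_group (X k)\<^esub> graph_class (X k) g') \<in> ?S"
      using limit_class_self[OF g] limit_class_self[OF g'] by blast
    then show ?thesis by (metis empty_iff)
  qed
  ultimately show ?thesis unfolding mult by (rule image)
qed

lemma common_level:
  assumes "A \<in> carrier (limit_group X f)" "B \<in> carrier (limit_group X f)"
  obtains k a b where "a \<in> EdgeFun k" "b \<in> EdgeFun k" "A = limit_class k a" "B = limit_class k b"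
proof -
  obtain k a l b where "a \<in> EdgeFun k" "A = limit_class k a" "b \<in> EdgeFun l" "B = limit_class l b"
    using assms unfolding carrier_limit_group by blast
  then have AB: "A = limit_class (max k l) (pull k (max k l) a)" "B = limit_class (max k l) (pull l (max k l) b)"
    using limit_class_pull by simp_all
  show ?thesis by (rule that[OF pull_carrier[OF max.cobounded1] pull_carrier[OF max.cobounded2] AB])
qed

text \<open>Pulling back along the identity changes no value on an edge; it makes \<open>g\<close>
  extensional and so an element of the carrier.\<close>

lemma lim_angle_onto_carrier:
  assumes "continuous_map Y euclidean (\<lambda>x. cis (2 * pi * U x))"
  obtains n g where "g \<in> EdgeFun n" "circle_equiv Y U (lim_angle n g)"
proof -
  obtain n g where g: "circle_equiv Y U (lim_angle n g)" using lim_angle_onto[OF assms] .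
  have "circle_equiv Y U (lim_angle n (pull n n g))"
    by (rule circle_equiv_trans[OF g circle_equiv_pull]) simp
  then show ?thesis using that pull_carrier by blast
qed

end

section \<open>The order isomorphism\<close>

text \<open>A class has no preferred level or representative, so the isomorphism is easier to
  describe as a relation between representatives than as a function.\<close>

lemma iso_from_relation:
  assumes total: "\<And>a. a \<in> carrier G \<Longrightarrow> \<exists>b\<in>carrier H. R a b"
    and onto: "\<And>b. b \<in> carrier H \<Longrightarrow> \<exists>a\<in>carrier G. R a b"
    and functional: "\<And>a b b'. R a b \<Longrightarrow> R a b' \<Longrightarrow> b = b'"
    and injective: "\<And>a a' b. R a b \<Longrightarrow> R a' b \<Longrightarrow> a = a'"
    and mult: "\<And>a a' b b'. a \<in> carrier G \<Longrightarrow> a' \<in> carrier G \<Longrightarrow> R a b \<Longrightarrow> R a' b' \<Longrightarrow>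
      a \<otimes>\<^bsub>G\<^esub> a' \<in> carrier G \<and> R (a \<otimes>\<^bsub>G\<^esub> a') (b \<otimes>\<^bsub>H\<^esub> b')"
  shows "\<exists>\<phi>\<in>iso G H. \<forall>a\<in>carrier G. R a (\<phi> a)"
proof -
  obtain \<phi> where \<phi>: "\<And>a. a \<in> carrier G \<Longrightarrow> \<phi> a \<in> carrier H \<and> R a (\<phi> a)" using total by metis
  have "\<phi> \<in> hom G H"
  proof (rule homI)
    fix a a' assume a: "a \<in> carrier G" "a' \<in> carrier G"
    then have "a \<otimes>\<^bsub>G\<^esub> a' \<in> carrier G" "R (a \<otimes>\<^bsub>G\<^esub> a') (\<phi> a \<otimes>\<^bsub>H\<^esub> \<phi> a')"
      using mult[OF a] \<phi> by blast+
    then show "\<phi> (a \<otimes>\<^bsub>G\<^esub> a') = \<phi> a \<otimes>\<^bsub>H\<^esub> \<phi> a'" using \<phi> functional by blast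
  qed (use \<phi> in blast)
  moreover have "bij_betw \<phi> (carrier G) (carrier H)"
    unfolding bij_betw_def
  proof
    show "inj_on \<phi> (carrier G)" using \<phi> injective by (metis inj_onI)
    show "\<phi> ` carrier G = carrier H"
    proof
      show "\<phi> ` carrier G \<subseteq> carrier H" using \<phi> by blast
      show "carrier H \<subseteq> \<phi> ` carrier G"
      proof
        fix b assume "b \<in> carrier H"
        then obtain a where "a \<in> carrier G" "R a b" using onto by blast
        then show "b \<in> \<phi> ` carrier G" using \<phi> functional by blast
      qed
    qed
  qed
  ultimately have "\<phi> \<in> iso G H" by (simp add: iso_def)
  then show ?thesis using \<phi> by blast
qed

section \<open>Correspondence of classes under the homeomorphism\<close>

context tower_homeo
begin

lemma swap: "tower_homeo X2 f2 X1 f1 h' h"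
  unfolding tower_homeo_def tower_homeo_axioms_def
proof (intro conjI)
  show "homeomorphic_maps (inverse_limit X2 f2) (inverse_limit X1 f1) h' h"
    using homeo homeomorphic_maps_sym by blast
qed (rule A.graph_tower_axioms B.graph_tower_axioms simple_A simple_B)+

text \<open>The sign is built into the relation, so that nonnegative classes can correspond to
  nonnegative ones even if the homeomorphism reverses directions.\<close>

definition corresponds :: "int \<Rightarrow> nat \<Rightarrow> ('e1 \<Rightarrow> int) \<Rightarrow> nat \<Rightarrow> ('e2 \<Rightarrow> int) \<Rightarrow> bool" where
  "corresponds s k a l b \<longleftrightarrow>
     circle_equiv A.Y (A.lim_angle k a) (\<lambda>x. of_int s * B.lim_angle l b (h x))"

text \<open>As \<open>s * s = 1\<close>, the sign can be moved to the other side. This makes the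
  relation symmetric under the exchange of the two towers.\<close>

lemma corresponds_iff:
  assumes s: "s = 1 \<or> s = -1"
  shows "corresponds s k a l b \<longleftrightarrow>
    circle_equiv B.Y (\<lambda>y. of_int s * A.lim_angle k a (h' y)) (B.lim_angle l b)"
proof
  have ss: "of_int s * (of_int s * u) = (u::real)" for u using s by auto
  assume "corresponds s k a l b"
  from circle_equiv_compose[OF this[unfolded corresponds_def] homeomorphism(2)]
  have 1: "circle_equiv B.Y (\<lambda>y. A.lim_angle k a (h' y)) (\<lambda>y. of_int s * B.lim_angle l b (h (h' y)))"
    by (simp add: o_def)
  from circle_equiv_linear[OF 1 1, of s 0]
  show "circle_equiv B.Y (\<lambda>y. of_int s * A.lim_angle k a (h' y)) (B.lim_angle l b)"
    by (rule circle_equiv_cong) (simp_all add: ss homeomorphism(4))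
next
  have ss: "of_int s * (of_int s * u) = (u::real)" for u using s by auto
  assume "circle_equiv B.Y (\<lambda>y. of_int s * A.lim_angle k a (h' y)) (B.lim_angle l b)"
  from circle_equiv_compose[OF this homeomorphism(1)]
  have 1: "circle_equiv A.Y (\<lambda>x. of_int s * A.lim_angle k a (h' (h x))) (\<lambda>x. B.lim_angle l b (h x))"
    by (simp add: o_def)
  from circle_equiv_linear[OF 1 1, of s 0]
  have "circle_equiv A.Y (A.lim_angle k a) (\<lambda>x. of_int s * B.lim_angle l b (h x))"
    by (rule circle_equiv_cong) (simp_all add: ss homeomorphism(3))
  then show "corresponds s k a l b" by (simp add: corresponds_def)
qed

lemma corresponds_right:
  obtains k a where "a \<in> A.EdgeFun k" "corresponds s k a l b"
proof -
  have "continuous_map A.Y euclidean (\<lambda>x. cis (2 * pi * B.lim_angle l b (h x)))"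
    using continuous_map_compose[OF homeomorphism(1) B.continuous_map_cis_lim_angle] by (simp add: o_def)
  from A.lim_angle_onto_carrier[OF this] obtain k a where
    a: "circle_equiv A.Y (\<lambda>x. B.lim_angle l b (h x)) (A.lim_angle k a)" by blast
  \<comment> \<open>Multiplication by \<open>s\<close> is compatible with homotopy, so the function
    is homotopic to the angle of \<open>\<lambda>e. s * a e\<close> and thus continuous modulo
    \<int>.\<close>
  have "continuous_map A.Y euclidean (\<lambda>x. cis (2 * pi * (of_int s * B.lim_angle l b (h x))))"
  proof (rule circle_equiv_imp_continuous)
    show "circle_equiv A.Y (\<lambda>x. of_int s * B.lim_angle l b (h x)) (A.lim_angle k (\<lambda>e. s * a e))"
    proof (rule circle_equiv_cong[OF circle_equiv_linear[OF a a, of s 0]])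
      fix x assume "x \<in> topspace A.Y"
      then have "x k \<in> topspace (gspace (X1 k))" using A.topspace_Y by blast
      from A.X.angle_add[OF this, of "\<lambda>e. s * a e" s a 0 a]
      show "of_int s * A.lim_angle k a x + of_int 0 * A.lim_angle k a x = A.lim_angle k (\<lambda>e. s * a e) x"
        by (simp add: A.lim_angle_def)
    qed simp
  qed (rule A.continuous_map_cis_lim_angle)
  from A.lim_angle_onto_carrier[OF this] show ?thesis
    using that circle_equiv_sym unfolding corresponds_def by metis
qed

lemma corresponds_left:
  assumes s: "s = 1 \<or> s = -1"
  obtains l b where "b \<in> B.EdgeFun l" "corresponds s k a l b"
proof -
  interpret S: tower_homeo X2 f2 X1 f1 h' h by (rule swap)
  obtain l b where "b \<in> B.EdgeFun l" "S.corresponds s l b k a"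
    by (rule S.corresponds_right)
  then show ?thesis
    using that corresponds_iff[OF s] circle_equiv_sym unfolding S.corresponds_def by blast
qed

lemma limit_group_order_iso:
  "order_isomorphic (limit_group X1 f1) (standard_cone X1 f1) (limit_group X2 f2) (standard_cone X2 f2)"
proof -
  interpret S: tower_homeo X2 f2 X1 f1 h' h by (rule swap)
  obtain s :: int where s: "s = 1 \<or> s = -1"
    and cone: "\<And>k g. \<forall>e\<in>gedges (X2 k). 0 \<le> g e \<Longrightarrow> \<exists>N q. (\<forall>e\<in>gedges (X1 N). 0 \<le> q e) \<and>
       circle_equiv A.Y (\<lambda>x. of_int s * B.lim_angle k g (h x)) (A.lim_angle N q)"
    using cone_transfer by blast
  \<comment> \<open>The transfer in the other direction has a sign of its own, which is not yet
    known to agree with \<open>s\<close>.\<close>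
  obtain s' :: int where s': "s' = 1 \<or> s' = -1"
    and cone': "\<And>k g. \<forall>e\<in>gedges (X1 k). 0 \<le> g e \<Longrightarrow> \<exists>N q. (\<forall>e\<in>gedges (X2 N). 0 \<le> q e) \<and>
       circle_equiv B.Y (\<lambda>x. of_int s' * A.lim_angle k g (h' x)) (B.lim_angle N q)"
    using S.cone_transfer by blast
  define R where "R u v \<longleftrightarrow> (\<exists>k a l b. a \<in> A.EdgeFun k \<and> b \<in> B.EdgeFun l \<and>
    u = A.limit_class k a \<and> v = B.limit_class l b \<and> corresponds s k a l b)" for u v
  have RI: "R (A.limit_class k a) (B.limit_class l b)"
    if "a \<in> A.EdgeFun k" "b \<in> B.EdgeFun l" "corresponds s k a l b" for k a l b
    unfolding R_def using that by blast
  have R_iff: "corresponds s k a l b"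
    if R: "R (A.limit_class k a) (B.limit_class l b)" and a: "a \<in> A.EdgeFun k" and b: "b \<in> B.EdgeFun l" for k a l b
  proof -
    obtain k' a' l' b' where *: "a' \<in> A.EdgeFun k'" "b' \<in> B.EdgeFun l'"
      "A.limit_class k a = A.limit_class k' a'" "B.limit_class l b = B.limit_class l' b'" "corresponds s k' a' l' b'"
      using R unfolding R_def by blast
    have 1: "circle_equiv A.Y (A.lim_angle k a) (A.lim_angle k' a')"
      using A.limit_class_eq_iff[OF a *(1)] *(3) by simp
    have "circle_equiv B.Y (B.lim_angle l' b') (B.lim_angle l b)"
      using B.limit_class_eq_iff[OF b *(2)] *(4) circle_equiv_sym by simp
    from circle_equiv_compose[OF this homeomorphism(1)]
    have 2: "circle_equiv A.Y (\<lambda>x. B.lim_angle l' b' (h x)) (\<lambda>x. B.lim_angle l b (h x))" by (simp add: o_def)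
    have "circle_equiv A.Y (\<lambda>x. of_int s * B.lim_angle l' b' (h x)) (\<lambda>x. of_int s * B.lim_angle l b (h x))"
      using circle_equiv_linear[OF 2 2, of s 0] by simp
    then show ?thesis
      using circle_equiv_trans[OF 1] *(5) circle_equiv_trans unfolding corresponds_def by blast
  qed
  have "\<exists>\<phi>\<in>iso (limit_group X1 f1) (limit_group X2 f2). \<forall>u\<in>carrier (limit_group X1 f1). R u (\<phi> u)"
  proof (rule iso_from_relation)
    fix u assume "u \<in> carrier (limit_group X1 f1)"
    then obtain k a where a: "a \<in> A.EdgeFun k" "u = A.limit_class k a" unfolding A.carrier_limit_group by blast
    obtain l b where b: "b \<in> B.EdgeFun l" "corresponds s k a l b" using corresponds_left[OF s] .
    then show "\<exists>v\<in>carrier (limit_group X2 f2). R u v"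
      using RI[OF a(1) b] a(2) unfolding B.carrier_limit_group by blast
  next
    fix v assume "v \<in> carrier (limit_group X2 f2)"
    then obtain l b where b: "b \<in> B.EdgeFun l" "v = B.limit_class l b" unfolding B.carrier_limit_group by blast
    obtain k a where a: "a \<in> A.EdgeFun k" "corresponds s k a l b" by (rule corresponds_right)
    then show "\<exists>u\<in>carrier (limit_group X1 f1). R u v"
      using RI[OF a(1) b(1) a(2)] b(2) unfolding A.carrier_limit_group by blast
  next
    fix u v v' assume "R u v" "R u v'"
    then obtain k a l b l' b' where *: "a \<in> A.EdgeFun k" "b \<in> B.EdgeFun l" "u = A.limit_class k a" "v = B.limit_class l b"
      "corresponds s k a l b" "b' \<in> B.EdgeFun l'" "v' = B.limit_class l' b'"
      unfolding R_def by blast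
    then have "corresponds s k a l' b'" using R_iff[of k a l' b'] \<open>R u v'\<close> by simp
    then have "circle_equiv B.Y (B.lim_angle l b) (B.lim_angle l' b')"
      using *(5) unfolding corresponds_iff[OF s] using circle_equiv_sym circle_equiv_trans by blast
    then show "v = v'" using B.limit_class_eq_iff[OF *(2,6)] * by simp
  next
    fix u u' v assume "R u v" "R u' v"
    then obtain k a l b k' a' where *: "a \<in> A.EdgeFun k" "b \<in> B.EdgeFun l" "u = A.limit_class k a" "v = B.limit_class l b"
      "corresponds s k a l b" "a' \<in> A.EdgeFun k'" "u' = A.limit_class k' a'"
      unfolding R_def by blast
    then have "corresponds s k' a' l b" using R_iff[of k' a' l b] \<open>R u' v\<close> by simp
    then have "circle_equiv A.Y (A.lim_angle k a) (A.lim_angle k' a')"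
      using *(5) unfolding corresponds_def using circle_equiv_sym circle_equiv_trans by blast
    then show "u = u'" using A.limit_class_eq_iff[OF *(1,6)] * by simp
  next
    fix u u' v v' assume u: "u \<in> carrier (limit_group X1 f1)" "u' \<in> carrier (limit_group X1 f1)" and R: "R u v" "R u' v'"
    obtain k a a' where a: "a \<in> A.EdgeFun k" "a' \<in> A.EdgeFun k" "u = A.limit_class k a" "u' = A.limit_class k a'"
      by (rule A.common_level[OF u])
    have "v \<in> carrier (limit_group X2 f2)" "v' \<in> carrier (limit_group X2 f2)"
      using R unfolding R_def B.carrier_limit_group by blast+
    then obtain l b b' where b: "b \<in> B.EdgeFun l" "b' \<in> B.EdgeFun l" "v = B.limit_class l b" "v' = B.limit_class l b'"
      by (rule B.common_level)
    have c: "corresponds s k a l b" "corresponds s k a' l b'" using R_iff R a b by blast+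
    let ?a = "a \<otimes>\<^bsub>edge_functions (X1 k)\<^esub> a'" and ?b = "b \<otimes>\<^bsub>edge_functions (X2 l)\<^esub> b'"
    have ab: "?a \<in> A.EdgeFun k" "?b \<in> B.EdgeFun l" using a b A.X.EF.m_closed B.X.EF.m_closed by blast+
    have "circle_equiv A.Y (A.lim_angle k ?a) (\<lambda>x. of_int s * B.lim_angle l ?b (h x))"
      by (rule circle_equiv_cong[OF circle_equiv_linear[OF c[unfolded corresponds_def], of 1 1]])
        (simp_all add: A.lim_angle_mult B.lim_angle_mult homeomorphism(5) distrib_left)
    then have "R (A.limit_class k ?a) (B.limit_class l ?b)" using RI[OF ab] by (simp add: corresponds_def)
    then show "u \<otimes>\<^bsub>limit_group X1 f1\<^esub> u' \<in> carrier (limit_group X1 f1) \<and>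
        R (u \<otimes>\<^bsub>limit_group X1 f1\<^esub> u') (v \<otimes>\<^bsub>limit_group X2 f2\<^esub> v')"
      unfolding a(3,4) b(3,4) A.mult_limit_class[OF a(1,2)] B.mult_limit_class[OF b(1,2)]
      using ab(1) A.carrier_limit_group by blast
  qed
  then obtain \<phi> where \<phi>: "\<phi> \<in> iso (limit_group X1 f1) (limit_group X2 f2)"
    "\<And>u. u \<in> carrier (limit_group X1 f1) \<Longrightarrow> R u (\<phi> u)" by blast
  have \<phi>_eq: "\<phi> (A.limit_class k a) = B.limit_class l b"
    if a: "a \<in> A.EdgeFun k" and b: "b \<in> B.EdgeFun l" and c: "corresponds s k a l b" for k a l b
  proof -
    have u: "A.limit_class k a \<in> carrier (limit_group X1 f1)" using a A.carrier_limit_group by blast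
    obtain l' b' where b': "b' \<in> B.EdgeFun l'" "\<phi> (A.limit_class k a) = B.limit_class l' b'"
      using \<phi>(2)[OF u] unfolding R_def by blast
    have "corresponds s k a l' b'" using R_iff[OF _ a b'(1)] \<phi>(2)[OF u] b'(2) by simp
    then have "circle_equiv B.Y (B.lim_angle l' b') (B.lim_angle l b)"
      using c unfolding corresponds_iff[OF s] using circle_equiv_sym circle_equiv_trans by blast
    then show ?thesis using B.limit_class_eq_iff[OF b'(1) b] b'(2) by simp
  qed
  \<comment> \<open>The functions obtained from \<open>cone\<close> are controlled on edges only;
    this gives an extensional representative with the same values there.\<close>
  have restrict_A: "\<exists>q'. q' \<in> A.EdgeFun N \<and> (\<forall>e\<in>gedges (X1 N). 0 \<le> q' e) \<and>
      circle_equiv A.Y (A.lim_angle N q) (A.lim_angle N q')" if "\<forall>e\<in>gedges (X1 N). 0 \<le> q e" for N q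
    using A.pull_carrier[of N N q] A.pull_self[of _ N q] A.circle_equiv_pull[of N N q] that by auto
  have restrict_B: "\<exists>q'. q' \<in> B.EdgeFun N \<and> (\<forall>e\<in>gedges (X2 N). 0 \<le> q' e) \<and>
      circle_equiv B.Y (B.lim_angle N q) (B.lim_angle N q')" if "\<forall>e\<in>gedges (X2 N). 0 \<le> q e" for N q
    using B.pull_carrier[of N N q] B.pull_self[of _ N q] B.circle_equiv_pull[of N N q] that by auto
  have down: "\<exists>N q. q \<in> A.EdgeFun N \<and> (\<forall>e\<in>gedges (X1 N). 0 \<le> q e) \<and> corresponds s N q l b"
    if nn: "\<forall>e\<in>gedges (X2 l). 0 \<le> b e" for l b
  proof -
    obtain N q where q: "\<forall>e\<in>gedges (X1 N). 0 \<le> q e"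
      "circle_equiv A.Y (\<lambda>x. of_int s * B.lim_angle l b (h x)) (A.lim_angle N q)" using cone[OF nn] by blast
    obtain q' where "q' \<in> A.EdgeFun N" "\<forall>e\<in>gedges (X1 N). 0 \<le> q' e"
      "circle_equiv A.Y (A.lim_angle N q) (A.lim_angle N q')" using restrict_A[OF q(1)] by blast
    then show ?thesis
      using circle_equiv_sym[OF circle_equiv_trans[OF q(2)]] unfolding corresponds_def by blast
  qed
  have up: "\<exists>N q. q \<in> B.EdgeFun N \<and> (\<forall>e\<in>gedges (X2 N). 0 \<le> q e) \<and> corresponds s' k a N q"
    if nn: "\<forall>e\<in>gedges (X1 k). 0 \<le> a e" for k a
  proof -
    obtain N q where q: "\<forall>e\<in>gedges (X2 N). 0 \<le> q e"
      "circle_equiv B.Y (\<lambda>y. of_int s' * A.lim_angle k a (h' y)) (B.lim_angle N q)" using cone'[OF nn] by blast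
    obtain q' where "q' \<in> B.EdgeFun N" "\<forall>e\<in>gedges (X2 N). 0 \<le> q' e"
      "circle_equiv B.Y (B.lim_angle N q) (B.lim_angle N q')" using restrict_B[OF q(1)] by blast
    then show ?thesis
      using circle_equiv_trans[OF q(2)] unfolding corresponds_iff[OF s'] by blast
  qed
  have up_s: "\<exists>N q. q \<in> B.EdgeFun N \<and> (\<forall>e\<in>gedges (X2 N). 0 \<le> q e) \<and> corresponds s k a N q"
    if nn: "\<forall>e\<in>gedges (X1 k). 0 \<le> a e" for k a
  proof (cases "s' = s")
    case True
    then show ?thesis using up[OF nn] by simp
  next
    \<comment> \<open>Here \<open>s' = - s\<close>. Moving \<open>a\<close> over to
      \<open>b\<close>, back to \<open>c\<close> and over again to \<open>q\<close> gives, up to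
      homotopy and with \<open>h\<close> omitted, \<open>a = - s * b\<close>,
      \<open>c = s * b\<close> and \<open>c = - s * q\<close>. Hence \<open>a = - c = s * q\<close>,
      with \<open>q\<close> nonnegative.\<close>
    case False
    then have neg: "of_int s' * u = - (of_int s * u)" for u :: real using s s' by auto
    obtain l b where b: "\<forall>e\<in>gedges (X2 l). 0 \<le> b e" "corresponds s' k a l b" using up[OF nn] by blast
    obtain m c where c: "\<forall>e\<in>gedges (X1 m). 0 \<le> c e" "corresponds s m c l b" using down[OF b(1)] by blast
    obtain N q where q: "q \<in> B.EdgeFun N" "\<forall>e\<in>gedges (X2 N). 0 \<le> q e" "corresponds s' m c N q"
      using up[OF c(1)] by blast
    have 1: "circle_equiv A.Y (A.lim_angle k a) (\<lambda>x. - (of_int s * B.lim_angle l b (h x)))"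
      using b(2) by (simp add: corresponds_def neg)
    have 2: "circle_equiv A.Y (\<lambda>x. - (of_int s * B.lim_angle l b (h x))) (\<lambda>x. - A.lim_angle m c x)"
      using circle_equiv_linear[OF circle_equiv_sym circle_equiv_refl, OF c(2)[unfolded corresponds_def], of "-1" 0]
      by simp
    have 3: "circle_equiv A.Y (\<lambda>x. - A.lim_angle m c x) (\<lambda>x. of_int s * B.lim_angle N q (h x))"
      using circle_equiv_linear[OF _ circle_equiv_refl, OF q(3)[unfolded corresponds_def], of "-1" 0]
      by (simp add: neg)
    have "corresponds s k a N q"
      using circle_equiv_trans[OF circle_equiv_trans[OF 1 2] 3] by (simp add: corresponds_def)
    then show ?thesis using q by blast
  qed
  have "\<phi> ` standard_cone X1 f1 = standard_cone X2 f2"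
  proof
    show "\<phi> ` standard_cone X1 f1 \<subseteq> standard_cone X2 f2"
    proof (rule image_subsetI)
      fix u assume "u \<in> standard_cone X1 f1"
      then obtain k a where a: "a \<in> A.EdgeFun k" "\<forall>e\<in>gedges (X1 k). 0 \<le> a e" "u = A.limit_class k a"
        unfolding A.standard_cone_eq by blast
      obtain N q where "q \<in> B.EdgeFun N" "\<forall>e\<in>gedges (X2 N). 0 \<le> q e" "corresponds s k a N q"
        using up_s[OF a(2)] by blast
      then show "\<phi> u \<in> standard_cone X2 f2"
        using \<phi>_eq[OF a(1)] a(3) unfolding B.standard_cone_eq by blast
    qed
    show "standard_cone X2 f2 \<subseteq> \<phi> ` standard_cone X1 f1"
    proof
      fix v assume "v \<in> standard_cone X2 f2"
      then obtain l b where b: "b \<in> B.EdgeFun l" "\<forall>e\<in>gedges (X2 l). 0 \<le> b e" "v = B.limit_class l b"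
        unfolding B.standard_cone_eq by blast
      obtain N q where q: "q \<in> A.EdgeFun N" "\<forall>e\<in>gedges (X1 N). 0 \<le> q e" "corresponds s N q l b"
        using down[OF b(2)] by blast
      then have "\<phi> (A.limit_class N q) = v" using \<phi>_eq[OF q(1) b(1) q(3)] b(3) by simp
      moreover have "A.limit_class N q \<in> standard_cone X1 f1" using q unfolding A.standard_cone_eq by blast
      ultimately show "v \<in> \<phi> ` standard_cone X1 f1" by blast
    qed
  qed
  with \<phi>(1) show ?thesis unfolding order_isomorphic_def by blast
qed

end

lemma presentation_graph_tower:
  assumes "presentation X f" "compact_space (inverse_limit X f)"
  shows "graph_tower X f"
  unfolding graph_tower_def
proof (intro conjI allI)
  fix k
  show "graph_cover (X (Suc k)) (X k) (f (Suc k))"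
    using assms(1) unfolding presentation_def graph_cover_def graph_cover_axioms_def fin_digraph_def by blast
qed (rule assms(2))

theorem corollary3p18:
  fixes X1 :: "nat \<Rightarrow> ('v1, 'e1) digraph" and f1 :: "nat \<Rightarrow> 'v1 \<Rightarrow> 'v1"
    and X2 :: "nat \<Rightarrow> ('v2, 'e2) digraph" and f2 :: "nat \<Rightarrow> 'v2 \<Rightarrow> 'v2"
  assumes "presentation X1 f1" and "presentation X2 f2"
    and "compact_space (inverse_limit X1 f1)" and "compact_space (inverse_limit X2 f2)"
    and "connected_space (inverse_limit X1 f1)" and "connected_space (inverse_limit X2 f2)"
    and "branched_matchbox_manifold (inverse_limit X1 f1)"
    and "branched_matchbox_manifold (inverse_limit X2 f2)"
    and "orientable (inverse_limit X1 f1)" and "orientable (inverse_limit X2 f2)"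
    and "simplicity_condition X1 f1" and "simplicity_condition X2 f2"
    and "inverse_limit X1 f1 homeomorphic_space inverse_limit X2 f2"
  shows "order_isomorphic (limit_group X1 f1) (standard_cone X1 f1)
           (limit_group X2 f2) (standard_cone X2 f2)"
proof -
  obtain h h' where "homeomorphic_maps (inverse_limit X1 f1) (inverse_limit X2 f2) h h'"
    using assms(13) unfolding homeomorphic_space_def by blast
  then have "tower_homeo X1 f1 X2 f2 h h'"
    unfolding tower_homeo_def tower_homeo_axioms_def
    using assms(11,12) presentation_graph_tower[OF assms(1,3)] presentation_graph_tower[OF assms(2,4)] by blast
  then show ?thesis by (rule tower_homeo.limit_group_order_iso)
qed

end
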